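(* Let $H$ be a complex Hilbert space, $J$ a signature operator in $H$ ($J=J^*=J^{-1}$), $H_\pm:=\ker(J\mp I)$, and $P_\pm$ the orthogonal projections onto $H_\pm$. Assume $L=L^*>0$ in $H$ (i.e. $(Lh,h)_H>0$ for all nonzero $h\in\operatorname{dom}(L)$) and that $B:=JL$ is similar to a self-adjoint operator in $H$. Then for each $\varphi_+\in H_+$ there is a unique solution $\psi$ of $$\frac{d\psi}{dx}=-JL\psi(x)\ (0<x<\infty),\qquad P_+\psi(0)=\varphi_+,\qquad \|\psi(x)\|_H=O(1)\ (x\to+\infty),$$ and it is given by $\psi(x)=\int_{+0}^{+\infty}e^{-xt}\,dE^B_t\,R_+\varphi_+=e^{-xB^+}R_+\varphi_+$.
   Context: Similarity: closed $T_1,T_2$ are similar if $T_2=ST_1S^{-1}$ with $S$ bounded, boundedly invertible, $S\operatorname{dom}(T_1)=\operatorname{dom}(T_2)$. A solution is $\psi\in C([0,\infty);H)$, strongly continuously differentiable on $(0,\infty)$, with $\psi(x)\in\operatorname{dom}(L)$ there, satisfying the equation and conditions. Put $[f,g]:=(Jf,g)_H$. Under the hypotheses $B$ is $J$-self-adjoint, $J$-positive, has real spectrum and a spectral function $E^B(\cdot)$; $E^B_t:=E^B((-\infty,t])$. $H^B_\pm:=E^B(\mathbb R_\pm)H$ are $B$-invariant, $J$-orthogonal, $H=H^B_+\dotplus H^B_-$, $\pm[\cdot,\cdot]$ is a Hilbert inner product on $H^B_\pm$, and $B^+:=B\upharpoonright(\operatorname{dom}(B)\cap H^B_+)$ is a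 positive self-adjoint operator in $(H^B_+,[\cdot,\cdot])$. $R_+:=(P_+\upharpoonright H^B_+)^{-1}:H_+\to H^B_+$ (this inverse exists and is a homeomorphism). *)

theory Defs
  imports "HOL-Analysis.Analysis"
begin

text \<open>A complex Hilbert space H is modelled as a real Hilbert space (type class
  real_inner + complete_space) together with an operator Ii (multiplication by i)
  which is real-linear, isometric and satisfies Ii (Ii x) = - x. The complex inner
  product (linear in the first argument) is recovered as below.\<close>

definition complex_structure :: "('h::real_inner \<Rightarrow> 'h) \<Rightarrow> bool" where
  "complex_structure Ii \<longleftrightarrow> bounded_linear Ii \<and> (\<forall>x. Ii (Ii x) = - x)
      \<and> (\<forall>x y. inner (Ii x) (Ii y) = inner x y)"

definition cinner :: "('h::real_inner \<Rightarrow> 'h) \<Rightarrow> 'h \<Rightarrow> 'h \<Rightarrow> complex" where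
  "cinner Ii x y = Complex (inner x y) (inner x (Ii y))"

definition clinear_on :: "('h::real_inner \<Rightarrow> 'h) \<Rightarrow> 'h set \<Rightarrow> ('h \<Rightarrow> 'h) \<Rightarrow> bool" where
  "clinear_on Ii D A \<longleftrightarrow> subspace D \<and> Ii ` D \<subseteq> D
      \<and> (\<forall>x\<in>D. \<forall>y\<in>D. A (x + y) = A x + A y)
      \<and> (\<forall>x\<in>D. \<forall>r. A (r *\<^sub>R x) = r *\<^sub>R A x)
      \<and> (\<forall>x\<in>D. A (Ii x) = Ii (A x))"

definition bounded_clinear_op :: "('h::real_normed_vector \<Rightarrow> 'h) \<Rightarrow> ('h \<Rightarrow> 'h) \<Rightarrow> bool" where
  "bounded_clinear_op Ii A \<longleftrightarrow> bounded_linear A \<and> (\<forall>x. A (Ii x) = Ii (A x))"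

definition selfadjoint :: "('h::real_inner \<Rightarrow> 'h) \<Rightarrow> 'h set \<Rightarrow> ('h \<Rightarrow> 'h) \<Rightarrow> bool" where
  "selfadjoint Ii D A \<longleftrightarrow> clinear_on Ii D A \<and> closure D = UNIV
      \<and> {y. \<exists>z. \<forall>x\<in>D. cinner Ii (A x) y = cinner Ii x z} = D
      \<and> (\<forall>x\<in>D. \<forall>y\<in>D. cinner Ii (A x) y = cinner Ii x (A y))"

definition strictly_positive :: "('h::real_inner \<Rightarrow> 'h) \<Rightarrow> 'h set \<Rightarrow> ('h \<Rightarrow> 'h) \<Rightarrow> bool" where
  "strictly_positive Ii D L \<longleftrightarrow> selfadjoint Ii D L
      \<and> (\<forall>h\<in>D. h \<noteq> 0 \<longrightarrow> cinner Ii (L h) h \<in> \<real> \<and> Re (cinner Ii (L h) h) > 0)"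

definition signature_op :: "('h::real_inner \<Rightarrow> 'h) \<Rightarrow> ('h \<Rightarrow> 'h) \<Rightarrow> bool" where
  "signature_op Ii J \<longleftrightarrow> bounded_clinear_op Ii J
      \<and> (\<forall>x y. cinner Ii (J x) y = cinner Ii x (J y)) \<and> (\<forall>x. J (J x) = x)"

definition orth_proj :: "('h::real_inner \<Rightarrow> 'h) \<Rightarrow> 'h set \<Rightarrow> 'h \<Rightarrow> 'h" where
  "orth_proj Ii M x = (THE y. y \<in> M \<and> (\<forall>m\<in>M. cinner Ii (x - y) m = 0))"

definition Hplus :: "('h::real_inner \<Rightarrow> 'h) \<Rightarrow> 'h set" where
  "Hplus J = {x. J x = x}"

definition Pplus :: "('h::real_inner \<Rightarrow> 'h) \<Rightarrow> ('h \<Rightarrow> 'h) \<Rightarrow> 'h \<Rightarrow> 'h" where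
  "Pplus Ii J = orth_proj Ii (Hplus J)"

definition similarity_witness ::
  "('h::real_inner \<Rightarrow> 'h) \<Rightarrow> 'h set \<Rightarrow> ('h \<Rightarrow> 'h)
    \<Rightarrow> ('h \<Rightarrow> 'h) \<Rightarrow> ('h \<Rightarrow> 'h) \<Rightarrow> 'h set \<Rightarrow> ('h \<Rightarrow> 'h) \<Rightarrow> bool" where
  "similarity_witness Ii D B S Si DT T \<longleftrightarrow>
      bounded_clinear_op Ii S \<and> bounded_clinear_op Ii Si
      \<and> (\<forall>x. S (Si x) = x) \<and> (\<forall>x. Si (S x) = x)
      \<and> S ` D = DT \<and> (\<forall>x\<in>DT. T x = S (B (Si x)))
      \<and> selfadjoint Ii DT T"

definition similar_to_selfadjoint :: "('h::real_inner \<Rightarrow> 'h) \<Rightarrow> 'h set \<Rightarrow> ('h \<Rightarrow> 'h) \<Rightarrow> bool" where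
  "similar_to_selfadjoint Ii D B \<longleftrightarrow> (\<exists>S Si DT T. similarity_witness Ii D B S Si DT T)"

definition tagged_partition :: "real \<Rightarrow> real \<Rightarrow> real list \<Rightarrow> real list \<Rightarrow> bool" where
  "tagged_partition a b ts us \<longleftrightarrow> length ts = Suc (length us) \<and> ts ! 0 = a \<and> last ts = b
      \<and> (\<forall>i<length us. ts ! i < ts ! Suc i \<and> ts ! i \<le> us ! i \<and> us ! i \<le> ts ! Suc i)"

definition mesh_less :: "real \<Rightarrow> real list \<Rightarrow> bool" where
  "mesh_less \<delta> ts \<longleftrightarrow> (\<forall>i. Suc i < length ts \<longrightarrow> ts ! Suc i - ts ! i < \<delta>)"

definition RS_sum :: "(real \<Rightarrow> real) \<Rightarrow> (real \<Rightarrow> 'h::real_vector) \<Rightarrow> real list \<Rightarrow> real list \<Rightarrow> 'h" where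
  "RS_sum f F ts us = (\<Sum>i<length us. f (us ! i) *\<^sub>R (F (ts ! Suc i) - F (ts ! i)))"

definition RS_has_integral :: "(real \<Rightarrow> real) \<Rightarrow> (real \<Rightarrow> 'h::real_normed_vector) \<Rightarrow> real \<Rightarrow> real \<Rightarrow> 'h \<Rightarrow> bool" where
  "RS_has_integral f F a b I \<longleftrightarrow> (\<forall>\<epsilon>>0. \<exists>\<delta>>0. \<forall>ts us.
      tagged_partition a b ts us \<and> mesh_less \<delta> ts \<longrightarrow> norm (RS_sum f F ts us - I) < \<epsilon>)"

definition RS_improper_line :: "(real \<Rightarrow> real) \<Rightarrow> (real \<Rightarrow> 'h::real_normed_vector) \<Rightarrow> 'h \<Rightarrow> bool" where
  "RS_improper_line f F v \<longleftrightarrow> (\<exists>I. (\<forall>a b. a < b \<longrightarrow> RS_has_integral f F a b (I a b))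
      \<and> ((\<lambda>p. I (fst p) (snd p)) \<longlongrightarrow> v) (at_bot \<times>\<^sub>F at_top))"

definition RS_improper_pos :: "(real \<Rightarrow> real) \<Rightarrow> (real \<Rightarrow> 'h::real_normed_vector) \<Rightarrow> 'h \<Rightarrow> bool" where
  "RS_improper_pos f F v \<longleftrightarrow> (\<exists>I G. (\<forall>a b. 0 < a \<and> a < b \<longrightarrow> RS_has_integral f F a b (I a b))
      \<and> (\<forall>a>0. ((\<lambda>b. I a b) \<longlongrightarrow> G a) at_top) \<and> (G \<longlongrightarrow> v) (at_right 0))"

definition spectral_family ::
  "('h::{real_inner,complete_space} \<Rightarrow> 'h) \<Rightarrow> 'h set \<Rightarrow> ('h \<Rightarrow> 'h) \<Rightarrow> (real \<Rightarrow> 'h \<Rightarrow> 'h) \<Rightarrow> bool" where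
  "spectral_family Ii DT T E \<longleftrightarrow>
      (\<forall>t. bounded_clinear_op Ii (E t) \<and> (\<forall>x y. cinner Ii (E t x) y = cinner Ii x (E t y)))
      \<and> (\<forall>s t x. E s (E t x) = E (min s t) x)
      \<and> (\<forall>t x. ((\<lambda>s. E s x) \<longlongrightarrow> E t x) (at_right t))
      \<and> (\<forall>x. ((\<lambda>s. E s x) \<longlongrightarrow> 0) at_bot)
      \<and> (\<forall>x. ((\<lambda>s. E s x) \<longlongrightarrow> x) at_top)
      \<and> DT = {h. \<exists>v. RS_improper_line (\<lambda>t. t) (\<lambda>t. E t h) v}
      \<and> (\<forall>h\<in>DT. RS_improper_line (\<lambda>t. t) (\<lambda>t. E t h) (T h))"

text \<open>Spectral function of B = S^{-1} T S obtained by transport: E^B_t = S^{-1} E^T_t S.\<close>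
definition transported_family :: "('h \<Rightarrow> 'h) \<Rightarrow> ('h \<Rightarrow> 'h) \<Rightarrow> (real \<Rightarrow> 'h \<Rightarrow> 'h) \<Rightarrow> real \<Rightarrow> 'h \<Rightarrow> 'h" where
  "transported_family S Si E t x = Si (E t (S x))"

text \<open>R_+ = (P_+ restricted to H^B_+)^{-1}, where H^B_+ = E^B((0,\<infinity>))H = ker E^B_0.\<close>
definition Rplus :: "('h::real_inner \<Rightarrow> 'h) \<Rightarrow> ('h \<Rightarrow> 'h) \<Rightarrow> (real \<Rightarrow> 'h \<Rightarrow> 'h) \<Rightarrow> 'h \<Rightarrow> 'h" where
  "Rplus Ii J EB \<phi> = (THE h. EB 0 h = 0 \<and> Pplus Ii J h = \<phi>)"

definition is_solution ::
  "('h::real_inner \<Rightarrow> 'h) \<Rightarrow> ('h \<Rightarrow> 'h) \<Rightarrow> 'h set \<Rightarrow> ('h \<Rightarrow> 'h) \<Rightarrow> 'h \<Rightarrow> (real \<Rightarrow> 'h) \<Rightarrow> bool" where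
  "is_solution Ii J DL L \<phi> \<psi> \<longleftrightarrow>
      continuous_on {0..} \<psi>
      \<and> (\<exists>\<psi>'. continuous_on {0<..} \<psi>'
           \<and> (\<forall>x>0. (\<psi> has_vector_derivative \<psi>' x) (at x) \<and> \<psi> x \<in> DL \<and> \<psi>' x = - J (L (\<psi> x))))
      \<and> Pplus Ii J (\<psi> 0) = \<phi>
      \<and> (\<exists>C. eventually (\<lambda>x. norm (\<psi> x) \<le> C) at_top)"

end

theory Submission
  imports Defs
begin

text \<open>Let T be the self-adjoint operator similar to B = J L. A continuous functional calculus for the
  resolvent of T^2 yields the sign decomposition of T and the decaying semigroup on each of the two
  half-spaces. A bounded solution lies in the positive half-space, because its component in the other one
  would grow. Along a solution [f,f] = (J f, f) has derivative - 2 (L f, f), so it decreases to 0 and is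
  nonnegative on the positive half-space (and nonpositive on the negative one, by reversing time).
  This gives uniqueness: a bounded solution starting in the kernel of the projection to \<open>H\<^sub>+\<close> has
  \<open>[f,f] \<le> 0\<close> throughout. For existence let K be the difference of the two spectral projections of B;
  (1 + J K)/2 has symmetric part at least 1/2, hence it is onto, and any preimage of \<open>\<phi>\<close> is mapped by
  the positive spectral projection to an admissible initial value.
  For a given spectral family E, the part of a solution in a short spectral interval is almost
  exp(- x s) times its initial value, and these errors add up orthogonally in a Stieltjes sum.\<close>

section \<open>Orthogonal projections and coercive operators\<close>

text \<open>The hypothesis L > 0 leaves the spectrum of T free to reach 0, so orbits tend to 0
  without any rate. Limits are therefore computed on the dense ranges of \<open>A\<close> and
  \<open>Q\<close>, where a rate exists. In the half-spaces growth is excluded by pairing with a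
  decaying orbit; exponential estimates are confined to spectral bands away from 0. The resolvent of
  T^2 is dictated by continuity: if a is the value of \<open>A\<close> = (1 + T^2)^{-1} and x > 0,
  then exp (- x |T|) is continuous in a on all of [0,1], infinity included, whereas the sign of T is
  not a function of a at all. The sign is therefore read off the bounded operator \<open>C\<close> =
  T (1 + T^2)^{-1} by comparison with its modulus \<open>Q\<close>. Existence and uniqueness come
  from this calculus alone. A spectral family is tied to the half-spaces at the end by letting it
  act on bounded solutions: \<open>E 0\<close> annihilates those of the forward equation and fixes
  those of the reversed one. All analysis takes place in the underlying real Hilbert space.\<close>

lemma orthogonal_projection_exists:
  fixes M :: "'h::{real_inner,complete_space} set"
  assumes sub: "subspace M" and cl: "closed M"
  obtains y where "y \<in> M" "\<And>m. m \<in> M \<Longrightarrow> inner (x - y) m = 0"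
proof -
  define d where "d = infdist x M"
  have ne: "M \<noteq> {}" using subspace_0[OF sub] by auto
  have d0: "d \<ge> 0" by (simp add: d_def infdist_nonneg)
  have lower: "d \<le> norm (x - m)" if "m \<in> M" for m
    using infdist_le[OF that, of x] by (simp add: d_def dist_norm)
  have "\<exists>y\<in>M. norm (x - y) < d + e" if "e > 0" for e
  proof (rule ccontr)
    assume "\<not> ?thesis"
    then have "d + e \<le> infdist x M"
      unfolding infdist_notempty[OF ne] using ne
      by (intro cINF_greatest) (auto simp: dist_norm not_less)
    then show False using that by (simp add: d_def)
  qed
  then have "\<exists>y\<in>M. norm (x - y) < d + inverse (real (Suc n))" for n
    by simp
  then obtain Y where Y: "\<And>n. Y n \<in> M" "\<And>n. norm (x - Y n) < d + inverse (real (Suc n))"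
    by metis
  have lim: "(\<lambda>n. norm (x - Y n)) \<longlonglongrightarrow> d"
  proof (rule tendsto_sandwich[of "\<lambda>_. d" _ _ "\<lambda>n. d + inverse (real (Suc n))"])
    show "(\<lambda>n. d + inverse (real (Suc n))) \<longlonglongrightarrow> d"
      using tendsto_add[OF tendsto_const LIMSEQ_inverse_real_of_nat, of d] by simp
  qed (use lower[OF Y(1)] less_imp_le[OF Y(2)] in auto)
  \<comment> \<open>The midpoint of Y m and Y n stays in M, hence at distance at least d from x;
    this is what makes the minimising sequence Cauchy.\<close>
  have parallelogram: "(norm (Y m - Y n))\<^sup>2 \<le> 2 * (norm (x - Y m))\<^sup>2 + 2 * (norm (x - Y n))\<^sup>2 - 4 * d\<^sup>2"
    for m n
  proof -
    have "(1/2) *\<^sub>R (Y m + Y n) \<in> M"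
      by (intro subspace_scale[OF sub] subspace_add[OF sub] Y)
    then have "d\<^sup>2 \<le> (norm (x - (1/2) *\<^sub>R (Y m + Y n)))\<^sup>2"
      using lower d0 by (intro power_mono) auto
    moreover have "(norm (Y m - Y n))\<^sup>2 + 4 * (norm (x - (1/2) *\<^sub>R (Y m + Y n)))\<^sup>2
        = 2 * (norm (x - Y m))\<^sup>2 + 2 * (norm (x - Y n))\<^sup>2"
      unfolding power2_norm_eq_inner
      by (simp add: inner_diff_left inner_diff_right inner_add_left inner_add_right
          inner_commute algebra_simps)
    ultimately show ?thesis by linarith
  qed
  have "Cauchy Y"
  proof (rule metric_CauchyI)
    fix e :: real assume e: "e > 0"
    have "(\<lambda>n. (norm (x - Y n))\<^sup>2) \<longlonglongrightarrow> d\<^sup>2" by (intro tendsto_intros lim)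
    then have "\<forall>\<^sub>F n in sequentially. (norm (x - Y n))\<^sup>2 < d\<^sup>2 + e\<^sup>2 / 4"
      by (rule order_tendstoD) (use e in auto)
    then obtain N where N: "\<And>n. n \<ge> N \<Longrightarrow> (norm (x - Y n))\<^sup>2 < d\<^sup>2 + e\<^sup>2 / 4"
      by (auto simp: eventually_sequentially)
    have "dist (Y m) (Y n) < e" if "m \<ge> N" "n \<ge> N" for m n
    proof -
      have "(norm (Y m - Y n))\<^sup>2 < e\<^sup>2"
        using parallelogram[of m n] N[OF that(1)] N[OF that(2)] by argo
      then show ?thesis using e by (simp add: dist_norm power_less_imp_less_base)
    qed
    then show "\<exists>N. \<forall>m\<ge>N. \<forall>n\<ge>N. dist (Y m) (Y n) < e" by blast
  qed
  then obtain y where y: "Y \<longlonglongrightarrow> y" using Cauchy_convergent convergent_def by blast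
  have yM: "y \<in> M" using closed_sequentially[OF cl _ y] Y(1) by blast
  have ny: "norm (x - y) = d"
    by (rule LIMSEQ_unique[OF _ lim]) (intro tendsto_intros y)
  have "inner (x - y) m = 0" if m: "m \<in> M" for m
  proof (cases "m = 0")
    case False
    \<comment> \<open>The t that minimises the distance from x to y + t m. It would lower the
      squared distance by the square of inner (x - y) m over inner m m, so that term must
      vanish.\<close>
    define t where "t = inner (x - y) m / inner m m"
    have mm: "inner m m > 0" using False by simp
    have "y + t *\<^sub>R m \<in> M" by (intro subspace_add[OF sub] subspace_scale[OF sub] yM m)
    then have "d\<^sup>2 \<le> (norm (x - (y + t *\<^sub>R m)))\<^sup>2" using lower d0 by (intro power_mono) auto
    also have "\<dots> = (norm (x - y))\<^sup>2 - 2 * t * inner (x - y) m + t\<^sup>2 * inner m m"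
      unfolding power2_norm_eq_inner
      by (simp add: inner_diff_left inner_diff_right inner_add_left inner_add_right
          inner_commute algebra_simps power2_eq_square)
    also have "\<dots> = d\<^sup>2 - (inner (x - y) m)\<^sup>2 / inner m m"
      using mm by (simp add: t_def ny power2_eq_square field_simps)
    finally have "(inner (x - y) m)\<^sup>2 / inner m m \<le> 0" by simp
    then have "(inner (x - y) m)\<^sup>2 \<le> 0" using mm by (simp add: divide_le_0_iff)
    then show ?thesis by simp
  qed simp
  then show thesis using that yM by blast
qed

lemma subspace_closure:
  fixes M :: "'a::real_normed_vector set"
  assumes sub: "subspace M"
  shows "subspace (closure M)"
proof (rule subspaceI)
  show "0 \<in> closure M" using subspace_0[OF sub] closure_subset by fast
next
  fix x y assume "x \<in> closure M" "y \<in> closure M"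
  then obtain X Y where "\<And>n. X n \<in> M" "X \<longlonglongrightarrow> x" "\<And>n. Y n \<in> M" "Y \<longlonglongrightarrow> y"
    unfolding closure_sequential by blast
  then have "\<And>n. X n + Y n \<in> M" "(\<lambda>n. X n + Y n) \<longlonglongrightarrow> x + y"
    using subspace_add[OF sub] by (auto intro: tendsto_add)
  then show "x + y \<in> closure M" unfolding closure_sequential by (intro exI[of _ "\<lambda>n. X n + Y n"]) auto
next
  fix c :: real and x assume "x \<in> closure M"
  then obtain X where "\<And>n. X n \<in> M" "X \<longlonglongrightarrow> x"
    unfolding closure_sequential by blast
  then have "\<And>n. c *\<^sub>R X n \<in> M" "(\<lambda>n. c *\<^sub>R X n) \<longlonglongrightarrow> c *\<^sub>R x"
    using subspace_scale[OF sub] by (auto intro: tendsto_intros)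
  then show "c *\<^sub>R x \<in> closure M" unfolding closure_sequential by (intro exI[of _ "\<lambda>n. c *\<^sub>R X n"]) auto
qed

lemma dense_if_orthogonal_trivial:
  fixes M :: "'h::{real_inner,complete_space} set"
  assumes sub: "subspace M" and triv: "\<And>x. (\<And>m. m \<in> M \<Longrightarrow> inner x m = 0) \<Longrightarrow> x = 0"
  shows "closure M = UNIV"
proof -
  have "x \<in> closure M" for x
  proof -
    obtain y where y: "y \<in> closure M" "\<And>m. m \<in> closure M \<Longrightarrow> inner (x - y) m = 0"
      using orthogonal_projection_exists[OF subspace_closure[OF sub] closed_closure] by metis
    have "inner (x - y) m = 0" if "m \<in> M" for m
      using y(2) closure_subset that by (metis subsetD)
    then have "x - y = 0" by (rule triv)
    then show ?thesis using y(1) by simp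
  qed
  then show ?thesis by auto
qed

text \<open>Lax-Milgram: coercivity bounds M from below, which makes the range closed, and a vector
  x orthogonal to the range satisfies inner (M x) x = 0. Symmetry is not assumed because the
  operator treated later need not be symmetric.\<close>

lemma coercive_surj:
  fixes M :: "'h::{real_inner,complete_space} \<Rightarrow> 'h"
  assumes M: "bounded_linear M" and c: "c > 0" and coercive: "\<And>x. c * (norm x)\<^sup>2 \<le> inner (M x) x"
  shows "surj M"
proof -
  have below: "norm (M x) \<ge> c * norm x" for x
  proof (cases "x = 0")
    case False
    have "c * norm x * norm x \<le> norm (M x) * norm x"
      using coercive[of x] Cauchy_Schwarz_ineq2[of "M x" x] by (simp add: power2_eq_square)
    then show ?thesis using False by simp
  qed simp
  have "complete (range M)"
    by (rule complete_isometric_image[OF c subspace_UNIV M])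
      (auto simp: below complete_UNIV)
  then have cl: "closed (range M)" by (rule complete_imp_closed)
  have sub: "subspace (range M)"
    using linear_subspace_image[OF bounded_linear.linear[OF M] subspace_UNIV] .
  have "closure (range M) = UNIV"
  proof (rule dense_if_orthogonal_trivial[OF sub])
    fix x assume "\<And>m. m \<in> range M \<Longrightarrow> inner x m = 0"
    then have "inner (M x) x = 0" by (metis inner_commute rangeI)
    then show "x = 0" using coercive[of x] c by (simp add: mult_le_0_iff)
  qed
  then show ?thesis using cl by (simp add: closure_closed)
qed

text \<open>Polarisation at x and at the multiple of X x that has the length of x. It reduces
  operator norms to quadratic forms, where nonnegative weights can be compared.\<close>

lemma symmetric_norm_bound:
  fixes X :: "'h::real_inner \<Rightarrow> 'h"
  assumes lin: "linear X" and sym: "\<And>x y. inner (X x) y = inner x (X y)"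
    and c: "\<And>x. \<bar>inner (X x) x\<bar> \<le> c * (norm x)\<^sup>2"
  shows "norm (X x) \<le> c * norm x"
proof (cases "x = 0 \<or> X x = 0")
  case True
  have "0 \<le> c * (norm x)\<^sup>2" using c[of x] by linarith
  then have "0 \<le> c * norm x" by (cases "x = 0") (auto simp: zero_le_mult_iff)
  then show ?thesis using True linear_0[OF lin] by auto
next
  case False
  define y where "y = (norm x / norm (X x)) *\<^sub>R X x"
  have ny: "norm y = norm x" using False by (simp add: y_def)
  have "4 * inner (X x) y = inner (X (x + y)) (x + y) - inner (X (x - y)) (x - y)"
    using sym[of x y] sym[of y x]
    by (simp add: linear_add[OF lin] linear_diff[OF lin] inner_add_left inner_add_right
        inner_diff_left inner_diff_right inner_commute)
  also have "\<dots> \<le> c * (norm (x + y))\<^sup>2 + c * (norm (x - y))\<^sup>2"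
    using c[of "x + y"] c[of "x - y"] by linarith
  also have "\<dots> = c * (2 * (norm x)\<^sup>2 + 2 * (norm y)\<^sup>2)"
    unfolding power2_norm_eq_inner
    by (simp add: inner_add_left inner_add_right inner_diff_left inner_diff_right
        inner_commute algebra_simps)
  finally have "inner (X x) y \<le> c * (norm x)\<^sup>2" by (simp add: ny)
  moreover have "inner (X x) y = norm x * norm (X x)"
    using False by (simp add: y_def power2_norm_eq_inner[symmetric] power2_eq_square)
  ultimately have "norm x * norm (X x) \<le> norm x * (c * norm x)"
    by (simp add: power2_eq_square algebra_simps)
  then show ?thesis using False by simp
qed

section \<open>Continuous functional calculus of a positive contraction\<close>

text \<open>Uniform continuity in a shape that Bernstein sums can absorb: near the diagonal the
  difference is below e, elsewhere 2 K is at most 2 K (s - t)^2 / d^2, and the quadratic term has an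
  explicit variance.\<close>

lemma quadratic_modulus:
  fixes f :: "real \<Rightarrow> real"
  assumes f: "continuous_on {0..1} f" and e: "e > 0"
  obtains M where "M \<ge> 0"
    "\<And>s t. s \<in> {0..1} \<Longrightarrow> t \<in> {0..1} \<Longrightarrow> \<bar>f s - f t\<bar> \<le> e + M * (s - t)\<^sup>2"
proof -
  have "compact (f ` {0..1})" by (intro compact_continuous_image f) simp
  then have "bounded (f ` {0..1})" by (rule compact_imp_bounded)
  then obtain K where K: "\<And>s. s \<in> {0..1} \<Longrightarrow> \<bar>f s\<bar> \<le> K" unfolding bounded_iff by force
  have K0: "K \<ge> 0" using K[of 0] by auto
  have "uniformly_continuous_on {0..1} f" by (intro compact_uniformly_continuous f) simp
  then obtain d where d: "d > 0"
    "\<And>s t. s \<in> {0..1} \<Longrightarrow> t \<in> {0..1} \<Longrightarrow> \<bar>s - t\<bar> < d \<Longrightarrow> \<bar>f s - f t\<bar> < e"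
    unfolding uniformly_continuous_on_def dist_real_def using e
    by (metis abs_minus_commute)
  show thesis
  proof (rule that[of "2 * K / d\<^sup>2"])
    show "2 * K / d\<^sup>2 \<ge> 0" using K0 by simp
    fix s t :: real assume st: "s \<in> {0..1}" "t \<in> {0..1}"
    show "\<bar>f s - f t\<bar> \<le> e + 2 * K / d\<^sup>2 * (s - t)\<^sup>2"
    proof (cases "\<bar>s - t\<bar> < d")
      case True
      then show ?thesis using d(2)[OF st True] K0 by (smt (verit) divide_nonneg_nonneg mult_nonneg_nonneg zero_le_power2)
    next
      case False
      then have "d\<^sup>2 \<le> (s - t)\<^sup>2" using d(1) by (simp add: abs_le_square_iff[symmetric])
      then have "2 * K * 1 \<le> 2 * K * ((s - t)\<^sup>2 / d\<^sup>2)"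
        using K0 d(1) by (intro mult_left_mono) auto
      then show ?thesis using K[OF st(1)] K[OF st(2)] e by (simp add: field_simps)
    qed
  qed
qed

locale positive_contraction =
  fixes A :: "'h::{real_inner,complete_space} \<Rightarrow> 'h"
  assumes bounded_linear_A: "bounded_linear A"
    and symmetric_A: "inner (A x) y = inner x (A y)"
    and nonneg_A: "0 \<le> inner (A x) x"
    and contraction_A: "inner (A x) x \<le> inner x x"
begin

definition A' :: "'h \<Rightarrow> 'h" where "A' x = x - A x"

lemma linear_A: "linear A" by (rule bounded_linear.linear[OF bounded_linear_A])
lemma linear_A': "linear A'"
  unfolding A'_def by (intro linear_compose_sub linear_A linear_ident)
lemma symmetric_A': "inner (A' x) y = inner x (A' y)"
  by (simp add: A'_def inner_diff_left inner_diff_right symmetric_A)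
lemma A_A'_commute: "A (A' x) = A' (A x)"
  by (simp add: A'_def linear_diff[OF linear_A])
lemma A_plus_A': "A x + A' x = x" by (simp add: A'_def)

text \<open>All members of the cone are nonnegative operators, so inequalities between the coefficients of
  Bernstein sums become operator inequalities.\<close>

inductive_set cone :: "('h \<Rightarrow> 'h) set" where
  id: "(\<lambda>x. x) \<in> cone"
| A: "X \<in> cone \<Longrightarrow> (\<lambda>x. A (X x)) \<in> cone"
| A': "X \<in> cone \<Longrightarrow> (\<lambda>x. A' (X x)) \<in> cone"
| add: "X \<in> cone \<Longrightarrow> Y \<in> cone \<Longrightarrow> (\<lambda>x. X x + Y x) \<in> cone"
| zero: "(\<lambda>x. 0) \<in> cone"

lemma cone_linear: "X \<in> cone \<Longrightarrow> linear X"
  by (induction rule: cone.induct)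
    (auto intro: linear_ident linear_compose_add linear_zero
      linear_compose[OF _ linear_A, unfolded o_def] linear_compose[OF _ linear_A', unfolded o_def])

lemma cone_commute_operator:
  assumes Z: "linear Z" "\<And>x. Z (A x) = A (Z x)" and X: "X \<in> cone"
  shows "Z (X x) = X (Z x)"
  using X
proof (induction arbitrary: x rule: cone.induct)
  case (A' X)
  then show ?case by (simp add: A'_def linear_diff[OF Z(1)] Z(2))
qed (auto simp: Z linear_add[OF Z(1)] linear_0[OF Z(1)])

lemma cone_comp:
  assumes X: "X \<in> cone" and Y: "Y \<in> cone"
  shows "(\<lambda>x. X (Y x)) \<in> cone"
  using X by (induction rule: cone.induct) (auto intro: cone.intros Y)

lemma cone_symmetric:
  assumes X: "X \<in> cone"
  shows "inner (X x) y = inner x (X y)"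
  using X
proof (induction arbitrary: x y rule: cone.induct)
  case (A X)
  have "A (X y) = X (A y)" by (rule cone_commute_operator[OF linear_A _ A(1)]) simp
  then show ?case by (simp add: symmetric_A A)
next
  case (A' X)
  have "A' (X y) = X (A' y)"
    by (rule cone_commute_operator[OF linear_A' _ A'(1)]) (simp add: A_A'_commute)
  then show ?case by (simp add: symmetric_A' A')
qed (auto simp: inner_add_left inner_add_right)

lemma nonneg_A': "0 \<le> inner (A' x) x"
  using contraction_A[of x] by (simp add: A'_def inner_diff_left)

text \<open>With a' = 1 - a one has a a' = a' a a' + a a' a. This shows nonnegativity of the product
  without operator square roots.\<close>

lemma nonneg_A_A': "0 \<le> inner (A (A' x)) x"
proof -
  have "inner (A (A' x)) x = inner (A (A' x)) (A' x) + inner (A' (A x)) (A x)"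
    unfolding symmetric_A symmetric_A' A_A'_commute[symmetric]
    by (metis A_A'_commute A_plus_A' add.commute inner_add_left symmetric_A symmetric_A')
  then show ?thesis using nonneg_A[of "A' x"] nonneg_A'[of "A x"] by linarith
qed

lemma linear_funpow:
  fixes f :: "'a::real_vector \<Rightarrow> 'a"
  assumes "linear f"
  shows "linear (f ^^ n)"
  by (induction n) (auto intro: linear_ident linear_compose[OF _ assms, unfolded o_def])

text \<open>By symmetry a factor \<open>A\<close> or \<open>A'\<close> can be moved to the right
  argument, which lowers its exponent by two and leaves a form of the same kind. Only exponents 0
  and 1 remain, and those are the cases above.\<close>

lemma nonneg_powers: "0 \<le> inner ((A ^^ i) ((A' ^^ j) x)) x"
proof (induction "i + j" arbitrary: i j x rule: less_induct)
  case less
  have comm: "(A ^^ i) (A' y) = A' ((A ^^ i) y)" for i y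
    by (induction i) (simp_all add: A_A'_commute)
  have comm': "A ((A' ^^ j) y) = (A' ^^ j) (A y)" for j y
    by (induction j) (simp_all add: A_A'_commute)
  consider "i \<ge> 2" | "j \<ge> 2" | "i < 2 \<and> j < 2" by linarith
  then show ?case
  proof cases
    case 1
    then obtain k where k: "i = Suc (Suc k)" by (metis add_2_eq_Suc le_Suc_ex)
    have "inner ((A ^^ i) ((A' ^^ j) x)) x = inner ((A ^^ k) ((A' ^^ j) (A x))) (A x)"
      by (simp add: k symmetric_A comm'[symmetric] funpow_swap1[symmetric])
    then show ?thesis using less[of k j "A x"] k by simp
  next
    case 2
    then obtain k where k: "j = Suc (Suc k)" by (metis add_2_eq_Suc le_Suc_ex)
    have "inner ((A ^^ i) ((A' ^^ j) x)) x = inner ((A ^^ i) ((A' ^^ k) (A' x))) (A' x)"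
      by (simp add: k symmetric_A' comm funpow_swap1[symmetric])
    then show ?thesis using less[of i k "A' x"] k by simp
  next
    case 3
    then have "i = 0 \<or> i = 1" "j = 0 \<or> j = 1" by auto
    then show ?thesis using nonneg_A nonneg_A' nonneg_A_A' by auto
  qed
qed

lemma cone_nonneg:
  assumes X: "X \<in> cone"
  shows "0 \<le> inner (X x) x"
proof -
  \<comment> \<open>The cone rules multiply from the outside, where plain nonnegativity of X would
    not survive. The powers of \<open>A\<close> and \<open>A'\<close> in front absorb those
    factors.\<close>
  have "0 \<le> inner ((A ^^ i) ((A' ^^ j) (X x))) x" for i j
    using X
  proof (induction arbitrary: i j x rule: cone.induct)
    case id
    show ?case by (rule nonneg_powers)
  next
    case (A X)
    have "A ((A' ^^ j) y) = (A' ^^ j) (A y)" for j y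
      by (induction j) (simp_all add: A_A'_commute)
    then show ?case using A(2)[of "Suc i" j] by (simp add: funpow_swap1)
  next
    case (A' X)
    show ?case using A'(2)[of i "Suc j"] by (simp add: funpow_swap1)
  next
    case (add X Y)
    then show ?case
      by (simp add: linear_add[OF linear_funpow[OF linear_A]] linear_add[OF linear_funpow[OF linear_A']]
          inner_add_left)
  next
    case zero
    then show ?case
      by (simp add: linear_0[OF linear_funpow[OF linear_A]] linear_0[OF linear_funpow[OF linear_A']])
  qed
  from this[of 0 0] show ?thesis by simp
qed

text \<open>The operator binomial (n choose k) A^k (1 - A)^(n-k), generated by Pascal's rule so that
  membership in \<open>cone\<close> is immediate.\<close>

fun bernstein :: "nat \<Rightarrow> nat \<Rightarrow> 'h \<Rightarrow> 'h" where
  "bernstein 0 k = (if k = 0 then (\<lambda>x. x) else (\<lambda>x. 0))"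
| "bernstein (Suc n) 0 = (\<lambda>x. A' (bernstein n 0 x))"
| "bernstein (Suc n) (Suc k) = (\<lambda>x. A' (bernstein n (Suc k) x) + A (bernstein n k x))"

lemma bernstein_cone: "bernstein n k \<in> cone"
  by (induction n k rule: bernstein.induct) (auto intro: cone.intros)

lemma bernstein_eq_0: "k > n \<Longrightarrow> bernstein n k x = 0"
  by (induction n k rule: bernstein.induct)
    (auto simp: linear_0[OF linear_A] linear_0[OF linear_A'])

section \<open>Bernstein sums and their first three moments\<close>

definition bern_sum :: "nat \<Rightarrow> (nat \<Rightarrow> real) \<Rightarrow> 'h \<Rightarrow> 'h" where
  "bern_sum n f x = (\<Sum>k\<le>n. f k *\<^sub>R bernstein n k x)"

lemma bern_sum_0: "bern_sum 0 f x = f 0 *\<^sub>R x"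
  by (simp add: bern_sum_def)

text \<open>De Casteljau's recursion. It replaces binomial identities: each moment follows from it
  by induction on the degree.\<close>

lemma bern_sum_Suc: "bern_sum (Suc n) f x = A' (bern_sum n f x) + A (bern_sum n (\<lambda>k. f (Suc k)) x)"
proof -
  have "bern_sum (Suc n) f x = f 0 *\<^sub>R A' (bernstein n 0 x)
      + (\<Sum>k\<le>n. f (Suc k) *\<^sub>R A' (bernstein n (Suc k) x)) + (\<Sum>k\<le>n. f (Suc k) *\<^sub>R A (bernstein n k x))"
    unfolding bern_sum_def
    by (subst sum.atMost_Suc_shift) (simp add: scaleR_add_right sum.distrib)
  also have "f 0 *\<^sub>R A' (bernstein n 0 x) + (\<Sum>k\<le>n. f (Suc k) *\<^sub>R A' (bernstein n (Suc k) x))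
      = (\<Sum>k\<le>Suc n. f k *\<^sub>R A' (bernstein n k x))"
    by (subst sum.atMost_Suc_shift) simp
  also have "\<dots> = A' (bern_sum n f x)"
    by (simp add: bern_sum_def linear_sum[OF linear_A'] linear_scale[OF linear_A'] bernstein_eq_0
        linear_0[OF linear_A'])
  also have "(\<Sum>k\<le>n. f (Suc k) *\<^sub>R A (bernstein n k x)) = A (bern_sum n (\<lambda>k. f (Suc k)) x)"
    by (simp add: bern_sum_def linear_sum[OF linear_A] linear_scale[OF linear_A])
  finally show ?thesis .
qed

lemma bern_sum_add: "bern_sum n (\<lambda>k. f k + g k) x = bern_sum n f x + bern_sum n g x"
  by (simp add: bern_sum_def scaleR_add_left sum.distrib)
lemma bern_sum_scale: "bern_sum n (\<lambda>k. c * f k) x = c *\<^sub>R bern_sum n f x"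
  by (simp add: bern_sum_def scaleR_sum_right)
lemma linear_bern_sum: "linear (bern_sum n f)"
  unfolding bern_sum_def
  by (intro linear_compose_sum ballI linear_compose_scale_right cone_linear bernstein_cone)

lemma bern_sum_const: "bern_sum n (\<lambda>k. c) x = c *\<^sub>R x"
  by (induction n) (simp_all add: bern_sum_0 bern_sum_Suc linear_scale[OF linear_A]
      linear_scale[OF linear_A'] scaleR_add_right[symmetric] A_plus_A' add.commute)

lemma bern_sum_of_nat: "bern_sum n real x = real n *\<^sub>R A x"
proof (induction n)
  case (Suc n)
  have "bern_sum n (\<lambda>k. real (Suc k)) x = bern_sum n real x + x"
    using bern_sum_add[of n real "\<lambda>_. 1" x] by (simp add: bern_sum_const add.commute)
  then show ?case
    by (simp add: bern_sum_Suc Suc A'_def linear_add[OF linear_A] linear_scale[OF linear_A] algebra_simps)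
qed (simp add: bern_sum_0)

text \<open>The second moment n a + n (n - 1) a^2 of a binomial variable with parameter a; it enters
  the variance of two samples.\<close>

lemma bern_sum_square:
  "bern_sum n (\<lambda>k. (real k)\<^sup>2) x = real n *\<^sub>R A x + (real n * (real n - 1)) *\<^sub>R A (A x)"
proof (induction n)
  case (Suc n)
  have "(\<lambda>k. (real (Suc k))\<^sup>2) = (\<lambda>k. (real k)\<^sup>2 + (2 * real k + 1))"
    by (auto simp: power2_eq_square algebra_simps)
  then have shift: "bern_sum n (\<lambda>k. (real (Suc k))\<^sup>2) x = bern_sum n (\<lambda>k. (real k)\<^sup>2) x + (2 * real n) *\<^sub>R A x + x"
    by (simp add: bern_sum_add bern_sum_scale bern_sum_const bern_sum_of_nat)
  have two: "(real n * 2) *\<^sub>R y = real n *\<^sub>R y + real n *\<^sub>R y" for y :: 'h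
    by (simp add: scaleR_add_left[symmetric])
  show ?case
    unfolding bern_sum_Suc shift Suc
    by (simp add: A'_def linear_add[OF linear_A] linear_diff[OF linear_A] linear_scale[OF linear_A]
        algebra_simps two)
qed (simp add: bern_sum_0)

text \<open>The law of two independent binomial samples with the same parameter, of sizes n and m.
  The weight F may couple the two grids, so approximations of different degree, and products, are
  compared inside one sum with nonnegative operators.\<close>

definition double_sum :: "nat \<Rightarrow> nat \<Rightarrow> (nat \<Rightarrow> nat \<Rightarrow> real) \<Rightarrow> 'h \<Rightarrow> 'h" where
  "double_sum n m F x = (\<Sum>k\<le>n. \<Sum>l\<le>m. F k l *\<^sub>R bernstein n k (bernstein m l x))"

lemma double_sum_product:
  "double_sum n m (\<lambda>k l. f k * g l) x = bern_sum n f (bern_sum m g x)"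
  by (simp add: double_sum_def bern_sum_def linear_sum[OF cone_linear[OF bernstein_cone]]
      linear_scale[OF cone_linear[OF bernstein_cone]] scaleR_sum_right)

lemma double_sum_fst: "double_sum n m (\<lambda>k l. f k) x = bern_sum n f x"
  using double_sum_product[of n m f "\<lambda>_. 1" x] by (simp add: bern_sum_const)
lemma double_sum_snd: "double_sum n m (\<lambda>k l. g l) x = bern_sum m g x"
  using double_sum_product[of n m "\<lambda>_. 1" g x] by (simp add: bern_sum_const)
lemma double_sum_add: "double_sum n m (\<lambda>k l. F k l + G k l) x = double_sum n m F x + double_sum n m G x"
  by (simp add: double_sum_def scaleR_add_left sum.distrib)
lemma double_sum_diff: "double_sum n m (\<lambda>k l. F k l - G k l) x = double_sum n m F x - double_sum n m G x"
  by (simp add: double_sum_def scaleR_diff_left sum_subtractf)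
lemma double_sum_scale: "double_sum n m (\<lambda>k l. c * F k l) x = c *\<^sub>R double_sum n m F x"
  by (simp add: double_sum_def scaleR_sum_right)

lemma bernstein_pair_cone: "(\<lambda>x. bernstein n k (bernstein m l x)) \<in> cone"
  by (rule cone_comp[OF bernstein_cone bernstein_cone])

lemma linear_double_sum: "linear (double_sum n m F)"
proof (rule linearI)
  show "double_sum n m F (x + y) = double_sum n m F x + double_sum n m F y" for x y
    by (simp add: double_sum_def linear_add[OF cone_linear[OF bernstein_pair_cone]]
        scaleR_add_right sum.distrib)
  show "double_sum n m F (c *\<^sub>R x) = c *\<^sub>R double_sum n m F x" for c x
    by (simp add: double_sum_def linear_scale[OF cone_linear[OF bernstein_pair_cone]]
        scaleR_sum_right mult.commute)
qed

lemma double_sum_symmetric: "inner (double_sum n m F x) y = inner x (double_sum n m F y)"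
  by (simp add: double_sum_def inner_sum_left inner_sum_right cone_symmetric[OF bernstein_pair_cone])

lemma bern_sum_symmetric: "inner (bern_sum n f x) y = inner x (bern_sum n f y)"
  by (simp add: bern_sum_def inner_sum_left inner_sum_right cone_symmetric[OF bernstein_cone])

text \<open>Chebyshev's argument for Bernstein polynomials, applied to two sums at once: the Cauchy property and
  multiplicativity follow without knowing the limit.\<close>

lemma double_sum_variance:
  assumes "n > 0" "m > 0"
  shows "inner (double_sum n m (\<lambda>k l. (real k / n - real l / m)\<^sup>2) x) x \<le> (1 / n + 1 / m) * (norm x)\<^sup>2"
proof -
  have "(\<lambda>k l. (real k / n - real l / m)\<^sup>2) =
      (\<lambda>k l. (1 / (real n)\<^sup>2 * (real k)\<^sup>2 + 1 / (real m)\<^sup>2 * (real l)\<^sup>2) - (2 / (real n * real m)) * (real k * real l))"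
    by (auto simp: power2_diff power_divide mult.assoc)
  then have "double_sum n m (\<lambda>k l. (real k / n - real l / m)\<^sup>2) x
      = (1 / (real n)\<^sup>2) *\<^sub>R bern_sum n (\<lambda>k. (real k)\<^sup>2) x + (1 / (real m)\<^sup>2) *\<^sub>R bern_sum m (\<lambda>k. (real k)\<^sup>2) x
        - (2 / (real n * real m)) *\<^sub>R bern_sum n real (bern_sum m real x)"
    by (simp only: double_sum_diff double_sum_add double_sum_scale double_sum_fst double_sum_snd
        double_sum_product bern_sum_scale bern_sum_const)
  \<comment> \<open>The mean squared difference of two independent sample means is a (1 - a) (1 / n
    + 1 / m).\<close>
  also have "inner \<dots> x = (1 / n + 1 / m) * (inner (A x) x - inner (A (A x)) x)"
    unfolding bern_sum_square bern_sum_of_nat using assms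
    by (simp add: linear_scale[OF linear_A] inner_add_left inner_diff_left
        field_simps power2_eq_square)
  also have "\<dots> \<le> (1 / n + 1 / m) * (norm x)\<^sup>2"
  proof (intro mult_left_mono)
    show "inner (A x) x - inner (A (A x)) x \<le> (norm x)\<^sup>2"
      using contraction_A[of x] symmetric_A[of "A x" x] inner_ge_zero[of "A x"]
      unfolding power2_norm_eq_inner by linarith
  qed simp
  finally show ?thesis .
qed

text \<open>The weights multiply nonnegative forms, so F can be estimated entry by entry; the
  quadratic part is then the variance.\<close>

lemma double_sum_bound:
  assumes nm: "n > 0" "m > 0" and M: "M \<ge> 0"
    and F: "\<And>k l. k \<le> n \<Longrightarrow> l \<le> m \<Longrightarrow> \<bar>F k l\<bar> \<le> e + M * (real k / n - real l / m)\<^sup>2"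
  shows "norm (double_sum n m F x) \<le> (e + M * (1 / n + 1 / m)) * norm x"
proof (rule symmetric_norm_bound[OF linear_double_sum double_sum_symmetric])
  fix x :: 'h
  have "\<bar>inner (double_sum n m F x) x\<bar>
      \<le> (\<Sum>k\<le>n. \<Sum>l\<le>m. \<bar>F k l\<bar> * inner (bernstein n k (bernstein m l x)) x)"
    unfolding double_sum_def inner_sum_left inner_scaleR_left
    by (intro order_trans[OF sum_abs] sum_mono)
      (simp add: abs_mult cone_nonneg[OF bernstein_pair_cone])
  also have "\<dots> \<le> (\<Sum>k\<le>n. \<Sum>l\<le>m. (e + M * (real k / n - real l / m)\<^sup>2)
      * inner (bernstein n k (bernstein m l x)) x)"
    by (intro sum_mono mult_right_mono F cone_nonneg[OF bernstein_pair_cone]) auto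
  also have "\<dots> = inner (double_sum n m (\<lambda>k l. e + M * (real k / n - real l / m)\<^sup>2) x) x"
    by (simp add: double_sum_def inner_sum_left)
  also have "\<dots> = e * (norm x)\<^sup>2 + M * inner (double_sum n m (\<lambda>k l. (real k / n - real l / m)\<^sup>2) x) x"
    by (simp add: double_sum_add double_sum_scale double_sum_fst bern_sum_const inner_add_left
        power2_norm_eq_inner)
  also have "\<dots> \<le> e * (norm x)\<^sup>2 + M * ((1 / n + 1 / m) * (norm x)\<^sup>2)"
    by (intro add_left_mono mult_left_mono double_sum_variance nm M)
  finally show "\<bar>inner (double_sum n m F x) x\<bar> \<le> (e + M * (1 / n + 1 / m)) * (norm x)\<^sup>2"
    by (simp add: algebra_simps)
qed

text \<open>Degree \<open>Suc n\<close> avoids division by zero in the grid points.\<close>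

definition approx :: "nat \<Rightarrow> (real \<Rightarrow> real) \<Rightarrow> 'h \<Rightarrow> 'h" where
  "approx n f = bern_sum (Suc n) (\<lambda>k. f (real k / real (Suc n)))"

definition calc :: "(real \<Rightarrow> real) \<Rightarrow> 'h \<Rightarrow> 'h" where
  "calc f x = lim (\<lambda>n. approx n f x)"

lemma approx_diff_bound:
  assumes f: "continuous_on {0..1} f" and e: "e > 0"
  obtains M where "M \<ge> 0"
    "\<And>n m x. norm (approx n f x - approx m f x) \<le> (e + M * (1 / Suc n + 1 / Suc m)) * norm x"
proof -
  obtain M where M: "M \<ge> 0"
    "\<And>s t. s \<in> {0..1} \<Longrightarrow> t \<in> {0..1} \<Longrightarrow> \<bar>f s - f t\<bar> \<le> e + M * (s - t)\<^sup>2"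
    using quadratic_modulus[OF f e] by metis
  have "norm (approx n f x - approx m f x) \<le> (e + M * (1 / Suc n + 1 / Suc m)) * norm x" for n m x
  proof -
    have "approx n f x - approx m f x
        = double_sum (Suc n) (Suc m) (\<lambda>k l. f (real k / Suc n) - f (real l / Suc m)) x"
      by (simp add: approx_def double_sum_diff double_sum_fst double_sum_snd del: of_nat_Suc)
    then show ?thesis
      using double_sum_bound[of "Suc n" "Suc m" M "\<lambda>k l. f (real k / Suc n) - f (real l / Suc m)" e x]
        M by (simp add: divide_le_eq del: of_nat_Suc)
  qed
  then show thesis using that M(1) by blast
qed

lemma inverse_Suc_tendsto: "(\<lambda>n. c / real (Suc n)) \<longlonglongrightarrow> 0"
  using tendsto_mult_left[OF LIMSEQ_inverse_real_of_nat, of c] by (simp add: divide_inverse)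

lemma approx_tendsto:
  assumes f: "continuous_on {0..1} f"
  shows "(\<lambda>n. approx n f x) \<longlonglongrightarrow> calc f x"
proof -
  have "Cauchy (\<lambda>n. approx n f x)"
  proof (rule metric_CauchyI)
    fix e :: real assume e: "e > 0"
    \<comment> \<open>The summand 1 keeps the divisor positive when x = 0; the same device recurs
      below.\<close>
    define X where "X = norm x + 1"
    have x1: "X > 0" by (simp add: X_def add_nonneg_pos)
    define d where "d = e / (2 * X)"
    have d: "d > 0" using e x1 by (simp add: d_def)
    obtain M where M: "M \<ge> 0"
      "\<And>n m x. norm (approx n f x - approx m f x) \<le> (d + M * (1 / Suc n + 1 / Suc m)) * norm x"
      using approx_diff_bound[OF f d] by metis
    have "\<forall>\<^sub>F n in sequentially. 2 * M / real (Suc n) < d"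
      by (rule order_tendstoD(2)[OF inverse_Suc_tendsto d])
    then obtain N where N: "\<And>n. n \<ge> N \<Longrightarrow> 2 * M / real (Suc n) < d"
      by (auto simp: eventually_sequentially)
    have "dist (approx m f x) (approx n f x) < e" if "m \<ge> N" "n \<ge> N" for m n
    proof -
      have "d + M * (1 / Suc m + 1 / Suc n) \<le> 2 * d"
      proof -
        have "M * (1 / Suc m + 1 / Suc n) = (2 * M / real (Suc m) + 2 * M / real (Suc n)) / 2"
          by (simp add: algebra_simps)
        also have "\<dots> \<le> d" using N[OF that(1)] N[OF that(2)] by argo
        finally show ?thesis by simp
      qed
      then have "dist (approx m f x) (approx n f x) \<le> 2 * d * norm x"
        unfolding dist_norm by (intro order_trans[OF M(2)] mult_right_mono) auto
      also have "\<dots> < 2 * d * X" using d by (simp add: X_def)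
      also have "\<dots> = e" using x1 by (simp add: d_def)
      finally show ?thesis .
    qed
    then show "\<exists>N. \<forall>m\<ge>N. \<forall>n\<ge>N. dist (approx m f x) (approx n f x) < e" by blast
  qed
  then show ?thesis unfolding calc_def using Cauchy_convergent convergent_LIMSEQ_iff by blast
qed

section \<open>Algebra of the calculus: linearity, norm bound, symmetry, commutation,
  products\<close>

lemma calc_eqI: "(\<lambda>n. approx n f x) \<longlonglongrightarrow> y \<Longrightarrow> calc f x = y"
  unfolding calc_def by (rule limI)

lemma calc_cong:
  assumes "\<And>a. 0 \<le> a \<Longrightarrow> a \<le> 1 \<Longrightarrow> f a = g a"
  shows "calc f x = calc g x"
proof -
  have "approx n f x = approx n g x" for n
    unfolding approx_def bern_sum_def
    by (intro sum.cong refl arg_cong2[where f = scaleR] assms) (auto simp: divide_le_eq simp del: of_nat_Suc)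
  then show ?thesis by (simp add: calc_def)
qed

lemma linear_approx: "linear (approx n f)" by (simp add: approx_def linear_bern_sum)

lemma calc_id: "calc (\<lambda>a. a) x = A x"
proof (rule calc_eqI)
  have "approx n (\<lambda>a. a) x = A x" for n
    using bern_sum_scale[of "Suc n" "1 / real (Suc n)" real x]
    by (simp add: approx_def bern_sum_of_nat del: of_nat_Suc)
  then show "(\<lambda>n. approx n (\<lambda>a. a) x) \<longlonglongrightarrow> A x" by simp
qed

lemma calc_add:
  assumes "continuous_on {0..1} f" "continuous_on {0..1} g"
  shows "calc (\<lambda>a. f a + g a) x = calc f x + calc g x"
  using tendsto_add[OF assms[THEN approx_tendsto]] by (intro calc_eqI) (simp add: approx_def bern_sum_add)

lemma calc_scale:
  assumes "continuous_on {0..1} f"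
  shows "calc (\<lambda>a. c * f a) x = c *\<^sub>R calc f x"
  using tendsto_scaleR[OF tendsto_const approx_tendsto[OF assms]]
  by (intro calc_eqI) (simp add: approx_def bern_sum_scale)

lemma calc_diff:
  assumes "continuous_on {0..1} f" "continuous_on {0..1} g"
  shows "calc (\<lambda>a. f a - g a) x = calc f x - calc g x"
proof -
  have "continuous_on {0..1} (\<lambda>a. - 1 * g a)" by (intro continuous_intros assms)
  from calc_add[OF assms(1) this] calc_scale[OF assms(2), of "- 1"] show ?thesis by simp
qed

lemma approx_norm:
  assumes "\<And>a. 0 \<le> a \<Longrightarrow> a \<le> 1 \<Longrightarrow> \<bar>f a\<bar> \<le> c"
  shows "norm (approx n f x) \<le> c * norm x"
  unfolding approx_def
  using double_sum_bound[of "Suc n" "Suc n" 0 "\<lambda>k l. f (real k / Suc n)" c x] assms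
  by (simp add: double_sum_fst divide_le_eq del: of_nat_Suc)

lemma calc_norm:
  assumes f: "continuous_on {0..1} f" and c: "\<And>a. 0 \<le> a \<Longrightarrow> a \<le> 1 \<Longrightarrow> \<bar>f a\<bar> \<le> c"
  shows "norm (calc f x) \<le> c * norm x"
  by (rule tendsto_upperbound[OF tendsto_norm[OF approx_tendsto[OF f]]])
    (use approx_norm[OF c] in auto)

lemma bounded_linear_calc:
  assumes f: "continuous_on {0..1} f"
  shows "bounded_linear (calc f)"
proof -
  have "compact (f ` {0..1})" by (intro compact_continuous_image f) simp
  then have "bounded (f ` {0..1})" by (rule compact_imp_bounded)
  then obtain K where K: "\<And>a. 0 \<le> a \<Longrightarrow> a \<le> 1 \<Longrightarrow> \<bar>f a\<bar> \<le> K" unfolding bounded_iff by force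
  show ?thesis
  proof (rule bounded_linear_intro[of _ K])
    show "calc f (x + y) = calc f x + calc f y" for x y
      using tendsto_add[OF approx_tendsto[OF f] approx_tendsto[OF f]]
      by (intro calc_eqI) (simp add: linear_add[OF linear_approx])
    show "calc f (c *\<^sub>R x) = c *\<^sub>R calc f x" for c x
      using tendsto_scaleR[OF tendsto_const approx_tendsto[OF f]]
      by (intro calc_eqI) (simp add: linear_scale[OF linear_approx])
    show "norm (calc f x) \<le> norm x * K" for x
      using calc_norm[OF f K] by (simp add: mult.commute)
  qed
qed

lemma calc_symmetric:
  assumes f: "continuous_on {0..1} f"
  shows "inner (calc f x) y = inner x (calc f y)"
proof (rule LIMSEQ_unique)
  show "(\<lambda>n. inner (approx n f x) y) \<longlonglongrightarrow> inner (calc f x) y"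
    by (intro tendsto_intros approx_tendsto f)
  have "inner (approx n f x) y = inner x (approx n f y)" for n
    by (simp add: approx_def bern_sum_symmetric)
  then show "(\<lambda>n. inner (approx n f x) y) \<longlonglongrightarrow> inner x (calc f y)"
    using tendsto_inner[OF tendsto_const approx_tendsto[OF f]] by simp
qed

lemma calc_commute:
  assumes f: "continuous_on {0..1} f" and Z: "bounded_linear Z" "\<And>x. Z (A x) = A (Z x)"
  shows "Z (calc f x) = calc f (Z x)"
proof (rule LIMSEQ_unique)
  show "(\<lambda>n. Z (approx n f x)) \<longlonglongrightarrow> Z (calc f x)"
    by (intro bounded_linear.tendsto[OF Z(1)] approx_tendsto f)
  have lin: "linear Z" by (rule bounded_linear.linear[OF Z(1)])
  have "Z (approx n f x) = approx n f (Z x)" for n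
    by (simp add: approx_def bern_sum_def linear_sum[OF lin] linear_scale[OF lin]
        cone_commute_operator[OF lin Z(2) bernstein_cone] del: bernstein.simps sum.atMost_Suc)
  then show "(\<lambda>n. Z (approx n f x)) \<longlonglongrightarrow> calc f (Z x)"
    using approx_tendsto[OF f] by simp
qed

text \<open>The product sampled on two independent grids differs from the product sampled on one by
  f(k/n) (g(l/n) - g(k/n)); boundedness of f and the modulus of g suffice.\<close>

lemma approx_mult_bound:
  assumes M: "M \<ge> 0" "\<And>s t. s \<in> {0..1} \<Longrightarrow> t \<in> {0..1} \<Longrightarrow> \<bar>g s - g t\<bar> \<le> e + M * (s - t)\<^sup>2"
    and K: "\<And>a. 0 \<le> a \<Longrightarrow> a \<le> 1 \<Longrightarrow> \<bar>f a\<bar> \<le> K" and e: "e > 0"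
  shows "norm (approx n f (approx n g x) - approx n (\<lambda>a. f a * g a) x)
      \<le> K * (e + M * (2 / Suc n)) * norm x"
proof -
  define N where "N = real (Suc n)"
  have N: "N > 0" by (simp add: N_def)
  have K0: "K \<ge> 0" using K[of 0] by auto
  define F where "F k l = f (real k / N) * g (real l / N) - f (real k / N) * g (real k / N)" for k l
  have "approx n f (approx n g x) - approx n (\<lambda>a. f a * g a) x = double_sum (Suc n) (Suc n) F x"
    unfolding approx_def F_def N_def double_sum_diff double_sum_product by (simp only: double_sum_fst)
  moreover have "norm (double_sum (Suc n) (Suc n) F x)
      \<le> (K * e + K * M * (1 / real (Suc n) + 1 / real (Suc n))) * norm x"
  proof (rule double_sum_bound)
    fix k l assume kl: "k \<le> Suc n" "l \<le> Suc n"
    then have I: "real k / N \<in> {0..1}" "real l / N \<in> {0..1}"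
      using N by (auto simp: N_def divide_le_eq simp del: of_nat_Suc)
    have "\<bar>F k l\<bar> = \<bar>f (real k / N)\<bar> * \<bar>g (real k / N) - g (real l / N)\<bar>"
      unfolding F_def right_diff_distrib[symmetric] abs_mult by (simp add: abs_minus_commute)
    also have "\<dots> \<le> K * (e + M * (real k / N - real l / N)\<^sup>2)"
      using I K0 by (intro mult_mono K M(2)) auto
    finally show "\<bar>F k l\<bar> \<le> K * e + K * M * (real k / real (Suc n) - real l / real (Suc n))\<^sup>2"
      by (simp add: N_def algebra_simps)
  qed (use M(1) K0 in auto)
  ultimately show ?thesis by (simp add: algebra_simps)
qed

lemma calc_mult:
  assumes f: "continuous_on {0..1} f" and g: "continuous_on {0..1} g"
  shows "calc (\<lambda>a. f a * g a) x = calc f (calc g x)"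
proof -
  have "compact (f ` {0..1})" by (intro compact_continuous_image f) simp
  then have "bounded (f ` {0..1})" by (rule compact_imp_bounded)
  then obtain K where K: "\<And>a. 0 \<le> a \<Longrightarrow> a \<le> 1 \<Longrightarrow> \<bar>f a\<bar> \<le> K" unfolding bounded_iff by force
  have K0: "K \<ge> 0" using K[of 0] by auto
  have fg: "continuous_on {0..1} (\<lambda>a. f a * g a)" by (intro continuous_intros f g)
  have lim1: "(\<lambda>n. approx n f (approx n g x)) \<longlonglongrightarrow> calc f (calc g x)"
  proof -
    \<comment> \<open>The operators \<open>approx n f\<close> are bounded by K uniformly in n, so
      their argument may itself converge.\<close>
    have "(\<lambda>n. approx n f (approx n g x - calc g x)) \<longlonglongrightarrow> 0"
    proof (rule Lim_null_comparison)
      show "\<forall>\<^sub>F n in sequentially. norm (approx n f (approx n g x - calc g x)) \<le> K * norm (approx n g x - calc g x)"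
        using approx_norm[OF K] by simp
      show "(\<lambda>n. K * norm (approx n g x - calc g x)) \<longlonglongrightarrow> 0"
        using tendsto_mult_left[OF tendsto_norm_zero[OF LIM_zero[OF approx_tendsto[OF g]]], of K x]
        by simp
    qed
    from tendsto_add[OF this approx_tendsto[OF f, of "calc g x"]]
    show ?thesis by (simp add: linear_diff[OF linear_approx])
  qed
  have bound: "norm (calc f (calc g x) - calc (\<lambda>a. f a * g a) x) \<le> K * e * norm x" if e: "e > 0" for e
  proof -
    obtain M where M: "M \<ge> 0"
      "\<And>s t. s \<in> {0..1} \<Longrightarrow> t \<in> {0..1} \<Longrightarrow> \<bar>g s - g t\<bar> \<le> e + M * (s - t)\<^sup>2"
      using quadratic_modulus[OF g e] by metis
    show ?thesis
    proof (rule LIMSEQ_le)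
      show "(\<lambda>n. norm (approx n f (approx n g x) - approx n (\<lambda>a. f a * g a) x))
          \<longlonglongrightarrow> norm (calc f (calc g x) - calc (\<lambda>a. f a * g a) x)"
        by (intro tendsto_intros lim1 approx_tendsto fg)
      have "(\<lambda>n. K * (e + M * (2 / real (Suc n))) * norm x) \<longlonglongrightarrow> K * (e + M * 0) * norm x"
        by (intro tendsto_intros inverse_Suc_tendsto)
      then show "(\<lambda>n. K * (e + M * (2 / real (Suc n))) * norm x) \<longlonglongrightarrow> K * e * norm x" by simp
      show "\<exists>N. \<forall>n\<ge>N. norm (approx n f (approx n g x) - approx n (\<lambda>a. f a * g a) x)
          \<le> K * (e + M * (2 / real (Suc n))) * norm x"
        by (intro exI[of _ 0] allI impI approx_mult_bound[OF M K e])
    qed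
  qed
  have "norm (calc f (calc g x) - calc (\<lambda>a. f a * g a) x) \<le> 0"
  proof (rule field_le_epsilon)
    fix e :: real assume e: "e > 0"
    define X where "X = K * norm x + 1"
    have X: "X > 0" using K0 by (simp add: X_def add_nonneg_pos)
    have "K * (e / X) * norm x = e * (K * norm x) / X" by simp
    also have "\<dots> \<le> e * X / X" using e X by (intro divide_right_mono mult_left_mono) (auto simp: X_def)
    also have "\<dots> = e" using X by simp
    finally show "norm (calc f (calc g x) - calc (\<lambda>a. f a * g a) x) \<le> 0 + e"
      using bound[of "e / X"] e X by simp
  qed
  then show ?thesis by simp
qed

end

section \<open>The decaying exponential as a function of the resolvent\<close>

text \<open>If T is self-adjoint and a is the value of A = 1/(1 + T^2), then the absolute value of T takes the
  value \<open>rate a\<close>; the value a = 0 corresponds to infinity.\<close>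

definition rate :: "real \<Rightarrow> real" where "rate a = sqrt (1 / a - 1)"

text \<open>The function s^j exp (- x s) of s = |T|, extended by its limit 0 at s = infinity. Here j
  = 0 gives the semigroup and j = 1 minus its derivative in x.\<close>

definition expo :: "nat \<Rightarrow> real \<Rightarrow> real \<Rightarrow> real" where
  "expo j x a = (if a \<le> 0 then 0 else rate a ^ j * exp (- x * rate a))"

text \<open>The value of |T| / (1 + T^2): with s = \<open>rate a\<close> it is a s, hence the root
  of a - a^2.\<close>

definition absC :: "real \<Rightarrow> real" where "absC a = sqrt (a - a * a)"

lemma rate_nonneg: "0 < a \<Longrightarrow> a \<le> 1 \<Longrightarrow> 0 \<le> rate a"
  by (simp add: rate_def)

lemma mult_rate: "0 < a \<Longrightarrow> a * rate a = absC a"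
proof -
  assume a: "0 < a"
  have "a * rate a = sqrt (a\<^sup>2) * sqrt (1 / a - 1)" using a by (simp add: rate_def)
  also have "\<dots> = sqrt (a\<^sup>2 * (1 / a - 1))" by (rule real_sqrt_mult[symmetric])
  also have "a\<^sup>2 * (1 / a - 1) = a - a * a" using a by (simp add: power2_eq_square field_simps)
  finally show ?thesis by (simp add: absC_def)
qed

lemma rate_at_top: "filterlim rate at_top (at_right 0)"
proof -
  have "filterlim (\<lambda>a::real. - 1 + inverse a) at_top (at_right 0)"
    by (intro filterlim_tendsto_add_at_top[OF tendsto_const] filterlim_inverse_at_top_right)
  from filterlim_compose[OF sqrt_at_top this] show ?thesis
    by (simp add: rate_def[abs_def] divide_inverse)
qed

lemma power_mult_exp_tendsto_0:
  assumes "x > 0"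
  shows "((\<lambda>s::real. s ^ j * exp (- x * s)) \<longlongrightarrow> 0) at_top"
proof -
  have "filterlim (\<lambda>s. x * s) at_top at_top"
    by (rule filterlim_tendsto_pos_mult_at_top[OF tendsto_const assms filterlim_ident])
  then have "((\<lambda>s. (x * s) ^ j / exp (x * s)) \<longlongrightarrow> 0) at_top"
    by (rule filterlim_compose[OF tendsto_power_div_exp_0])
  from tendsto_mult_left[OF this, of "1 / x ^ j"] show ?thesis
    using assms by (simp add: exp_minus power_mult_distrib field_simps)
qed

text \<open>The only critical point is a = 0, where the exponential beats every power of s. For x =
  0 and j = 0 the function jumps there, which is why x = 0 is treated separately in
  \<open>orbit\<close>.\<close>

lemma continuous_expo:
  assumes x: "x > 0"
  shows "continuous_on {0..1} (expo j x)"
  unfolding continuous_on_def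
proof
  fix a :: real assume a: "a \<in> {0..1}"
  show "(expo j x \<longlongrightarrow> expo j x a) (at a within {0..1})"
  proof (cases "a = 0")
    case True
    have "((\<lambda>a. rate a ^ j * exp (- x * rate a)) \<longlongrightarrow> 0) (at_right 0)"
      by (rule filterlim_compose[OF power_mult_exp_tendsto_0[OF x] rate_at_top])
    moreover have "\<forall>\<^sub>F a in at_right 0. rate a ^ j * exp (- x * rate a) = expo j x a"
      using eventually_at_right_less[of "0::real"] by eventually_elim (simp add: expo_def)
    ultimately have "(expo j x \<longlongrightarrow> 0) (at_right 0)" by (rule Lim_transform_eventually)
    then show ?thesis using True by (simp add: expo_def at_within_Icc_at_right)
  next
    case False
    then have pos: "a > 0" using a by auto
    have "((\<lambda>a. rate a ^ j * exp (- x * rate a)) \<longlongrightarrow> rate a ^ j * exp (- x * rate a)) (at a within {0..1})"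
      unfolding rate_def using pos by (intro tendsto_intros) auto
    moreover have "\<forall>\<^sub>F a in at a within {0..1}. rate a ^ j * exp (- x * rate a) = expo j x a"
    proof -
      have "\<forall>\<^sub>F b in at a within {0..1}. b > 0" using pos
        by (intro order_tendstoD(1)[OF tendsto_ident_at])
      then show ?thesis by eventually_elim (simp add: expo_def)
    qed
    ultimately have "(expo j x \<longlongrightarrow> rate a ^ j * exp (- x * rate a)) (at a within {0..1})"
      by (rule Lim_transform_eventually)
    then show ?thesis using pos by (simp add: expo_def)
  qed
qed

lemma continuous_absC: "continuous_on {0..1} absC"
  unfolding absC_def by (intro continuous_intros)

lemma square_mult_exp_le:
  fixes s x :: real
  assumes "s \<ge> 0" "x > 0"
  shows "s\<^sup>2 * exp (- x * s) \<le> 2 / x\<^sup>2"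
proof -
  have "1 + x * s + (x * s)\<^sup>2 / 2 \<le> exp (x * s)"
    using assms by (intro exp_lower_Taylor_quadratic) simp
  then have "(x * s)\<^sup>2 / 2 \<le> exp (x * s)" using assms by (smt (verit) mult_nonneg_nonneg)
  then show ?thesis using assms by (simp add: exp_minus power_mult_distrib field_simps)
qed

text \<open>The factor 1 + exp z serves both signs of z. With z = - (y - x) s, multiplication by exp
  (- x s) turns it into exp (- x s) + exp (- y s), which \<open>square_mult_exp_sum_le\<close>
  controls.\<close>

lemma exp_remainder_le:
  fixes z :: real
  shows "\<bar>exp z - 1 - z\<bar> \<le> z\<^sup>2 * (1 + exp z)" and "\<bar>exp z - 1\<bar> \<le> \<bar>z\<bar> * (1 + exp z)"
proof -
  have 1: "1 + z \<le> exp z" by (rule exp_ge_add_one_self)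
  have "1 - z \<le> exp (- z)" using exp_ge_add_one_self[of "- z"] by simp
  then have "(1 - z) * exp z \<le> exp (- z) * exp z" by (intro mult_right_mono) auto
  then have 2: "exp z - 1 \<le> z * exp z" by (simp add: exp_minus_inverse algebra_simps exp_minus)
  show abs: "\<bar>exp z - 1\<bar> \<le> \<bar>z\<bar> * (1 + exp z)"
  proof (cases "z \<ge> 0")
    case True
    then have "1 \<le> exp z" by simp
    then show ?thesis using 2 True by (simp add: algebra_simps)
  next
    case False
    then have "exp z \<le> 1" "z * exp z \<le> 0" by (auto simp: mult_le_0_iff)
    moreover have "- z * (1 + exp z) = - z - z * exp z" by (simp add: algebra_simps)
    ultimately show ?thesis using 1 False by linarith
  qed
  have "exp z - 1 - z \<le> z * (exp z - 1)" using 2 by (simp add: algebra_simps)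
  also have "\<dots> \<le> \<bar>z\<bar> * \<bar>exp z - 1\<bar>" by (simp add: abs_mult[symmetric])
  also have "\<dots> \<le> \<bar>z\<bar> * (\<bar>z\<bar> * (1 + exp z))" by (intro mult_left_mono abs) simp
  also have "\<dots> = z\<^sup>2 * (1 + exp z)" by (simp add: power2_eq_square mult.assoc[symmetric])
  finally show "\<bar>exp z - 1 - z\<bar> \<le> z\<^sup>2 * (1 + exp z)" using 1 by linarith
qed

text \<open>Both exponentials are at most exp (- (x / 2) s), and \<open>square_mult_exp_le\<close>
  at x / 2 then gives 2 times 2 / (x / 2)^2, that is 16 / x^2.\<close>

lemma square_mult_exp_sum_le:
  fixes s x y :: real
  assumes "s \<ge> 0" "x > 0" "y \<ge> x / 2"
  shows "s\<^sup>2 * (exp (- x * s) + exp (- y * s)) \<le> 16 / x\<^sup>2"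
proof -
  have "exp (- x * s) \<le> exp (- (x / 2) * s)" "exp (- y * s) \<le> exp (- (x / 2) * s)"
    using assms mult_right_mono[OF assms(3,1)] by auto
  then have "exp (- x * s) + exp (- y * s) \<le> 2 * exp (- (x / 2) * s)" by linarith
  then have "s\<^sup>2 * (exp (- x * s) + exp (- y * s)) \<le> s\<^sup>2 * (2 * exp (- (x / 2) * s))"
    by (rule mult_left_mono) simp
  also have "\<dots> = 2 * (s\<^sup>2 * exp (- (x / 2) * s))" by simp
  also have "\<dots> \<le> 2 * (2 / (x / 2)\<^sup>2)"
    using assms by (intro mult_left_mono square_mult_exp_le) auto
  finally show ?thesis by (simp add: power_divide)
qed

lemma exp_diff_factor: "exp (- y * s) = exp (- x * s) * exp (- (y - x) * s)" for s :: real
  by (simp add: exp_add[symmetric] algebra_simps)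

text \<open>The bound is uniform in the spectral value a, so \<open>calc_norm\<close> converts it
  into a norm estimate valid for every initial vector. The condition y >= x / 2 keeps both
  exponentials decaying.\<close>

lemma expo_taylor:
  assumes x: "x > 0" and y: "y \<ge> x / 2" and a: "a \<le> 1"
  shows "\<bar>expo 0 y a - expo 0 x a + (y - x) * expo 1 x a\<bar> \<le> 16 / x\<^sup>2 * (y - x)\<^sup>2"
proof (cases "a \<le> 0")
  case False
  define s where "s = rate a"
  have s: "s \<ge> 0" using rate_nonneg False a by (simp add: s_def)
  define z where "z = - (y - x) * s"
  have "expo 0 y a - expo 0 x a + (y - x) * expo 1 x a = exp (- x * s) * (exp z - 1 - z)"
    using False exp_diff_factor[of y s x] by (simp add: expo_def s_def[symmetric] z_def algebra_simps)
  then have "\<bar>expo 0 y a - expo 0 x a + (y - x) * expo 1 x a\<bar> \<le> exp (- x * s) * (z\<^sup>2 * (1 + exp z))"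
    using exp_remainder_le(1)[of z] by (simp add: abs_mult)
  also have "\<dots> = (y - x)\<^sup>2 * (s\<^sup>2 * (exp (- x * s) + exp (- y * s)))"
  proof -
    have "z\<^sup>2 = (y - x)\<^sup>2 * s\<^sup>2" by (simp add: z_def power_mult_distrib power2_commute)
    moreover have "exp (- y * s) = exp (- x * s) * exp z" unfolding z_def by (rule exp_diff_factor)
    ultimately show ?thesis by (simp only:) (simp add: power2_eq_square algebra_simps)
  qed
  also have "\<dots> \<le> (y - x)\<^sup>2 * (16 / x\<^sup>2)"
    by (intro mult_left_mono square_mult_exp_sum_le s x y) simp
  finally show ?thesis by (simp add: mult.commute)
qed (simp add: expo_def)

lemma expo_1_lipschitz:
  assumes x: "x > 0" and y: "y \<ge> x / 2" and a: "a \<le> 1"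
  shows "\<bar>expo 1 y a - expo 1 x a\<bar> \<le> 16 / x\<^sup>2 * \<bar>y - x\<bar>"
proof (cases "a \<le> 0")
  case False
  define s where "s = rate a"
  have s: "s \<ge> 0" using rate_nonneg False a by (simp add: s_def)
  define z where "z = - (y - x) * s"
  have "expo 1 y a - expo 1 x a = s * exp (- x * s) * (exp z - 1)"
    using False exp_diff_factor[of y s x] by (simp add: expo_def s_def[symmetric] z_def algebra_simps)
  then have "\<bar>expo 1 y a - expo 1 x a\<bar> \<le> s * exp (- x * s) * (\<bar>z\<bar> * (1 + exp z))"
    using exp_remainder_le(2)[of z] s by (simp add: abs_mult mult_left_mono)
  also have "\<dots> = \<bar>y - x\<bar> * (s\<^sup>2 * (exp (- x * s) + exp (- y * s)))"
  proof -
    have "\<bar>z\<bar> = \<bar>y - x\<bar> * s" using s by (simp add: z_def abs_mult abs_minus_commute)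
    moreover have "exp (- y * s) = exp (- x * s) * exp z" unfolding z_def by (rule exp_diff_factor)
    ultimately show ?thesis by (simp only:) (simp add: power2_eq_square algebra_simps)
  qed
  also have "\<dots> \<le> \<bar>y - x\<bar> * (16 / x\<^sup>2)"
    by (intro mult_left_mono square_mult_exp_sum_le s x y) simp
  finally show ?thesis by (simp add: mult.commute)
qed (simp add: expo_def)

text \<open>In this order: contractivity, a rate for x -> 0 on the range of \<open>A\<close>, a rate
  for x -> infinity on the range of \<open>Q\<close>, and the identity that exhibits the generator
  as |T|.\<close>

lemma expo_0_bounds:
  assumes "x > 0" "0 \<le> a" "a \<le> 1"
  shows "\<bar>expo 0 x a\<bar> \<le> 1" and "\<bar>expo 0 x a * a - a\<bar> \<le> x" and "\<bar>expo 0 x a * absC a\<bar> \<le> 1 / x"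
    and "expo 0 x a * absC a = expo 1 x a * a"
proof -
  have "\<bar>expo 0 x a\<bar> \<le> 1 \<and> \<bar>expo 0 x a * a - a\<bar> \<le> x \<and> \<bar>expo 0 x a * absC a\<bar> \<le> 1 / x
      \<and> expo 0 x a * absC a = expo 1 x a * a"
  proof (cases "a = 0")
    case False
    then have a: "0 < a" using assms by simp
    define s where "s = rate a"
    have s: "s \<ge> 0" using rate_nonneg a assms by (simp add: s_def)
    have as: "absC a = a * s" using mult_rate[OF a] by (simp add: s_def)
    have as1: "a * s \<le> 1"
      unfolding as[symmetric] absC_def using a assms by (simp add: algebra_simps add_increasing2)
    have e: "expo 0 x a = exp (- x * s)" "expo 1 x a = s * exp (- x * s)"
      using a by (auto simp: expo_def s_def)
    have "x * s \<le> exp (x * s)" using exp_ge_add_one_self[of "x * s"] by linarith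
    then have "s * exp (- x * s) \<le> 1 / x" using assms by (simp add: exp_minus field_simps)
    then have "a * (s * exp (- x * s)) \<le> 1 * (1 / x)"
      using a assms s by (intro mult_mono) auto
    moreover have "a - exp (- x * s) * a \<le> x"
    proof -
      have "1 - exp (- x * s) \<le> x * s" using exp_ge_add_one_self[of "- x * s"] by simp
      then have "a * (1 - exp (- x * s)) \<le> a * (x * s)" using a by (intro mult_left_mono) auto
      also have "\<dots> = x * (a * s)" by simp
      also have "\<dots> \<le> x * 1" using as1 assms by (intro mult_left_mono) auto
      finally show ?thesis by (simp add: algebra_simps)
    qed
    moreover have "exp (- x * s) \<le> 1" "exp (- x * s) * a \<le> a"
      using s assms a by auto
    ultimately show ?thesis using s a assms by (simp add: e e(2)[unfolded One_nat_def] as abs_mult algebra_simps)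
  qed (use assms in \<open>simp add: expo_def absC_def\<close>)
  then show "\<bar>expo 0 x a\<bar> \<le> 1" "\<bar>expo 0 x a * a - a\<bar> \<le> x" "\<bar>expo 0 x a * absC a\<bar> \<le> 1 / x"
    "expo 0 x a * absC a = expo 1 x a * a" by auto
qed

text \<open>Equicontinuity extends convergence from a dense set. This compensates for the absence of
  uniform rates in both limits of the semigroup.\<close>

lemma tendsto_zero_dense:
  fixes U :: "'s \<Rightarrow> 'a::real_normed_vector \<Rightarrow> 'b::real_normed_vector"
  assumes K: "\<forall>\<^sub>F s in F. \<forall>h k. norm (U s h - U s k) \<le> K * norm (h - k)"
    and dense: "closure S = UNIV" and lim: "\<And>h. h \<in> S \<Longrightarrow> ((\<lambda>s. U s h) \<longlongrightarrow> 0) F"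
  shows "((\<lambda>s. U s h) \<longlongrightarrow> 0) F"
proof (rule tendstoI)
  fix e :: real assume e: "e > 0"
  define X where "X = \<bar>K\<bar> + 1"
  have X0: "X > 0" by (simp add: X_def)
  define d where "d = e / 2 / X"
  have d: "d > 0" using e X0 by (simp add: d_def)
  have Kd: "\<bar>K\<bar> * d \<le> e / 2"
  proof -
    have "\<bar>K\<bar> * d \<le> X * d" using d by (simp add: X_def)
    also have "\<dots> = e / 2" using X0 by (simp add: d_def)
    finally show ?thesis .
  qed
  have "h \<in> closure S" by (simp add: dense)
  then obtain k where k: "k \<in> S" "dist k h < d" using d closure_approachable by metis
  have "\<forall>\<^sub>F s in F. norm (U s k) < e / 2"
    using tendstoD[OF lim[OF k(1)], of "e / 2"] e by simp
  then show "\<forall>\<^sub>F s in F. dist (U s h) 0 < e"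
    using K
  proof eventually_elim
    case (elim s)
    have "norm (U s h - U s k) \<le> K * norm (h - k)" using elim(2) by blast
    also have "\<dots> \<le> \<bar>K\<bar> * d"
      using k(2) by (intro mult_mono) (auto simp: dist_norm norm_minus_commute)
    finally have "norm (U s h - U s k) \<le> e / 2" using Kd by simp
    then show ?case using elim(1) norm_triangle_sub[of "U s h" "U s k"] by simp
  qed
qed

lemma has_vector_derivativeI_quadratic:
  fixes f :: "real \<Rightarrow> 'a::real_normed_vector"
  assumes "\<forall>\<^sub>F y in at x. norm (f y - f x - (y - x) *\<^sub>R d) \<le> K * (y - x)\<^sup>2"
  shows "(f has_vector_derivative d) (at x)"
  unfolding has_vector_derivative_def has_derivative_iff_norm
proof
  show "bounded_linear (\<lambda>y. y *\<^sub>R d)" by (rule bounded_linear_scaleR_left)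
  show "((\<lambda>y. norm (f y - f x - (y - x) *\<^sub>R d) / norm (y - x)) \<longlongrightarrow> 0) (at x)"
  proof (rule Lim_null_comparison)
    have "\<forall>\<^sub>F y in at x. y \<noteq> x" by (simp add: eventually_at_filter)
    then show "\<forall>\<^sub>F y in at x. norm (norm (f y - f x - (y - x) *\<^sub>R d) / norm (y - x)) \<le> K * \<bar>y - x\<bar>"
      using assms
    proof eventually_elim
      case (elim y)
      then show ?case by (simp add: divide_le_eq power2_eq_square mult.assoc)
    qed
    have "((\<lambda>y. K * \<bar>y - x\<bar>) \<longlongrightarrow> K * \<bar>x - x\<bar>) (at x)" by (intro tendsto_intros)
    then show "((\<lambda>y. K * \<bar>y - x\<bar>) \<longlongrightarrow> 0) (at x)" by simp
  qed
qed

section \<open>Half-spaces and decaying orbits of an injective self-adjoint operator\<close>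

locale injective_selfadjoint =
  fixes D :: "'h::{real_inner,complete_space} set" and T :: "'h \<Rightarrow> 'h"
  assumes subspace_D: "subspace D"
    and T_add: "x \<in> D \<Longrightarrow> y \<in> D \<Longrightarrow> T (x + y) = T x + T y"
    and T_scale: "x \<in> D \<Longrightarrow> T (r *\<^sub>R x) = r *\<^sub>R T x"
    and dense_D: "closure D = UNIV"
    and T_symmetric: "x \<in> D \<Longrightarrow> y \<in> D \<Longrightarrow> inner (T x) y = inner x (T y)"
    and T_maximal: "(\<And>x. x \<in> D \<Longrightarrow> inner (T x) y = inner x z) \<Longrightarrow> y \<in> D"
    and T_injective: "x \<in> D \<Longrightarrow> T x = 0 \<Longrightarrow> x = 0"
begin

lemma T_diff: "x \<in> D \<Longrightarrow> y \<in> D \<Longrightarrow> T (x - y) = T x - T y"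
  using T_add[of x "- 1 *\<^sub>R y"] T_scale[of y "- 1"] subspace_scale[OF subspace_D, of y "- 1"] by simp

lemma T_zero: "T 0 = 0" using T_scale[OF subspace_0[OF subspace_D], of 0] by simp

lemma orthogonal_D_eq_0:
  assumes "\<And>x. x \<in> D \<Longrightarrow> inner x v = 0"
  shows "v = 0"
proof -
  have "closed {x. inner x v = 0}" by (intro closed_Collect_eq continuous_intros)
  then have "closure D \<subseteq> {x. inner x v = 0}" using assms by (intro closure_minimal) auto
  then have "v \<in> {x. inner x v = 0}" unfolding dense_D by (rule subsetD) simp
  then show ?thesis by simp
qed

lemma adjointI:
  assumes "\<And>x. x \<in> D \<Longrightarrow> inner (T x) y = inner x z"
  shows "y \<in> D" and "T y = z"
proof -
  show y: "y \<in> D" using T_maximal assms by blast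
  have "T y - z = 0"
    by (rule orthogonal_D_eq_0) (simp add: inner_diff_right T_symmetric[symmetric] y assms)
  then show "T y = z" by simp
qed

lemma T_closed:
  assumes X: "\<And>n. X n \<in> D" and x: "(X \<longlongrightarrow> x) F" and y: "((\<lambda>n. T (X n)) \<longlongrightarrow> y) F" and F: "F \<noteq> bot"
  shows "x \<in> D" and "T x = y"
proof -
  have "inner (T z) x = inner z y" if z: "z \<in> D" for z
  proof (rule tendsto_unique[OF F])
    show "((\<lambda>n. inner (T z) (X n)) \<longlongrightarrow> inner (T z) x) F" by (intro tendsto_intros x)
    show "((\<lambda>n. inner (T z) (X n)) \<longlongrightarrow> inner z y) F"
      using tendsto_inner[OF tendsto_const y, of z] by (simp add: T_symmetric X z)
  qed
  then show "x \<in> D" "T x = y" using adjointI by blast+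
qed

text \<open>\<open>A\<close> is (1 + T^2)^{-1}, and \<open>C\<close> below is T (1 + T^2)^{-1}. The
  latter is bounded but still carries the sign of T.\<close>

definition A :: "'h \<Rightarrow> 'h" where "A h = (SOME a. a \<in> D \<and> T a \<in> D \<and> a + T (T a) = h)"

definition C :: "'h \<Rightarrow> 'h" where "C h = T (A h)"

text \<open>The resolvent is read off the projection of (h, 0) onto the graph of T.\<close>

lemma A_exists: "\<exists>a. a \<in> D \<and> T a \<in> D \<and> a + T (T a) = h"
proof -
  let ?G = "(\<lambda>x. (x, T x)) ` D"
  have sub: "subspace ?G"
  proof (rule subspaceI)
    show "0 \<in> ?G" using subspace_0[OF subspace_D] T_zero by (force simp: zero_prod_def)
    show "x + y \<in> ?G" if "x \<in> ?G" "y \<in> ?G" for x y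
      using that T_add subspace_add[OF subspace_D] by force
    show "c *\<^sub>R x \<in> ?G" if "x \<in> ?G" for c x
      using that T_scale subspace_scale[OF subspace_D] by force
  qed
  have cl: "closed ?G"
    unfolding closed_sequential_limits
  proof (intro allI impI, elim conjE)
    fix P l assume P: "\<forall>n. P n \<in> ?G" "P \<longlonglongrightarrow> l"
    have PD: "fst (P n) \<in> D" "T (fst (P n)) = snd (P n)" for n using P(1)[rule_format, of n] by auto
    have "(\<lambda>n. T (fst (P n))) \<longlonglongrightarrow> snd l" unfolding PD(2) by (rule tendsto_snd[OF P(2)])
    then have "fst l \<in> D" "T (fst l) = snd l"
      by (rule T_closed[OF PD(1) tendsto_fst[OF P(2)]], simp)+
    then show "l \<in> ?G" by (intro image_eqI[of _ _ "fst l"]) (simp_all add: prod_eq_iff)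
  qed
  obtain y where y: "y \<in> ?G" "\<And>m. m \<in> ?G \<Longrightarrow> inner ((h, 0) - y) m = 0"
    using orthogonal_projection_exists[OF sub cl] by metis
  then obtain a where a: "a \<in> D" "y = (a, T a)" by auto
  \<comment> \<open>Orthogonality of (h - a, - T a) to the graph is precisely the adjoint relation
    for T a, with value h - a.\<close>
  have "inner (T x) (T a) = inner x (h - a)" if "x \<in> D" for x
    using y(2)[of "(x, T x)"] that by (auto simp: a inner_diff_left inner_diff_right inner_commute)
  then have "T a \<in> D" "T (T a) = h - a" using adjointI by blast+
  then show ?thesis using a by auto
qed

lemma A_props: "A h \<in> D" "C h \<in> D" "A h + T (C h) = h"
  using someI_ex[OF A_exists[of h]] by (auto simp: A_def C_def)

text \<open>Obtained by splitting k as A k + T (C k). Symmetry, nonnegativity and both norm bounds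
  are read off this identity.\<close>

lemma A_inner: "inner (A h) k = inner (A h) (A k) + inner (C h) (C k)"
proof -
  have "inner (A h) k = inner (A h) (A k) + inner (A h) (T (C k))"
    by (metis A_props(3) inner_add_right)
  also have "inner (A h) (T (C k)) = inner (C h) (C k)"
    using T_symmetric[OF A_props(1) A_props(2), of h k] by (simp add: C_def[of h])
  finally show ?thesis .
qed

lemma A_norm: "norm (A h) \<le> norm h" and C_norm: "norm (C h) \<le> norm h"
proof -
  have sum: "(norm (A h))\<^sup>2 + (norm (C h))\<^sup>2 \<le> norm (A h) * norm h"
    using A_inner[of h h] norm_cauchy_schwarz[of "A h" h] by (simp add: power2_norm_eq_inner)
  then have "norm (A h) * norm (A h) \<le> norm (A h) * norm h"
    by (simp add: power2_eq_square) (smt (verit) mult_nonneg_nonneg norm_ge_zero)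
  then show A: "norm (A h) \<le> norm h" by (cases "norm (A h) = 0") auto
  have "(norm (C h))\<^sup>2 \<le> norm (A h) * norm h" using sum by (smt (verit) zero_le_power2)
  also have "\<dots> \<le> (norm h)\<^sup>2" using A by (simp add: power2_eq_square mult_right_mono)
  finally show "norm (C h) \<le> norm h" by (rule power2_le_imp_le) simp
qed

lemma A_eqI:
  assumes "a \<in> D" "T a \<in> D" "a + T (T a) = h"
  shows "A h = a"
proof -
  define d where "d = A h - a"
  have d: "d \<in> D" "T d \<in> D" "T d = C h - T a" "T (T d) = T (C h) - T (T a)"
    using assms A_props[of h] by (auto simp: d_def T_diff C_def subspace_diff[OF subspace_D])
  then have "d + T (T d) = 0" using assms(3) A_props(3)[of h] unfolding d(4) unfolding d_def
    by (simp add: algebra_simps)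
  then have "inner d d + inner (T d) (T d) = 0"
    using T_symmetric[OF d(1,2)] by (metis inner_add_right inner_zero_right)
  then have "inner d d = 0" by (metis add_nonneg_eq_0_iff inner_ge_zero)
  then show ?thesis by (simp add: d_def)
qed

lemma A_add: "A (h + k) = A h + A k" and C_add: "C (h + k) = C h + C k"
proof -
  show A: "A (h + k) = A h + A k"
  proof (rule A_eqI)
    show "A h + A k \<in> D" by (intro subspace_add[OF subspace_D] A_props)
    have "T (A h + A k) = C h + C k" by (simp add: T_add A_props C_def)
    then show "T (A h + A k) \<in> D" "A h + A k + T (T (A h + A k)) = h + k"
      using A_props(3)[of h] A_props(3)[of k]
      by (auto simp: T_add A_props subspace_add[OF subspace_D] algebra_simps)
  qed
  then show "C (h + k) = C h + C k" by (simp add: C_def T_add A_props)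
qed

lemma A_scale: "A (r *\<^sub>R h) = r *\<^sub>R A h" and C_scale: "C (r *\<^sub>R h) = r *\<^sub>R C h"
proof -
  show A: "A (r *\<^sub>R h) = r *\<^sub>R A h"
  proof (rule A_eqI)
    show "r *\<^sub>R A h \<in> D" by (intro subspace_scale[OF subspace_D] A_props)
    have "T (r *\<^sub>R A h) = r *\<^sub>R C h" by (simp add: T_scale A_props C_def)
    then show "T (r *\<^sub>R A h) \<in> D" "r *\<^sub>R A h + T (T (r *\<^sub>R A h)) = r *\<^sub>R h"
      using A_props(3)[of h]
      by (auto simp: T_scale T_zero A_props subspace_0[OF subspace_D] subspace_scale[OF subspace_D]
          scaleR_add_right[symmetric])
  qed
  then show "C (r *\<^sub>R h) = r *\<^sub>R C h" by (simp add: C_def T_scale A_props)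
qed

lemma bounded_linear_resolvent: "bounded_linear A"
  using A_norm by (intro bounded_linear_intro[of _ 1]) (auto simp: A_add A_scale)
lemma bounded_linear_C: "bounded_linear C"
  using C_norm by (intro bounded_linear_intro[of _ 1]) (auto simp: C_add C_scale)

lemma A_symmetric: "inner (A h) k = inner h (A k)"
  by (metis A_inner inner_commute)

sublocale positive_contraction A
proof (rule positive_contraction.intro)
  show "0 \<le> inner (A x) x" for x using A_inner[of x x] by simp
  show "inner (A x) x \<le> inner x x" for x
  proof -
    have "inner (A x) x \<le> norm (A x) * norm x" by (rule norm_cauchy_schwarz)
    also have "\<dots> \<le> norm x * norm x" by (intro mult_right_mono A_norm) simp
    finally show ?thesis by (simp add: power2_norm_eq_inner[symmetric] power2_eq_square)
  qed
  show "bounded_linear A" by (rule bounded_linear_resolvent)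
  show "inner (A x) y = inner x (A y)" for x y by (rule A_symmetric)
qed

lemma A_injective: "A h = 0 \<Longrightarrow> h = 0"
  using A_props(3)[of h] by (simp add: C_def T_zero)

lemma C_injective: "C h = 0 \<Longrightarrow> h = 0"
  using T_injective[OF A_props(1)[of h]] A_injective[of h] unfolding C_def by blast

lemma A_T: "x \<in> D \<Longrightarrow> A (T x) = C x"
proof (rule A_eqI)
  assume x: "x \<in> D"
  show "C x \<in> D" by (rule A_props)
  have TC: "T (C x) = x - A x" using A_props(3)[of x] by (simp add: algebra_simps)
  then show "T (C x) \<in> D" using x by (simp add: A_props subspace_diff[OF subspace_D])
  show "C x + T (T (C x)) = T x" unfolding TC using x by (simp add: T_diff A_props C_def)
qed

lemma A_C_commute: "A (C h) = C (A h)"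
  by (simp add: C_def[of h] A_T A_props)

text \<open>In terms of values, (a T)^2 = a - a^2 because a (1 + T^2) = 1. This is the radicand of
  \<open>absC\<close>, so \<open>Q\<close> squares to the square of \<open>C\<close>.\<close>

lemma C_C: "C (C h) = A h - A (A h)"
proof -
  have "C (C h) = T (C (A h))" by (simp add: C_def[of "C h"] A_C_commute)
  then show ?thesis using A_props(3)[of "A h"] by (simp add: algebra_simps)
qed

lemma C_symmetric: "inner (C h) k = inner h (C k)"
proof -
  have "inner (C h) k = inner (C h) (A k) + inner (C h) (T (C k))"
    by (metis A_props(3) inner_add_right)
  also have "inner (C h) (T (C k)) = inner (T (C h)) (C k)"
    by (simp add: T_symmetric A_props)
  also have "inner (C h) (A k) = inner (A h) (C k)"
    by (simp add: C_def T_symmetric A_props)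
  finally show ?thesis by (metis A_props(3) inner_add_left)
qed

text \<open>The hypothesis is T u = w multiplied by \<open>A\<close>, but it makes sense for every
  u. It yields u = A u + C w, so domain questions reduce to identities between bounded
  operators.\<close>

lemma in_domainI:
  assumes "C u = A w"
  shows "u \<in> D" and "T u = w"
proof -
  have u: "u = A u + C w"
    using A_props(3)[of u] by (simp add: assms C_def[of w])
  show "u \<in> D" by (subst u) (intro subspace_add[OF subspace_D] A_props)
  have "T u = C u + T (C w)" by (subst u) (simp add: T_add A_props C_def[of u] A_props(2)[unfolded C_def] C_def[of w])
  then show "T u = w" by (simp add: assms A_props)
qed

lemma A_dense: "closure (range A) = UNIV"
proof (rule dense_if_orthogonal_trivial)
  show "subspace (range A)"
    by (rule linear_subspace_image[OF bounded_linear.linear[OF bounded_linear_A] subspace_UNIV])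
  fix x assume "\<And>m. m \<in> range A \<Longrightarrow> inner x m = 0"
  then have "inner (A x) y = 0" for y by (simp add: A_symmetric)
  from A_injective this[of "A x"] show "x = 0" by simp
qed

section \<open>The modulus of \<open>C\<close> and the sign decomposition\<close>

abbreviation Q :: "'h \<Rightarrow> 'h" where "Q \<equiv> calc absC"

lemma bounded_linear_Q: "bounded_linear Q" by (rule bounded_linear_calc[OF continuous_absC])
lemma linear_Q: "linear Q" by (rule bounded_linear.linear[OF bounded_linear_Q])
lemma Q_symmetric: "inner (Q h) k = inner h (Q k)" by (rule calc_symmetric[OF continuous_absC])
lemma C_calc: "continuous_on {0..1} f \<Longrightarrow> C (calc f h) = calc f (C h)"
  by (rule calc_commute[OF _ bounded_linear_C]) (auto simp: A_C_commute)
lemma A_calc: "continuous_on {0..1} f \<Longrightarrow> A (calc f h) = calc f (A h)"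
  by (rule calc_commute[OF _ bounded_linear_A]) auto
lemma calc_calc_commute:
  assumes "continuous_on {0..1} f" "continuous_on {0..1} g"
  shows "calc f (calc g h) = calc g (calc f h)"
  using calc_mult[OF assms, of h] calc_mult[OF assms(2,1), of h] by (simp add: mult.commute)

lemma Q_Q: "Q (Q h) = C (C h)"
proof -
  have "Q (Q h) = calc (\<lambda>a. a - a * a) h"
    unfolding calc_mult[OF continuous_absC continuous_absC, symmetric]
  proof (rule calc_cong)
    fix a :: real assume "0 \<le> a" "a \<le> 1"
    then have "a * a \<le> a" using mult_right_mono[of a 1 a] by simp
    then show "absC a * absC a = a - a * a" by (simp add: absC_def)
  qed
  also have "\<dots> = A h - A (A h)"
    by (subst calc_diff) (auto intro!: continuous_intros simp: calc_mult calc_id)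
  finally show ?thesis by (simp add: C_C)
qed

lemma Q_injective: "Q h = 0 \<Longrightarrow> h = 0"
  using Q_Q[of h] C_injective linear_0[OF linear_Q] by metis

text \<open>Since \<open>Q\<close> is the modulus of C, the space \<open>half c\<close> is the spectral subspace
  on which c T is nonnegative, for c = 1 and c = - 1.\<close>

definition half :: "real \<Rightarrow> 'h set" where "half c = {h. Q h = c *\<^sub>R C h}"

lemma subspace_half: "subspace (half c)"
  unfolding half_def subspace_def
  using C_scale[of 0 0]
  by (simp add: linear_0[OF linear_Q] linear_add[OF linear_Q] linear_scale[OF linear_Q] C_add C_scale
      scaleR_add_right mult.commute)

lemma closed_half: "closed (half c)"
  unfolding half_def
  by (intro closed_Collect_eq continuous_intros linear_continuous_on bounded_linear_Q bounded_linear_C)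

lemma half_inter: "h \<in> half 1 \<Longrightarrow> h \<in> half (- 1) \<Longrightarrow> h = 0"
proof -
  assume "h \<in> half 1" "h \<in> half (- 1)"
  then have "C h = - C h" by (simp add: half_def)
  then have "C h = 0" by (metis add_eq_0_iff scaleR_2 scale_eq_0_iff zero_neq_numeral)
  then show "h = 0" by (rule C_injective)
qed

text \<open>Since \<open>Q\<close> and \<open>C\<close> commute and have equal squares, Q + C maps
  into \<open>half 1\<close>. The remainder of the projection is orthogonal to that range, hence
  annihilated by Q + C, which says that it lies in \<open>half (- 1)\<close>.\<close>

lemma half_decomposition:
  obtains y where "y \<in> half 1" "h - y \<in> half (- 1)" "norm y \<le> norm h"
proof -
  obtain y where y: "y \<in> half 1" "\<And>m. m \<in> half 1 \<Longrightarrow> inner (h - y) m = 0"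
    using orthogonal_projection_exists[OF subspace_half closed_half] by metis
  have "Q (h - y) + C (h - y) = 0"
  proof -
    have "inner (Q (h - y) + C (h - y)) z = 0" for z
    proof -
      have "Q z + C z \<in> half 1"
        by (simp add: half_def linear_add[OF linear_Q] C_add Q_Q C_calc continuous_absC)
      from y(2)[OF this] show ?thesis
        by (simp add: inner_add_left inner_add_right Q_symmetric C_symmetric)
    qed
    from this[of "Q (h - y) + C (h - y)"] show ?thesis by simp
  qed
  then have "h - y \<in> half (- 1)" by (simp add: half_def eq_neg_iff_add_eq_0)
  moreover have "norm y \<le> norm h"
  proof -
    have "inner h y = inner y y" using y(2)[OF y(1)] by (simp add: inner_diff_left)
    then have "norm y * norm y \<le> norm h * norm y"
      using norm_cauchy_schwarz[of h y] by (simp add: power2_norm_eq_inner[symmetric] power2_eq_square)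
    then show ?thesis by (cases "norm y = 0") auto
  qed
  ultimately show thesis using that y(1) by blast
qed

definition proj :: "'h \<Rightarrow> 'h" where
  "proj h = (SOME y. y \<in> half 1 \<and> h - y \<in> half (- 1) \<and> norm y \<le> norm h)"

lemma proj_props: "proj h \<in> half 1" "h - proj h \<in> half (- 1)" "norm (proj h) \<le> norm h"
proof -
  have "\<exists>y. y \<in> half 1 \<and> h - y \<in> half (- 1) \<and> norm y \<le> norm h" using half_decomposition by metis
  from someI_ex[OF this]
  show "proj h \<in> half 1" "h - proj h \<in> half (- 1)" "norm (proj h) \<le> norm h" by (auto simp: proj_def)
qed

lemma proj_eqI:
  assumes "y \<in> half 1" "h - y \<in> half (- 1)"
  shows "proj h = y"
proof -
  have "(h - y) - (h - proj h) \<in> half (- 1)" "proj h - y \<in> half 1"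
    by (intro subspace_diff[OF subspace_half] assms proj_props)+
  then show ?thesis using half_inter[of "proj h - y"] by simp
qed

lemma bounded_linear_proj: "bounded_linear proj"
proof (rule bounded_linear_intro[of _ 1])
  show "proj (x + y) = proj x + proj y" for x y
  proof (rule proj_eqI)
    have "(x - proj x) + (y - proj y) \<in> half (- 1)"
      by (intro subspace_add[OF subspace_half] proj_props)
    then show "x + y - (proj x + proj y) \<in> half (- 1)" by (simp add: algebra_simps)
  qed (intro subspace_add[OF subspace_half] proj_props)
  show "proj (r *\<^sub>R x) = r *\<^sub>R proj x" for r x
    by (rule proj_eqI) (simp_all add: subspace_scale[OF subspace_half] proj_props scaleR_diff_right[symmetric])
qed (simp add: proj_props)

lemma Q_dense: "closure (range Q) = UNIV"
proof (rule dense_if_orthogonal_trivial)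
  show "subspace (range Q)" by (rule linear_subspace_image[OF linear_Q subspace_UNIV])
  fix x assume "\<And>m. m \<in> range Q \<Longrightarrow> inner x m = 0"
  then have "inner (Q x) y = 0" for y by (simp add: Q_symmetric)
  from Q_injective this[of "Q x"] show "x = 0" by simp
qed

section \<open>The semigroup exp (- x |T|) and its orbits\<close>

lemma decay_norm: "x > 0 \<Longrightarrow> norm (calc (expo 0 x) h) \<le> norm h"
  using calc_norm[OF continuous_expo[of x 0], of 1] expo_0_bounds(1)[of x] by simp

lemma decay_diff: "x > 0 \<Longrightarrow> calc (expo j x) (h - k) = calc (expo j x) h - calc (expo j x) k"
  by (rule linear_diff[OF bounded_linear.linear[OF bounded_linear_calc[OF continuous_expo]]])

text \<open>On the range of \<open>Q\<close> the decay is at least like 1 / s, because |T| exp (- s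
  |T|) is at most 1 / s; density of that range, a consequence of injectivity of T, does the
  rest.\<close>

lemma decay_at_top: "((\<lambda>s. calc (expo 0 s) h) \<longlongrightarrow> 0) at_top"
proof (rule tendsto_zero_dense[OF _ Q_dense])
  show "\<forall>\<^sub>F s in at_top. \<forall>h k. norm (calc (expo 0 s) h - calc (expo 0 s) k) \<le> 1 * norm (h - k)"
    using eventually_gt_at_top[of 0] by eventually_elim (simp add: decay_diff[symmetric] decay_norm)
  fix h assume "h \<in> range Q"
  then obtain z where h: "h = Q z" by auto
  show "((\<lambda>s. calc (expo 0 s) h) \<longlongrightarrow> 0) at_top"
  proof (rule Lim_null_comparison)
    show "\<forall>\<^sub>F s in at_top. norm (calc (expo 0 s) h) \<le> norm z / s"
      using eventually_gt_at_top[of 0]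
    proof eventually_elim
      case (elim s)
      have "norm (calc (\<lambda>a. expo 0 s a * absC a) z) \<le> 1 / s * norm z"
        using elim expo_0_bounds(3)[of s]
        by (intro calc_norm continuous_on_mult continuous_expo continuous_absC) auto
      then show ?case by (simp add: h calc_mult[OF continuous_expo[OF elim] continuous_absC])
    qed
    show "((\<lambda>s. norm z / s) \<longlongrightarrow> 0) at_top"
      by (rule tendsto_divide_0[OF tendsto_const]) (simp add: filterlim_at_top_imp_at_infinity filterlim_ident)
  qed
qed

lemma decay_at_0: "((\<lambda>x. calc (expo 0 x) h) \<longlongrightarrow> h) (at_right 0)"
proof -
  have pos: "\<forall>\<^sub>F x in at_right 0. x > (0::real)" by (rule eventually_at_right_less)
  have "((\<lambda>x. calc (expo 0 x) h - h) \<longlongrightarrow> 0) (at_right 0)"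
  proof (rule tendsto_zero_dense[OF _ A_dense])
    show "\<forall>\<^sub>F x in at_right 0. \<forall>h k. norm (calc (expo 0 x) h - h - (calc (expo 0 x) k - k)) \<le> 2 * norm (h - k)"
      using pos
    proof eventually_elim
      case (elim x)
      have "norm (calc (expo 0 x) (h - k) - (h - k)) \<le> 2 * norm (h - k)" for h k
        using norm_triangle_ineq4[of "calc (expo 0 x) (h - k)" "h - k"] decay_norm[OF elim, of "h - k"]
        by linarith
      then show ?case by (simp add: decay_diff[OF elim] algebra_simps)
    qed
    fix h assume "h \<in> range A"
    then obtain z where h: "h = A z" by auto
    show "((\<lambda>x. calc (expo 0 x) h - h) \<longlongrightarrow> 0) (at_right 0)"
    proof (rule Lim_null_comparison)
      show "\<forall>\<^sub>F x in at_right 0. norm (calc (expo 0 x) h - h) \<le> x * norm z"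
        using pos
      proof eventually_elim
        case (elim x)
        note cont = continuous_expo[OF elim, of 0]
        have "norm (calc (\<lambda>a. expo 0 x a * a - a) z) \<le> x * norm z"
          using elim expo_0_bounds(2)[of x]
          by (intro calc_norm continuous_intros cont) auto
        then show ?case
          by (simp add: h calc_diff[OF continuous_on_mult[OF cont continuous_on_id] continuous_on_id]
              calc_mult[OF cont continuous_on_id] calc_id)
      qed
      show "((\<lambda>x. x * norm z) \<longlongrightarrow> 0) (at_right 0)"
        by (rule tendsto_mult_left_zero[OF tendsto_ident_at])
    qed
  qed
  then show ?thesis by (rule LIM_zero_cancel)
qed

lemma decay_derivative:
  assumes x: "x > 0"
  shows "((\<lambda>x. calc (expo 0 x) h) has_vector_derivative - calc (expo 1 x) h) (at x)"
proof (rule has_vector_derivativeI_quadratic)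
  have "\<forall>\<^sub>F y in at x. y > x / 2" by (rule order_tendstoD(1)[OF tendsto_ident_at]) (use x in simp)
  then show "\<forall>\<^sub>F y in at x. norm (calc (expo 0 y) h - calc (expo 0 x) h - (y - x) *\<^sub>R - calc (expo 1 x) h)
      \<le> 16 / x\<^sup>2 * norm h * (y - x)\<^sup>2"
  proof eventually_elim
    case (elim y)
    then have y: "y > 0" using x by simp
    note cont = continuous_expo[OF x] continuous_expo[OF y]
    have "norm (calc (\<lambda>a. expo 0 y a - expo 0 x a + (y - x) * expo 1 x a) h) \<le> 16 / x\<^sup>2 * (y - x)\<^sup>2 * norm h"
      using expo_taylor[OF x, of y] elim by (intro calc_norm continuous_intros cont) auto
    also have "calc (\<lambda>a. expo 0 y a - expo 0 x a + (y - x) * expo 1 x a) h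
        = calc (expo 0 y) h - calc (expo 0 x) h + (y - x) *\<^sub>R calc (expo 1 x) h"
      by (subst calc_add; (intro continuous_intros cont)?) (simp add: calc_diff calc_scale cont)
    finally show ?case by (simp add: mult_ac)
  qed
qed

lemma continuous_decay_rate: "continuous_on {0<..} (\<lambda>x. calc (expo 1 x) h)"
  unfolding continuous_on_def
proof
  fix x :: real assume "x \<in> {0<..}"
  then have x: "x > 0" by simp
  have "\<forall>\<^sub>F y in at x within {0<..}. y > x / 2"
    by (rule order_tendstoD(1)[OF tendsto_ident_at]) (use x in simp)
  then have "\<forall>\<^sub>F y in at x within {0<..}. norm (calc (expo 1 y) h - calc (expo 1 x) h) \<le> 16 / x\<^sup>2 * norm h * \<bar>y - x\<bar>"
  proof eventually_elim
    case (elim y)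
    then have y: "y > 0" using x by simp
    note cont = continuous_expo[OF x] continuous_expo[OF y]
    have "norm (calc (\<lambda>a. expo 1 y a - expo 1 x a) h) \<le> 16 / x\<^sup>2 * \<bar>y - x\<bar> * norm h"
      using expo_1_lipschitz[OF x, of y] elim by (intro calc_norm continuous_intros cont) auto
    then show ?case by (simp add: calc_diff cont mult_ac)
  qed
  moreover have "((\<lambda>y. 16 / x\<^sup>2 * norm h * \<bar>y - x\<bar>) \<longlongrightarrow> 0) (at x within {0<..})"
    by (intro tendsto_mult_right_zero tendsto_rabs_zero) (simp add: LIM_zero tendsto_ident_at)
  ultimately have "((\<lambda>y. calc (expo 1 y) h - calc (expo 1 x) h) \<longlongrightarrow> 0) (at x within {0<..})"
    by (rule Lim_null_comparison)
  then show "((\<lambda>x. calc (expo 1 x) h) \<longlongrightarrow> calc (expo 1 x) h) (at x within {0<..})"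
    by (rule LIM_zero_cancel)
qed

lemma decay_absC: "x > 0 \<Longrightarrow> calc (expo 0 x) (Q h) = calc (expo 1 x) (A h)"
proof -
  assume x: "x > 0"
  have "calc (expo 0 x) (Q h) = calc (\<lambda>a. expo 0 x a * absC a) h"
    by (rule calc_mult[symmetric, OF continuous_expo[OF x] continuous_absC])
  also have "\<dots> = calc (\<lambda>a. expo 1 x a * a) h"
    by (rule calc_cong) (rule expo_0_bounds(4)[OF x])
  also have "\<dots> = calc (expo 1 x) (A h)"
    by (simp add: calc_mult[OF continuous_expo[OF x] continuous_on_id] calc_id)
  finally show ?thesis .
qed

text \<open>On \<open>half c\<close> the modulus |T| equals c T, so T acts on the semigroup as c
  times its rate function.\<close>

lemma decay_domain:
  assumes c: "c * c = 1" and h: "h \<in> half c" and x: "x > 0"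
  shows "calc (expo 0 x) h \<in> D" and "T (calc (expo 0 x) h) = c *\<^sub>R calc (expo 1 x) h"
proof -
  note cont = continuous_expo[OF x]
  have "A (c *\<^sub>R calc (expo 1 x) h) = c *\<^sub>R calc (expo 0 x) (Q h)"
    by (simp only: A_scale A_calc[OF cont] decay_absC[OF x])
  also have "Q h = c *\<^sub>R C h" using h by (simp add: half_def)
  also have "c *\<^sub>R calc (expo 0 x) (c *\<^sub>R C h) = C (calc (expo 0 x) h)"
    by (simp add: linear_scale[OF bounded_linear.linear[OF bounded_linear_calc[OF cont]]] c C_calc[OF cont])
  finally show "calc (expo 0 x) h \<in> D" "T (calc (expo 0 x) h) = c *\<^sub>R calc (expo 1 x) h"
    using in_domainI by metis+
qed

text \<open>The value at 0 is prescribed because \<open>expo 0 0\<close> is discontinuous and lies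
  outside the calculus; \<open>decay_at_0\<close> shows that the choice is continuous.\<close>

definition orbit :: "'h \<Rightarrow> real \<Rightarrow> 'h" where
  "orbit h x = (if x = 0 then h else calc (expo 0 x) h)"

lemma orbit_domain: "c * c = 1 \<Longrightarrow> h \<in> half c \<Longrightarrow> x > 0 \<Longrightarrow> orbit h x \<in> D"
  by (simp add: orbit_def decay_domain)

lemma orbit_derivative:
  assumes c: "c * c = 1" and h: "h \<in> half c" and x: "x > 0"
  shows "(orbit h has_vector_derivative - (c *\<^sub>R T (orbit h x))) (at x)"
proof -
  have "((\<lambda>x. calc (expo 0 x) h) has_vector_derivative - (c *\<^sub>R T (orbit h x))) (at x)"
    using decay_derivative[OF x] x c by (simp add: orbit_def decay_domain(2)[OF c h])
  then show ?thesis
    by (rule has_vector_derivative_transform_within_open[of _ _ _ "{0<..}"])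
      (use x in \<open>auto simp: orbit_def\<close>)
qed

lemma continuous_orbit_derivative:
  assumes c: "c * c = 1" and h: "h \<in> half c"
  shows "continuous_on {0<..} (\<lambda>x. T (orbit h x))"
proof -
  have "continuous_on {0<..} (\<lambda>x. c *\<^sub>R calc (expo 1 x) h)"
    by (intro continuous_intros continuous_decay_rate)
  then show ?thesis
    by (rule continuous_on_eq) (simp add: orbit_def decay_domain(2)[OF c h])
qed

lemma continuous_orbit: "continuous_on {0..} (orbit h)"
  unfolding continuous_on_def
proof
  fix x :: real assume "x \<in> {0..}"
  then consider "x = 0" | "x > 0" by fastforce
  then show "(orbit h \<longlongrightarrow> orbit h x) (at x within {0..})"
  proof cases
    case 1
    have "\<forall>\<^sub>F x in at_right 0. calc (expo 0 x) h = orbit h x"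
      using eventually_at_right_less[of "0::real"] by eventually_elim (simp add: orbit_def)
    then have "(orbit h \<longlongrightarrow> h) (at_right 0)"
      using Lim_transform_eventually[OF decay_at_0] by blast
    then show ?thesis using 1 by (simp add: orbit_def at_within_Ici_at_right)
  next
    case 2
    have "isCont (\<lambda>x. calc (expo 0 x) h) x"
      using decay_derivative[OF 2] by (rule has_vector_derivative_continuous)
    then have "((\<lambda>x. calc (expo 0 x) h) \<longlongrightarrow> orbit h x) (at x)"
      using 2 by (simp add: orbit_def isCont_def)
    moreover have "\<forall>\<^sub>F y in at x. y > 0" by (rule order_tendstoD(1)[OF tendsto_ident_at 2])
    then have "\<forall>\<^sub>F y in at x. calc (expo 0 y) h = orbit h y"
      by eventually_elim (simp add: orbit_def)
    ultimately have "(orbit h \<longlongrightarrow> orbit h x) (at x)" by (rule Lim_transform_eventually)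
    then show ?thesis by (rule tendsto_within_subset) simp
  qed
qed

lemma orbit_norm: "x \<ge> 0 \<Longrightarrow> norm (orbit h x) \<le> norm h"
  by (simp add: orbit_def decay_norm)

lemma orbit_at_top: "(orbit h \<longlongrightarrow> 0) at_top"
proof (rule Lim_transform_eventually[OF decay_at_top])
  show "\<forall>\<^sub>F x in at_top. calc (expo 0 x) h = orbit h x"
    using eventually_gt_at_top[of 0] by eventually_elim (simp add: orbit_def)
qed

text \<open>On the complement of \<open>half c\<close> solutions of u' = - c T u grow exponentially; pairing with a decaying
  solution of the adjoint equation gives a constant that a bounded solution forces to vanish.\<close>

lemma bounded_solution_in_half:
  assumes c: "c * c = 1"
    and der: "\<And>x. x > 0 \<Longrightarrow> (u has_vector_derivative - (c *\<^sub>R T (u x))) (at x)"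
    and dom: "\<And>x. x > 0 \<Longrightarrow> u x \<in> D"
    and bound: "\<forall>\<^sub>F x in at_top. norm (u x) \<le> M"
    and x: "x > 0"
  shows "u x \<in> half c"
proof -
  \<comment> \<open>The kernel of \<open>N\<close> is \<open>half c\<close>, so the claim becomes N
    (u x) = 0.\<close>
  define N where "N y = Q y - c *\<^sub>R C y" for y
  have N: "bounded_linear N"
    unfolding N_def
    by (intro bounded_linear_sub bounded_linear_Q bounded_linear_const_scaleR bounded_linear_C)
  note N_lin = bounded_linear.linear[OF N]
  have N_sym: "inner (N y) z = inner y (N z)" for y z
    by (simp add: N_def inner_diff_left inner_diff_right Q_symmetric C_symmetric)
  have N_A: "N (A y) = A (N y)" for y
    by (simp add: N_def A_calc[OF continuous_absC] A_C_commute linear_diff[OF linear_A] A_scale)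
  \<comment> \<open>On the range of \<open>N\<close> the operator \<open>C\<close> is - c
    \<open>Q\<close>: \<open>N\<close> maps into the opposite half-space.\<close>
  have N_C: "N (C y) = - (c *\<^sub>R Q (N y))" for y
    by (simp add: N_def C_calc[OF continuous_absC] linear_diff[OF linear_Q] linear_scale[OF linear_Q]
        Q_Q scaleR_diff_right c)
  have C_N: "C (N y) = N (C y)" for y
  proof -
    have "C (N y) = C (Q y + (- c) *\<^sub>R C y)" by (simp add: N_def)
    then show ?thesis by (simp only: C_add C_scale C_calc[OF continuous_absC]) (simp add: N_def)
  qed
  have zero: "inner (N (u x)) (A z) = 0" for z
  proof -
    \<comment> \<open>On the range of \<open>N\<close> the operator c T acts as - |T|, so the first
      factor evolves by exp (s |T|) and the second by its inverse, which makes \<open>F\<close>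
      constant. The extra \<open>A\<close> replaces the unbounded T by \<open>C\<close>.\<close>
    define F where "F s = inner (N (u (x + s))) (calc (expo 0 s) (A z))" for s
    have F': "(F has_vector_derivative 0) (at s)" if s: "s > 0" for s
    proof -
      have xs: "x + s > 0" using x s by simp
      define y where "y = calc (expo 0 s) z"
      have Ay: "calc (expo 0 s) (A z) = A y"
        by (simp add: y_def A_calc[OF continuous_expo[OF s]])
      have Qy: "Q y = calc (expo 1 s) (A z)"
        unfolding y_def decay_absC[OF s, symmetric]
        by (rule calc_calc_commute[OF continuous_absC continuous_expo[OF s]])
      have "((\<lambda>s. u (x + s)) has_vector_derivative 1 *\<^sub>R (- (c *\<^sub>R T (u (x + s))))) (at s)"
      proof -
        have "((\<lambda>s. x + s) has_vector_derivative 1) (at s)"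
          by (auto intro!: derivative_eq_intros)
        from vector_diff_chain_at[OF this, of u, OF der[OF xs]] show ?thesis by (simp only: o_def)
      qed
      from bounded_linear.has_vector_derivative[OF N this]
      have "((\<lambda>s. N (u (x + s))) has_vector_derivative N (- (c *\<^sub>R T (u (x + s))))) (at s)" by simp
      from bounded_bilinear.has_vector_derivative[OF bounded_bilinear_inner this decay_derivative[OF s]]
      have "(F has_vector_derivative inner (N (u (x + s))) (- calc (expo 1 s) (A z))
          + inner (N (- (c *\<^sub>R T (u (x + s))))) (calc (expo 0 s) (A z))) (at s)"
        by (simp add: F_def[abs_def])
      moreover have "inner (N (- (c *\<^sub>R T (u (x + s))))) (calc (expo 0 s) (A z))
          = inner (N (u (x + s))) (calc (expo 1 s) (A z))"
      proof -
        have "inner (N (T (u (x + s)))) (A y) = inner (N (C (u (x + s)))) y"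
          by (simp add: symmetric_A[symmetric] N_A[symmetric] A_T dom xs)
        also have "\<dots> = - c * inner (N (u (x + s))) (Q y)"
          by (simp add: N_C Q_symmetric)
        finally show ?thesis
          by (simp add: Ay Qy linear_neg[OF N_lin] linear_scale[OF N_lin] c mult.assoc[symmetric])
      qed
      ultimately show ?thesis by simp
    qed
    have "\<exists>k. \<forall>s\<in>{0<..}. F s = k"
    proof (rule has_vector_derivative_zero_constant[of "{0<..}" F])
      show "(F has_vector_derivative 0) (at s within {0<..})" if "s \<in> {0<..}" for s
        using F'[of s] that by (auto intro: has_vector_derivative_at_within)
    qed auto
    then obtain k where k: "\<And>s. s > 0 \<Longrightarrow> F s = k" by auto
    obtain K where K: "\<And>y. norm (N y) \<le> norm y * K" "K \<ge> 0"
      using bounded_linear.nonneg_bounded[OF N] by blast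
    have "(F \<longlongrightarrow> 0) at_top"
    proof (rule Lim_null_comparison)
      have "filterlim (\<lambda>s. x + s) at_top at_top"
        by (rule filterlim_tendsto_add_at_top[OF tendsto_const filterlim_ident])
      then have "\<forall>\<^sub>F s in at_top. norm (u (x + s)) \<le> M"
        using bound by (auto simp: filterlim_iff)
      then show "\<forall>\<^sub>F s in at_top. norm (F s) \<le> M * K * norm (calc (expo 0 s) (A z))"
      proof eventually_elim
        case (elim s)
        have "norm (F s) \<le> norm (N (u (x + s))) * norm (calc (expo 0 s) (A z))"
          unfolding F_def real_norm_def by (rule Cauchy_Schwarz_ineq2)
        also have "\<dots> \<le> (norm (u (x + s)) * K) * norm (calc (expo 0 s) (A z))"
          by (intro mult_right_mono K) simp
        also have "\<dots> \<le> (M * K) * norm (calc (expo 0 s) (A z))"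
          by (intro mult_right_mono elim K) simp
        finally show ?case .
      qed
      show "((\<lambda>s. M * K * norm (calc (expo 0 s) (A z))) \<longlongrightarrow> 0) at_top"
        using tendsto_mult_left[OF tendsto_norm_zero[OF decay_at_top], of "M * K" "A z"] by simp
    qed
    moreover have "(F \<longlongrightarrow> k) at_top"
      by (rule tendsto_eventually[OF eventually_mono[OF eventually_gt_at_top[of 0] k]])
    ultimately have "k = 0" by (metis tendsto_unique trivial_limit_at_top_linorder)
    have "isCont u x" using der[OF x] by (rule has_vector_derivative_continuous)
    then have "isCont (\<lambda>s. u (x + s)) 0"
      using isCont_o2[where f = "\<lambda>s. x + s" and a = 0 and g = u] by simp
    then have "((\<lambda>s. u (x + s)) \<longlongrightarrow> u x) (at_right 0)"
      unfolding isCont_def by (auto intro: tendsto_within_subset)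
    then have "(F \<longlongrightarrow> inner (N (u x)) (A z)) (at_right 0)"
      unfolding F_def[abs_def]
      by (intro tendsto_inner bounded_linear.tendsto[OF N] decay_at_0)
    moreover have "(F \<longlongrightarrow> k) (at_right 0)"
      by (rule tendsto_eventually[OF eventually_mono[OF eventually_at_right_less[of "0::real"] k]])
    ultimately show ?thesis using \<open>k = 0\<close> by (metis tendsto_unique trivial_limit_at_right_real)
  qed
  \<comment> \<open>Here z is A (N (u x)), with one \<open>A\<close> moved across.\<close>
  have "inner (A (N (u x))) (A (N (u x))) = 0" by (subst symmetric_A) (rule zero)
  then have "A (N (u x)) = 0" by simp
  then have "N (u x) = 0" by (rule A_injective)
  then show ?thesis by (simp add: half_def N_def)
qed

end

section \<open>Forward and backward evolution of J L\<close>

locale similar_pencil = injective_selfadjoint D T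
  for D :: "'h::{real_inner,complete_space} set" and T +
  fixes J L S Si :: "'h \<Rightarrow> 'h" and DL :: "'h set"
  assumes bounded_linear_J: "bounded_linear J"
    and J_symmetric: "inner (J x) y = inner x (J y)"
    and J_J: "J (J x) = x"
    and L_positive: "h \<in> DL \<Longrightarrow> h \<noteq> 0 \<Longrightarrow> 0 < inner (L h) h"
    and bounded_linear_S: "bounded_linear S" and bounded_linear_Si: "bounded_linear Si"
    and S_Si: "S (Si x) = x" and Si_S: "Si (S x) = x"
    and S_domain: "S ` DL = D"
    and T_eq: "x \<in> D \<Longrightarrow> T x = S (J (L (Si x)))"
begin

lemma linear_J: "linear J" by (rule bounded_linear.linear[OF bounded_linear_J])
lemma linear_S: "linear S" by (rule bounded_linear.linear[OF bounded_linear_S])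
lemma linear_Si: "linear Si" by (rule bounded_linear.linear[OF bounded_linear_Si])

text \<open>The value c = - 1 stands for the equation with reversed time.\<close>

definition evolution :: "real \<Rightarrow> (real \<Rightarrow> 'h) \<Rightarrow> bool" where
  "evolution c \<psi> \<longleftrightarrow> continuous_on {0..} \<psi>
      \<and> (\<forall>x>0. (\<psi> has_vector_derivative - (c *\<^sub>R J (L (\<psi> x)))) (at x) \<and> \<psi> x \<in> DL)"

lemma evolution_similar:
  assumes "evolution c \<psi>" "x > 0"
  shows "((\<lambda>x. S (\<psi> x)) has_vector_derivative - (c *\<^sub>R T (S (\<psi> x)))) (at x)" and "S (\<psi> x) \<in> D"
proof -
  have \<psi>: "\<psi> x \<in> DL" "(\<psi> has_vector_derivative - (c *\<^sub>R J (L (\<psi> x)))) (at x)"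
    using assms by (auto simp: evolution_def)
  show D: "S (\<psi> x) \<in> D" using \<psi>(1) S_domain by blast
  show "((\<lambda>x. S (\<psi> x)) has_vector_derivative - (c *\<^sub>R T (S (\<psi> x)))) (at x)"
    using bounded_linear.has_vector_derivative[OF bounded_linear_S \<psi>(2)]
    by (simp add: T_eq[OF D] Si_S linear_neg[OF linear_S] linear_scale[OF linear_S])
qed

lemma evolution_orbit:
  assumes c: "c * c = 1" and f: "S f \<in> half c"
  shows "evolution c (\<lambda>x. Si (orbit (S f) x))"
  unfolding evolution_def
proof (intro conjI allI impI)
  show "continuous_on {0..} (\<lambda>x. Si (orbit (S f) x))"
    by (rule bounded_linear.continuous_on[OF bounded_linear_Si continuous_orbit])
  fix x :: real assume x: "x > 0"
  have D: "orbit (S f) x \<in> D" by (rule orbit_domain[OF c f x])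
  then obtain y where y: "y \<in> DL" "orbit (S f) x = S y" using S_domain by blast
  show "Si (orbit (S f) x) \<in> DL" using y by (simp add: Si_S)
  show "((\<lambda>x. Si (orbit (S f) x)) has_vector_derivative - (c *\<^sub>R J (L (Si (orbit (S f) x))))) (at x)"
    using bounded_linear.has_vector_derivative[OF bounded_linear_Si orbit_derivative[OF c f x]]
    by (simp add: T_eq[OF D] Si_S linear_neg[OF linear_Si] linear_scale[OF linear_Si])
qed

definition form :: "'h \<Rightarrow> real" where "form f = inner (J f) f"

lemma form_continuous_on: "continuous_on X \<psi> \<Longrightarrow> continuous_on X (\<lambda>x. form (\<psi> x))"
  unfolding form_def
  by (intro continuous_intros bounded_linear.continuous_on[OF bounded_linear_J])

lemma form_derivative:
  assumes "evolution c \<psi>" "x > 0"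
  shows "((\<lambda>x. form (\<psi> x)) has_real_derivative - (2 * c * inner (L (\<psi> x)) (\<psi> x))) (at x)"
proof -
  have \<psi>: "(\<psi> has_vector_derivative - (c *\<^sub>R J (L (\<psi> x)))) (at x)"
    using assms by (auto simp: evolution_def)
  have "((\<lambda>x. form (\<psi> x)) has_vector_derivative
      inner (J (\<psi> x)) (- (c *\<^sub>R J (L (\<psi> x)))) + inner (J (- (c *\<^sub>R J (L (\<psi> x))))) (\<psi> x)) (at x)"
    unfolding form_def
    by (rule bounded_bilinear.has_vector_derivative[OF bounded_bilinear_inner
          bounded_linear.has_vector_derivative[OF bounded_linear_J \<psi>] \<psi>])
  moreover have "inner (J (\<psi> x)) (- (c *\<^sub>R J (L (\<psi> x)))) + inner (J (- (c *\<^sub>R J (L (\<psi> x))))) (\<psi> x)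
      = - (2 * c * inner (L (\<psi> x)) (\<psi> x))"
    by (simp add: linear_neg[OF linear_J] linear_scale[OF linear_J] J_symmetric J_J inner_commute)
  ultimately show ?thesis by (simp add: has_real_derivative_iff_has_vector_derivative)
qed

lemma L_nonneg: "h \<in> DL \<Longrightarrow> 0 \<le> inner (L h) h"
  using L_positive[of h] by (cases "h = 0") auto

lemma form_antimono:
  assumes ev: "evolution c \<psi>" and x: "0 \<le> x"
  shows "c > 0 \<Longrightarrow> form (\<psi> x) \<le> form (\<psi> 0)"
    and "c < 0 \<Longrightarrow> form (\<psi> 0) \<le> form (\<psi> x)"
proof -
  have cont: "continuous_on {0..x} (\<lambda>x. form (\<psi> x))"
    using ev by (intro form_continuous_on) (auto simp: evolution_def intro: continuous_on_subset)
  have dom: "\<psi> y \<in> DL" if "y > 0" for y using ev that by (auto simp: evolution_def)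
  show "form (\<psi> x) \<le> form (\<psi> 0)" if "c > 0"
    by (rule DERIV_nonpos_imp_decreasing_open[OF x _ cont])
      (use form_derivative[OF ev] L_nonneg[OF dom] that in \<open>force intro: mult_nonneg_nonneg\<close>)
  show "form (\<psi> 0) \<le> form (\<psi> x)" if "c < 0"
    by (rule DERIV_nonneg_imp_increasing_open[OF x _ cont])
      (use form_derivative[OF ev] L_nonneg[OF dom] that in \<open>force intro: mult_nonpos_nonneg\<close>)
qed

text \<open>The form decreases along the orbit of f, which tends to 0.\<close>

lemma form_half:
  assumes f: "S f \<in> half c" and c: "c = 1 \<or> c = - 1"
  shows "0 \<le> c * form f"
proof -
  define \<psi> where "\<psi> x = Si (orbit (S f) x)" for x
  have ev: "evolution c \<psi>" unfolding \<psi>_def using c f by (intro evolution_orbit) auto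
  have \<psi>0: "\<psi> 0 = f" by (simp add: \<psi>_def orbit_def Si_S)
  have "(\<psi> \<longlongrightarrow> Si 0) at_top"
    unfolding \<psi>_def by (rule bounded_linear.tendsto[OF bounded_linear_Si orbit_at_top])
  then have "((\<lambda>x. c * form (\<psi> x)) \<longlongrightarrow> c * form 0) at_top"
    unfolding form_def linear_0[OF linear_Si]
    by (intro tendsto_intros bounded_linear.tendsto[OF bounded_linear_J])
  then have "((\<lambda>x. c * form (\<psi> x)) \<longlongrightarrow> 0) at_top" by (simp add: form_def)
  moreover have "\<forall>\<^sub>F x in at_top. c * form (\<psi> x) \<le> c * form f"
  proof (rule eventually_mono[OF eventually_ge_at_top[of 0]])
    show "c * form (\<psi> x) \<le> c * form f" if "0 \<le> x" for x
      using c form_antimono[OF ev that] by (auto simp: \<psi>0)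
  qed
  ultimately show ?thesis
    by (intro tendsto_upperbound[of "\<lambda>x. c * form (\<psi> x)" 0 at_top]) auto
qed

lemma evolution_in_half:
  assumes ev: "evolution c \<psi>" and c: "c * c = 1" and bound: "\<forall>\<^sub>F x in at_top. norm (\<psi> x) \<le> M" and x: "x > 0"
  shows "S (\<psi> x) \<in> half c"
proof -
  obtain K where K: "\<And>y. norm (S y) \<le> norm y * K" "K \<ge> 0"
    using bounded_linear.nonneg_bounded[OF bounded_linear_S] by blast
  have "\<forall>\<^sub>F x in at_top. norm (S (\<psi> x)) \<le> M * K"
    using bound by eventually_elim (use K in \<open>meson mult_right_mono order_trans\<close>)
  then show ?thesis
    using bounded_solution_in_half[OF c, of "\<lambda>x. S (\<psi> x)"] evolution_similar[OF ev] x by blast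
qed

lemma evolution_initial_in_half:
  assumes ev: "evolution c \<psi>" and c: "c * c = 1" and bound: "\<forall>\<^sub>F x in at_top. norm (\<psi> x) \<le> M"
  shows "S (\<psi> 0) \<in> half c"
proof (rule Lim_in_closed_set[OF closed_half])
  show "\<forall>\<^sub>F x in at_right 0. S (\<psi> x) \<in> half c"
    by (rule eventually_mono[OF eventually_at_right_less[of 0] evolution_in_half[OF ev c bound]])
  have "(\<psi> \<longlongrightarrow> \<psi> 0) (at 0 within {0..})" using ev by (simp add: evolution_def continuous_on_def)
  then show "((\<lambda>x. S (\<psi> x)) \<longlongrightarrow> S (\<psi> 0)) (at_right 0)"
    by (intro bounded_linear.tendsto[OF bounded_linear_S]) (simp add: at_within_Ici_at_right)
qed simp

text \<open>Injectivity of P_+ on H^B_+: on the kernel of P_+ the form is minus the squared norm, on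
  H^B_+ it is nonnegative.\<close>

lemma kernel_half:
  assumes "S d \<in> half 1" "J d = - d"
  shows "d = 0"
proof -
  have "0 \<le> - inner d d" using form_half[OF assms(1)] by (simp add: form_def assms(2))
  then show ?thesis by (metis inner_eq_zero_iff inner_ge_zero neg_0_le_iff_le order_antisym)
qed

text \<open>For x > 0 the form is nonnegative by boundedness and at most minus the squared norm of
  the initial value by monotonicity. So it is identically 0 there, its derivative - 2 (L f, f)
  vanishes, and strict positivity of L gives f = 0.\<close>

lemma evolution_unique:
  assumes ev: "evolution 1 \<psi>" and bound: "\<forall>\<^sub>F x in at_top. norm (\<psi> x) \<le> M" and J0: "J (\<psi> 0) = - \<psi> 0"
    and x: "x \<ge> 0"
  shows "\<psi> x = 0"
proof -
  have ge: "form (\<psi> x) \<ge> 0" if "x > 0" for x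
    using form_half[of "\<psi> x" 1] evolution_in_half[OF ev _ bound that] by simp
  have form0: "form (\<psi> 0) = - (norm (\<psi> 0))\<^sup>2" by (simp add: form_def J0 power2_norm_eq_inner)
  have le: "form (\<psi> x) \<le> - (norm (\<psi> 0))\<^sup>2" if "x > 0" for x
    using form_antimono(1)[OF ev, of x] that form0 by simp
  have zero: "form (\<psi> x) = 0" if "x > 0" for x
    using ge[OF that] le[OF that] by (smt (verit) zero_le_power2)
  show ?thesis
  proof (cases "x = 0")
    case True
    have "(norm (\<psi> 0))\<^sup>2 \<le> 0" using le[of 1] zero[of 1] by simp
    then show ?thesis using True by simp
  next
    case False
    then have x: "x > 0" using x by simp
    have "((\<lambda>x. form (\<psi> x)) has_real_derivative 0) (at x)"
      by (rule has_field_derivative_transform_within_open[of "\<lambda>_. 0" 0 x "{0<..}"])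
        (use x zero in auto)
    then have "- (2 * 1 * inner (L (\<psi> x)) (\<psi> x)) = 0"
      using form_derivative[OF ev x] DERIV_unique by blast
    moreover have "\<psi> x \<in> DL" using ev x by (auto simp: evolution_def)
    ultimately show ?thesis using L_positive[of "\<psi> x"] by auto
  qed
qed

lemma initial_value_exists:
  assumes \<phi>: "J \<phi> = \<phi>"
  obtains f where "S f \<in> half 1" "(1/2) *\<^sub>R (f + J f) = \<phi>"
proof -
  define P where "P f = Si (proj (S f))" for f
  have P: "bounded_linear P"
    unfolding P_def
    by (intro bounded_linear_compose[OF bounded_linear_Si] bounded_linear_compose[OF bounded_linear_proj]
        bounded_linear_S)
  \<comment> \<open>2 P - 1 is the difference of the spectral projections; the coercivity constant
    1/2 comes from the identity part alone.\<close>
  define M where "M f = (1/2) *\<^sub>R (f + J (2 *\<^sub>R P f - f))" for f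
  have "bounded_linear M"
    unfolding M_def
    by (intro bounded_linear_const_scaleR bounded_linear_add bounded_linear_ident
        bounded_linear_compose[OF bounded_linear_J] bounded_linear_sub P)
  moreover have "(1/2) * (norm f)\<^sup>2 \<le> inner (M f) f" for f
  proof -
    define a b where "a = P f" and "b = f - P f"
    have "S a \<in> half 1" "S b \<in> half (- 1)"
      using proj_props[of "S f"] by (auto simp: a_def b_def P_def S_Si linear_diff[OF linear_S])
    \<comment> \<open>The form has opposite signs on the two half-spaces, and the cross terms of (J
      (a - b), a + b) cancel by symmetry of J.\<close>
    then have "0 \<le> form a - form b" using form_half[of a 1] form_half[of b "- 1"] by simp
    also have "form a - form b = inner (J (2 *\<^sub>R P f - f)) f"
    proof -
      have "2 *\<^sub>R P f - f = a - b" "f = a + b" by (auto simp: a_def b_def scaleR_2)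
      then have "inner (J (2 *\<^sub>R P f - f)) f = inner (J (a - b)) (a + b)"
        by (rule arg_cong2[where f = "\<lambda>u v. inner (J u) v"])
      moreover have "inner (J (a - b)) (a + b) = form a - form b"
        using J_symmetric[of a b]
        by (simp add: form_def linear_diff[OF linear_J] inner_diff_left inner_diff_right inner_add_left inner_add_right
            inner_commute)
      ultimately show ?thesis by simp
    qed
    finally show ?thesis by (simp add: M_def inner_add_left power2_norm_eq_inner)
  qed
  ultimately have "surj M" by (intro coercive_surj[of M "1/2"]) auto
  then obtain f where f: "M f = \<phi>" by (metis surjD)
  have quarters: "(1/4) *\<^sub>R y + ((1/4) *\<^sub>R y + z) = (1/2) *\<^sub>R y + z"
    "(1/4) *\<^sub>R y + (1/4) *\<^sub>R y = (1/2) *\<^sub>R y" for y z :: 'h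
    by (simp_all add: scaleR_add_left[symmetric] add.assoc[symmetric])
  \<comment> \<open>With P_+ = (1 + J) / 2 and P_+ J = P_+ this is P_+ P = P_+ M. Since P_+ fixes
    \<phi>, the vector \<open>P f\<close> is the required initial value.\<close>
  have "(1/2) *\<^sub>R (P f + J (P f)) = (1/2) *\<^sub>R (M f + J (M f))"
    by (simp add: M_def linear_add[OF linear_J] linear_diff[OF linear_J] linear_scale[OF linear_J] J_J
        scaleR_2 algebra_simps quarters)
  also have "\<dots> = \<phi>" using f \<phi> by (simp add: scaleR_2[symmetric])
  finally show thesis using that[of "P f"] proj_props(1) by (simp add: P_def S_Si)
qed

end

section \<open>Riemann-Stieltjes sums of a spectral family\<close>

lemma tagged_partition_mono:
  assumes "tagged_partition a b ts us" "i \<le> j" "j \<le> length us"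
  shows "ts ! i \<le> ts ! j"
  using assms(2,3)
proof (induction j rule: dec_induct)
  case (step n)
  then have "ts ! n < ts ! Suc n" using assms(1) by (auto simp: tagged_partition_def)
  then show ?case using step by simp
qed simp

lemma tagged_partition_ends:
  assumes "tagged_partition a b ts us"
  shows "ts ! 0 = a" "ts ! length us = b" "length ts = Suc (length us)"
proof -
  have p: "ts ! 0 = a" "length ts = Suc (length us)" "last ts = b" using assms by (auto simp: tagged_partition_def)
  then have "ts \<noteq> []" by auto
  then show "ts ! 0 = a" "ts ! length us = b" "length ts = Suc (length us)"
    using p by (auto simp: last_conv_nth)
qed

text \<open>The integral quantifies over all sufficiently fine partitions; its uniqueness, and
  estimates read off its sums, need such partitions to exist.\<close>

lemma fine_partition_exists:
  assumes ab: "a < b" and \<delta>: "\<delta> > 0"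
  obtains ts us where "tagged_partition a b ts us" "mesh_less \<delta> ts"
proof -
  obtain n where n: "(b - a) / \<delta> < real n" using reals_Archimedean2 by blast
  have "0 < (b - a) / \<delta>" using ab \<delta> by simp
  then have n0: "real n > 0" using n by linarith
  define p where "p i = a + real i * ((b - a) / real n)" for i
  define ts where "ts = map p [0..<Suc n]"
  define us where "us = map p [0..<n]"
  have len: "length ts = Suc n" "length us = n" by (auto simp: ts_def us_def)
  have nth: "ts ! i = p i" if "i \<le> n" for i using that by (simp add: ts_def del: upt_Suc)
  have nth': "us ! i = p i" if "i < n" for i using that by (simp add: us_def)
  have step: "p (Suc i) - p i = (b - a) / real n" for i
    unfolding p_def by (simp add: add_divide_distrib[symmetric] diff_divide_distrib[symmetric] algebra_simps)
  have pos: "(b - a) / real n > 0" using ab n0 by simp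
  have small: "(b - a) / real n < \<delta>" using n n0 \<delta> by (simp add: field_simps)
  have lt: "p i < p (Suc i)" for i using step[of i] pos by linarith
  have "last ts = ts ! n" using last_conv_nth[of ts] len by force
  then have "last ts = b" using n0 by (simp add: nth p_def)
  moreover have "ts ! 0 = a" by (simp add: nth p_def)
  ultimately have "tagged_partition a b ts us"
    using lt by (auto simp: tagged_partition_def len nth nth' less_imp_le)
  moreover have "mesh_less \<delta> ts" using step small by (simp add: mesh_less_def len nth)
  ultimately show thesis using that by blast
qed

text \<open>Needed for the projections \<open>E s\<close> and for \<open>Si\<close>, which carries
  the integral back from T to B.\<close>

lemma RS_has_integral_bounded_linear:
  assumes F: "bounded_linear F" and int: "RS_has_integral f G a b I"
  shows "RS_has_integral f (\<lambda>t. F (G t)) a b (F I)"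
  unfolding RS_has_integral_def
proof (intro allI impI)
  fix e :: real assume e: "e > 0"
  obtain K where K: "K > 0" "\<And>x. norm (F x) \<le> norm x * K" using bounded_linear.pos_bounded[OF F] by blast
  have lin: "linear F" by (rule bounded_linear.linear[OF F])
  obtain \<delta> where \<delta>: "\<delta> > 0"
    "\<And>ts us. tagged_partition a b ts us \<and> mesh_less \<delta> ts \<Longrightarrow> norm (RS_sum f G ts us - I) < e / K"
    using int e K(1) unfolding RS_has_integral_def by (metis divide_pos_pos)
  have "norm (RS_sum f (\<lambda>t. F (G t)) ts us - F I) < e"
    if "tagged_partition a b ts us \<and> mesh_less \<delta> ts" for ts us
  proof -
    have "RS_sum f (\<lambda>t. F (G t)) ts us - F I = F (RS_sum f G ts us - I)"
      by (simp add: RS_sum_def linear_sum[OF lin] linear_scale[OF lin] linear_diff[OF lin])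
    also have "norm \<dots> \<le> norm (RS_sum f G ts us - I) * K" by (rule K(2))
    also have "\<dots> < e" using \<delta>(2)[OF that] K(1) by (simp add: field_simps)
    finally show ?thesis .
  qed
  then show "\<exists>\<delta>>0. \<forall>ts us. tagged_partition a b ts us \<and> mesh_less \<delta> ts
      \<longrightarrow> norm (RS_sum f (\<lambda>t. F (G t)) ts us - F I) < e"
    using \<delta>(1) by blast
qed

lemma RS_improper_line_bounded_linear:
  assumes F: "bounded_linear F" and int: "RS_improper_line f G v"
  shows "RS_improper_line f (\<lambda>t. F (G t)) (F v)"
proof -
  obtain I where I: "\<And>a b. a < b \<Longrightarrow> RS_has_integral f G a b (I a b)"
    "((\<lambda>p. I (fst p) (snd p)) \<longlongrightarrow> v) (at_bot \<times>\<^sub>F at_top)"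
    using int unfolding RS_improper_line_def by blast
  show ?thesis
    unfolding RS_improper_line_def
    using RS_has_integral_bounded_linear[OF F I(1)] bounded_linear.tendsto[OF F I(2)]
    by (intro exI[of _ "\<lambda>a b. F (I a b)"]) auto
qed

lemma RS_has_integral_unique:
  assumes I: "RS_has_integral f G a b I" and I': "RS_has_integral f G a b I'" and ab: "a < b"
  shows "I = I'"
proof (rule ccontr)
  assume "I \<noteq> I'"
  then have e: "norm (I - I') / 2 > 0" by simp
  obtain \<delta> where \<delta>: "\<delta> > 0"
    "\<And>ts us. tagged_partition a b ts us \<and> mesh_less \<delta> ts \<Longrightarrow> norm (RS_sum f G ts us - I) < norm (I - I') / 2"
    using I e unfolding RS_has_integral_def by meson
  obtain \<delta>' where \<delta>': "\<delta>' > 0"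
    "\<And>ts us. tagged_partition a b ts us \<and> mesh_less \<delta>' ts \<Longrightarrow> norm (RS_sum f G ts us - I') < norm (I - I') / 2"
    using I' e unfolding RS_has_integral_def by meson
  obtain ts us where p: "tagged_partition a b ts us" "mesh_less (min \<delta> \<delta>') ts"
    using fine_partition_exists[OF ab, of "min \<delta> \<delta>'"] \<delta>(1) \<delta>'(1) by auto
  then have "mesh_less \<delta> ts" "mesh_less \<delta>' ts" by (auto simp: mesh_less_def)
  then have "norm (RS_sum f G ts us - I) < norm (I - I') / 2" "norm (RS_sum f G ts us - I') < norm (I - I') / 2"
    using \<delta>(2) \<delta>'(2) p by blast+
  then show False using norm_triangle_sub[of "I - I'" "RS_sum f G ts us - I'"]
      norm_triangle_ineq4[of "RS_sum f G ts us - I'" "RS_sum f G ts us - I"]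
    by (simp add: norm_minus_commute)
qed

lemma eventually_large_interval:
  "\<forall>\<^sub>F p in at_bot \<times>\<^sub>F at_top. fst p < (a::real) \<and> b < (snd p::real)"
  using eventually_prodI[OF eventually_gt_at_bot[of a] eventually_gt_at_top[of b]] by simp

lemma bot_top_nontrivial: "(at_bot :: real filter) \<times>\<^sub>F (at_top :: real filter) \<noteq> bot"
  by (simp add: prod_filter_eq_bot)

lemma RS_improper_line_unique:
  assumes "RS_improper_line f G v" "RS_improper_line f G v'"
  shows "v = v'"
proof -
  obtain I I' where I: "\<And>a b. a < b \<Longrightarrow> RS_has_integral f G a b (I a b)"
    "((\<lambda>p. I (fst p) (snd p)) \<longlongrightarrow> v) (at_bot \<times>\<^sub>F at_top)"
    and I': "\<And>a b. a < b \<Longrightarrow> RS_has_integral f G a b (I' a b)"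
    "((\<lambda>p. I' (fst p) (snd p)) \<longlongrightarrow> v') (at_bot \<times>\<^sub>F at_top)"
    using assms unfolding RS_improper_line_def by blast
  have eq: "\<forall>\<^sub>F p in at_bot \<times>\<^sub>F at_top. I (fst p) (snd p) = I' (fst p) (snd p)"
    using eventually_large_interval[of 0 0]
    by eventually_elim (meson I(1) I'(1) RS_has_integral_unique less_trans)
  have "((\<lambda>p. I' (fst p) (snd p)) \<longlongrightarrow> v) (at_bot \<times>\<^sub>F at_top)"
    by (rule Lim_transform_eventually[OF I(2) eq])
  then show ?thesis using I'(2) tendsto_unique[OF bot_top_nontrivial] by blast
qed

locale spectral_operator = injective_selfadjoint D T
  for D :: "'h::{real_inner,complete_space} set" and T +
  fixes E :: "real \<Rightarrow> 'h \<Rightarrow> 'h"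
  assumes bounded_linear_E: "bounded_linear (E t)"
    and E_symmetric: "inner (E t x) y = inner x (E t y)"
    and E_E: "E s (E t x) = E (min s t) x"
    and E_right: "((\<lambda>s. E s x) \<longlongrightarrow> E t x) (at_right t)"
    and E_bot: "((\<lambda>s. E s x) \<longlongrightarrow> 0) at_bot"
    and E_top: "((\<lambda>s. E s x) \<longlongrightarrow> x) at_top"
    and E_domain: "D = {h. \<exists>v. RS_improper_line (\<lambda>t. t) (\<lambda>t. E t h) v}"
    and E_T: "h \<in> D \<Longrightarrow> RS_improper_line (\<lambda>t. t) (\<lambda>t. E t h) (T h)"
begin

lemma linear_E: "linear (E t)" by (rule bounded_linear.linear[OF bounded_linear_E])

text \<open>For a <= b, the spectral projection of the half-open interval (a, b].\<close>

definition band :: "real \<Rightarrow> real \<Rightarrow> 'h \<Rightarrow> 'h" where "band a b x = E b x - E a x"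

lemma bounded_linear_band: "bounded_linear (band a b)"
  unfolding band_def by (intro bounded_linear_sub bounded_linear_E)
lemma linear_band: "linear (band a b)" by (rule bounded_linear.linear[OF bounded_linear_band])

lemma band_orthogonal:
  assumes "a \<le> b" "b \<le> c" "c \<le> d"
  shows "inner (band a b x) (band c d y) = 0"
  using assms by (simp add: band_def inner_diff_left inner_diff_right E_symmetric E_E min_absorb1)

text \<open>T is given only as an improper integral, so \<open>E s\<close> is applied under the
  integral. Existence of the result gives the domain claim, uniqueness the commutation.\<close>

lemma T_E: "h \<in> D \<Longrightarrow> E s h \<in> D" "h \<in> D \<Longrightarrow> T (E s h) = E s (T h)"
proof -
  assume h: "h \<in> D"
  have "RS_improper_line (\<lambda>t. t) (\<lambda>t. E s (E t h)) (E s (T h))"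
    by (rule RS_improper_line_bounded_linear[OF bounded_linear_E E_T[OF h]])
  then have *: "RS_improper_line (\<lambda>t. t) (\<lambda>t. E t (E s h)) (E s (T h))"
    by (simp add: E_E min.commute)
  show D: "E s h \<in> D" by (subst E_domain) (use * in blast)
  show "T (E s h) = E s (T h)" by (rule RS_improper_line_unique[OF E_T[OF D] *])
qed

lemma T_band: "h \<in> D \<Longrightarrow> band a b h \<in> D" "h \<in> D \<Longrightarrow> T (band a b h) = band a b (T h)"
  by (auto simp: band_def T_E T_diff subspace_diff[OF subspace_D])

text \<open>Bands over a partition are orthogonal, so by Pythagoras errors with a common relative
  bound K add up with the same K, whatever the number of cells.\<close>

lemma partition_bound:
  assumes p: "tagged_partition a b ts us" and K: "K \<ge> 0"
    and le: "\<And>i. i < length us \<Longrightarrow> norm (band (ts ! i) (ts ! Suc i) (z i)) \<le> K * norm (band (ts ! i) (ts ! Suc i) y)"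
  shows "norm (\<Sum>i<length us. band (ts ! i) (ts ! Suc i) (z i)) \<le> K * norm (band a b y)"
proof -
  have orth: "pairwise (\<lambda>i j. orthogonal (band (ts ! i) (ts ! Suc i) (w i)) (band (ts ! j) (ts ! Suc j) (w j))) {..<length us}"
    for w
  proof (rule pairwiseI)
    fix i j assume ij: "i \<in> {..<length us}" "j \<in> {..<length us}" "i \<noteq> j"
    have "inner (band (ts ! i) (ts ! Suc i) (w i)) (band (ts ! j) (ts ! Suc j) (w j)) = 0"
      if "i < j" "j < length us" for i j
      using that by (intro band_orthogonal tagged_partition_mono[OF p]) auto
    then show "orthogonal (band (ts ! i) (ts ! Suc i) (w i)) (band (ts ! j) (ts ! Suc j) (w j))"
      unfolding orthogonal_def using ij by (metis inner_commute lessThan_iff linorder_neqE_nat)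
  qed
  have "(norm (\<Sum>i<length us. band (ts ! i) (ts ! Suc i) (z i)))\<^sup>2
      = (\<Sum>i<length us. (norm (band (ts ! i) (ts ! Suc i) (z i)))\<^sup>2)"
    by (rule norm_sum_Pythagorean[OF _ orth]) simp
  also have "\<dots> \<le> (\<Sum>i<length us. K\<^sup>2 * (norm (band (ts ! i) (ts ! Suc i) y))\<^sup>2)"
    using le by (intro sum_mono) (auto simp: power_mult_distrib[symmetric] intro: power_mono)
  also have "\<dots> = K\<^sup>2 * (norm (\<Sum>i<length us. band (ts ! i) (ts ! Suc i) y))\<^sup>2"
    by (simp add: sum_distrib_left[symmetric] norm_sum_Pythagorean[OF _ orth[of "\<lambda>_. y"]])
  also have "(\<Sum>i<length us. band (ts ! i) (ts ! Suc i) y) = band a b y"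
    using tagged_partition_ends[OF p] by (simp add: band_def sum_lessThan_telescope[of "\<lambda>i. E (ts ! i) y"])
  finally have "(norm (\<Sum>i<length us. band (ts ! i) (ts ! Suc i) (z i)))\<^sup>2 \<le> (K * norm (band a b y))\<^sup>2"
    by (simp add: power_mult_distrib)
  then show ?thesis by (rule power2_le_imp_le) (simp add: K)
qed

lemma RS_sum_band: "RS_sum f (\<lambda>t. E t y) ts us = (\<Sum>i<length us. band (ts ! i) (ts ! Suc i) (f (us ! i) *\<^sub>R y))"
  by (simp add: RS_sum_def band_def linear_scale[OF linear_E] scaleR_diff_right)

text \<open>The sums for T y - s y have coefficients \<open>us ! i - s\<close>. Cells missing the
  interval contribute nothing, and the remaining tags lie within the mesh of it. The later estimates
  of T through E rest on this.\<close>

lemma T_near_scalar: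
  assumes y: "y \<in> D" "E \<alpha> y = 0" "E \<beta> y = y" and r: "r \<ge> 0" and \<alpha>\<beta>: "\<alpha> \<le> \<beta>"
    and sr: "\<And>t. \<alpha> \<le> t \<Longrightarrow> t \<le> \<beta> \<Longrightarrow> \<bar>t - s\<bar> \<le> r"
  shows "norm (T y - s *\<^sub>R y) \<le> r * norm y"
proof -
  obtain I where I: "\<And>a b. a < b \<Longrightarrow> RS_has_integral (\<lambda>t. t) (\<lambda>t. E t y) a b (I a b)"
    "((\<lambda>p. I (fst p) (snd p)) \<longlongrightarrow> T y) (at_bot \<times>\<^sub>F at_top)"
    using E_T[OF y(1)] unfolding RS_improper_line_def by blast
  have low: "E t y = 0" if "t \<le> \<alpha>" for t
    using E_E[of t \<alpha> y] that y(2) by (simp add: min_absorb1 linear_0[OF linear_E])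
  have high: "E t y = y" if "\<beta> \<le> t" for t
    using E_E[of t \<beta> y] that y(3) by (simp add: min_absorb2)
  have "norm (I a b - s *\<^sub>R y) \<le> r * norm y" if ab: "a < \<alpha>" "\<beta> < b" "a < b" for a b
  proof (rule field_le_epsilon)
    fix e :: real assume e: "e > 0"
    define X where "X = norm y + 1"
    have X: "X > 0" by (simp add: X_def add_nonneg_pos)
    define d where "d = e / X / 2"
    have d: "d > 0" using e X by (simp add: d_def)
    have dX: "d * norm y \<le> e / 2"
    proof -
      have "d * norm y \<le> d * X" using d by (simp add: X_def)
      also have "\<dots> = e / 2" using X by (simp add: d_def)
      finally show ?thesis .
    qed
    obtain \<delta> where \<delta>: "\<delta> > 0"
      "\<And>ts us. tagged_partition a b ts us \<and> mesh_less \<delta> ts \<Longrightarrow> norm (RS_sum (\<lambda>t. t) (\<lambda>t. E t y) ts us - I a b) < e / 2"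
      using I(1)[OF ab(3)] e unfolding RS_has_integral_def by (meson half_gt_zero)
    obtain ts us where p: "tagged_partition a b ts us" "mesh_less (min d \<delta>) ts"
      using fine_partition_exists[OF ab(3), of "min d \<delta>"] d \<delta>(1) by auto
    have near: "norm (RS_sum (\<lambda>t. t) (\<lambda>t. E t y) ts us - I a b) < e / 2"
      using p \<delta>(2) by (auto simp: mesh_less_def)
    have "RS_sum (\<lambda>t. t) (\<lambda>t. E t y) ts us - s *\<^sub>R y
        = (\<Sum>i<length us. band (ts ! i) (ts ! Suc i) ((us ! i - s) *\<^sub>R y))"
    proof -
      have "(\<Sum>i<length us. band (ts ! i) (ts ! Suc i) y) = y"
        using tagged_partition_ends[OF p(1)] low[of a] high[of b] ab
        by (simp add: band_def sum_lessThan_telescope[of "\<lambda>i. E (ts ! i) y"])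
      then have "s *\<^sub>R y = (\<Sum>i<length us. band (ts ! i) (ts ! Suc i) (s *\<^sub>R y))"
        by (simp add: linear_scale[OF linear_band] scaleR_sum_right[symmetric])
      then show ?thesis
        by (simp add: RS_sum_band scaleR_diff_left linear_diff[OF linear_band] sum_subtractf)
    qed
    also have "norm \<dots> \<le> (r + d) * norm (band a b y)"
    proof (rule partition_bound[OF p(1)])
      fix i assume i: "i < length us"
      have u: "ts ! i < ts ! Suc i" "ts ! i \<le> us ! i" "us ! i \<le> ts ! Suc i"
        using p(1) i by (auto simp: tagged_partition_def)
      have m: "ts ! Suc i - ts ! i < d"
        using p(2) i tagged_partition_ends(3)[OF p(1)] by (auto simp: mesh_less_def)
      show "norm (band (ts ! i) (ts ! Suc i) ((us ! i - s) *\<^sub>R y)) \<le> (r + d) * norm (band (ts ! i) (ts ! Suc i) y)"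
      proof (cases "ts ! Suc i \<le> \<alpha> \<or> \<beta> \<le> ts ! i")
        case True
        then have "band (ts ! i) (ts ! Suc i) y = 0"
          using u low[of "ts ! i"] low[of "ts ! Suc i"] high[of "ts ! i"] high[of "ts ! Suc i"]
          by (auto simp: band_def)
        then show ?thesis by (simp add: linear_scale[OF linear_band])
      next
        case False
        have "\<bar>us ! i - s\<bar> \<le> r + d"
        proof -
          \<comment> \<open>The point of the interval nearest to the tag; as the cell meets the
            interval, it is no farther away than the mesh.\<close>
          define t where "t = max \<alpha> (min \<beta> (us ! i))"
          have "\<bar>t - s\<bar> \<le> r" using \<alpha>\<beta> by (intro sr) (auto simp: t_def)
          moreover have "\<bar>us ! i - t\<bar> \<le> d" using False u m by (auto simp: t_def max_def min_def)
          ultimately show ?thesis by linarith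
        qed
        then show ?thesis by (simp add: linear_scale[OF linear_band] mult_right_mono)
      qed
    qed (use r d in simp)
    also have "band a b y = y" using low[of a] high[of b] ab by (simp add: band_def)
    finally have "norm (RS_sum (\<lambda>t. t) (\<lambda>t. E t y) ts us - s *\<^sub>R y) \<le> r * norm y + e / 2"
      using dX by (simp add: distrib_right)
    then show "norm (I a b - s *\<^sub>R y) \<le> r * norm y + e"
      using near norm_triangle_ineq4[of "RS_sum (\<lambda>t. t) (\<lambda>t. E t y) ts us - s *\<^sub>R y"
          "RS_sum (\<lambda>t. t) (\<lambda>t. E t y) ts us - I a b"]
      by simp
  qed
  then have ev: "\<forall>\<^sub>F p in at_bot \<times>\<^sub>F at_top. norm (I (fst p) (snd p) - s *\<^sub>R y) \<le> r * norm y"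
    using eventually_large_interval[of "min \<alpha> \<beta>" "max \<alpha> \<beta>"] by (auto elim!: eventually_mono)
  have "((\<lambda>p. norm (I (fst p) (snd p) - s *\<^sub>R y)) \<longlongrightarrow> norm (T y - s *\<^sub>R y)) (at_bot \<times>\<^sub>F at_top)"
    by (intro tendsto_intros I(2))
  from tendsto_upperbound[OF this ev bot_top_nontrivial] show ?thesis .
qed

text \<open>An application of \<open>T_near_scalar\<close> at the midpoint, with half the length as
  radius.\<close>

lemma inner_T_bounds:
  assumes y: "y \<in> D" "E \<alpha> y = 0" "E \<beta> y = y" and \<alpha>\<beta>: "\<alpha> \<le> \<beta>"
  shows "\<alpha> * (norm y)\<^sup>2 \<le> inner (T y) y" and "inner (T y) y \<le> \<beta> * (norm y)\<^sup>2"
proof -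
  define s r where "s = (\<alpha> + \<beta>) / 2" and "r = (\<beta> - \<alpha>) / 2"
  have "norm (T y - s *\<^sub>R y) \<le> r * norm y"
    by (rule T_near_scalar[OF y _ \<alpha>\<beta>]) (use \<alpha>\<beta> in \<open>auto simp: s_def r_def abs_le_iff field_simps\<close>)
  then have "norm (T y - s *\<^sub>R y) * norm y \<le> r * norm y * norm y" by (rule mult_right_mono) simp
  then have "\<bar>inner (T y - s *\<^sub>R y) y\<bar> \<le> r * (norm y)\<^sup>2"
    using Cauchy_Schwarz_ineq2[of "T y - s *\<^sub>R y" y] by (simp add: power2_eq_square mult.assoc)
  then have "\<bar>inner (T y) y - s * (norm y)\<^sup>2\<bar> \<le> r * (norm y)\<^sup>2"
    by (simp add: inner_diff_left power2_norm_eq_inner)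
  moreover have "\<alpha> * (norm y)\<^sup>2 = s * (norm y)\<^sup>2 - r * (norm y)\<^sup>2" "\<beta> * (norm y)\<^sup>2 = s * (norm y)\<^sup>2 + r * (norm y)\<^sup>2"
    by (simp_all add: s_def r_def algebra_simps add_divide_distrib diff_divide_distrib)
  ultimately show "\<alpha> * (norm y)\<^sup>2 \<le> inner (T y) y" "inner (T y) y \<le> \<beta> * (norm y)\<^sup>2" by linarith+
qed

lemma band_ends:
  assumes "a \<le> b"
  shows "E a (band a b x) = 0" and "E b (band a b x) = band a b x"
  using assms by (simp_all add: band_def linear_diff[OF linear_E] E_E min_absorb1 min_absorb2)

text \<open>The squared norm grows at least like exp (2 m x), so its product with exp (- 2 m x) is
  nondecreasing, while boundedness makes that product tend to 0.\<close>

lemma bounded_growth_zero: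
  assumes der: "\<And>x. x > 0 \<Longrightarrow> (y has_vector_derivative - (c *\<^sub>R T (y x))) (at x)"
    and m: "m > 0" and growth: "\<And>x. x > 0 \<Longrightarrow> c * inner (T (y x)) (y x) \<le> - m * (norm (y x))\<^sup>2"
    and bound: "\<forall>\<^sub>F x in at_top. norm (y x) \<le> M" and x: "x > 0"
  shows "y x = 0"
proof -
  define g where "g z = inner (y z) (y z) * exp (- 2 * m * z)" for z
  have g': "\<exists>d. (g has_real_derivative d) (at z) \<and> d \<ge> 0" if z: "z > 0" for z
  proof -
    have "((\<lambda>z. inner (y z) (y z)) has_real_derivative - 2 * (c * inner (T (y z)) (y z))) (at z)"
      using bounded_bilinear.has_vector_derivative[OF bounded_bilinear_inner der[OF z] der[OF z]]
      by (simp add: has_real_derivative_iff_has_vector_derivative inner_commute)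
    moreover have "((\<lambda>z. exp (- 2 * m * z)) has_real_derivative - 2 * m * exp (- 2 * m * z)) (at z)"
      by (auto intro!: derivative_eq_intros)
    ultimately have "(g has_real_derivative - 2 * (c * inner (T (y z)) (y z)) * exp (- 2 * m * z)
        + - 2 * m * exp (- 2 * m * z) * inner (y z) (y z)) (at z)"
      unfolding g_def[abs_def] by (rule DERIV_mult)
    moreover have "0 \<le> exp (- 2 * m * z) * (2 * (- (c * inner (T (y z)) (y z)) - m * inner (y z) (y z)))"
      using growth[OF z] by (intro mult_nonneg_nonneg) (auto simp: power2_norm_eq_inner)
    ultimately show ?thesis by (intro exI conjI) (assumption, simp add: algebra_simps)
  qed
  have mono: "g x \<le> g z" if "x \<le> z" for z
    by (rule DERIV_nonneg_imp_nondecreasing[OF that]) (use g' x in force)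
  have "\<forall>\<^sub>F z in at_top. g x \<le> M\<^sup>2 * exp (- 2 * m * z)"
    using bound eventually_ge_at_top[of x]
  proof eventually_elim
    case (elim z)
    have "inner (y z) (y z) \<le> M\<^sup>2"
      using elim(1) power_mono[of "norm (y z)" M 2] by (simp add: power2_norm_eq_inner)
    then have "g z \<le> M\<^sup>2 * exp (- 2 * m * z)" by (simp add: g_def)
    then show ?case using mono[OF elim(2)] by linarith
  qed
  moreover have "((\<lambda>z. M\<^sup>2 * exp (- 2 * m * z)) \<longlongrightarrow> 0) at_top"
    using tendsto_mult_right_zero[OF power_mult_exp_tendsto_0[of "2 * m" 0], of "M\<^sup>2"] m
    by (simp add: mult.assoc)
  ultimately have "g x \<le> 0" by (intro tendsto_lowerbound[of _ 0 at_top "g x"]) auto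
  then have "inner (y x) (y x) \<le> 0" by (simp add: g_def mult_le_0_iff del: inner_ge_zero)
  then show ?thesis using inner_ge_zero[of "y x"] by (metis inner_eq_zero_iff order_antisym)
qed

lemma band_derivative:
  assumes "(u has_vector_derivative - (c *\<^sub>R T (u x))) (at x)" "u x \<in> D"
  shows "((\<lambda>x. band a b (u x)) has_vector_derivative - (c *\<^sub>R T (band a b (u x)))) (at x)"
  using bounded_linear.has_vector_derivative[OF bounded_linear_band assms(1)]
  by (simp add: T_band assms(2) linear_neg[OF linear_band] linear_scale[OF linear_band])

text \<open>Bands at distance m from 0 on the growing side: negative spectrum for c = 1, positive
  spectrum for reversed time. There an exponential rate exists.\<close>

lemma band_bounded_solution:
  assumes der: "\<And>x. x > 0 \<Longrightarrow> (u has_vector_derivative - (c *\<^sub>R T (u x))) (at x)"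
    and dom: "\<And>x. x > 0 \<Longrightarrow> u x \<in> D" and bound: "\<forall>\<^sub>F x in at_top. norm (u x) \<le> M"
    and m: "m > 0" and ab: "a \<le> b" and growth: "c = 1 \<and> b \<le> - m \<or> c = - 1 \<and> m \<le> a" and x: "x > 0"
  shows "band a b (u x) = 0"
proof -
  obtain K where K: "\<And>y. norm (band a b y) \<le> norm y * K" "K \<ge> 0"
    using bounded_linear.nonneg_bounded[OF bounded_linear_band] by blast
  have bound': "\<forall>\<^sub>F x in at_top. norm (band a b (u x)) \<le> M * K"
    using bound by eventually_elim (use K in \<open>meson mult_right_mono order_trans\<close>)
  show ?thesis
  proof (rule bounded_growth_zero[where y = "\<lambda>x. band a b (u x)", OF _ m _ bound' x])
    show "((\<lambda>x. band a b (u x)) has_vector_derivative - (c *\<^sub>R T (band a b (u x)))) (at x)" if "x > 0" for x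
      by (intro band_derivative der dom that)
    show "c * inner (T (band a b (u x))) (band a b (u x)) \<le> - m * (norm (band a b (u x)))\<^sup>2" if "x > 0" for x
    proof -
      let ?y = "band a b (u x)"
      have "a * (norm ?y)\<^sup>2 \<le> inner (T ?y) ?y" "inner (T ?y) ?y \<le> b * (norm ?y)\<^sup>2"
        by (rule inner_T_bounds[OF T_band(1)[OF dom[OF that]] band_ends(1)[OF ab] band_ends(2)[OF ab] ab])+
      moreover have "b * (norm ?y)\<^sup>2 \<le> - m * (norm ?y)\<^sup>2" if "b \<le> - m"
        by (rule mult_right_mono[OF that]) simp
      moreover have "m * (norm ?y)\<^sup>2 \<le> a * (norm ?y)\<^sup>2" if "m \<le> a"
        by (rule mult_right_mono[OF that]) simp
      ultimately show ?thesis using growth by auto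
    qed
  qed
qed

text \<open>The jump of E at 0 vanishes because T is injective.\<close>

lemma E_0_bounded_solution:
  assumes der: "\<And>x. x > 0 \<Longrightarrow> (u has_vector_derivative - (1 *\<^sub>R T (u x))) (at x)"
    and dom: "\<And>x. x > 0 \<Longrightarrow> u x \<in> D" and bound: "\<forall>\<^sub>F x in at_top. norm (u x) \<le> M" and x: "x > 0"
  shows "E 0 (u x) = 0"
proof -
  have neg: "E b (u x) = 0" if b: "b < 0" for b
  proof (rule tendsto_unique[of at_bot])
    have "\<forall>\<^sub>F a in at_bot. E a (u x) = E b (u x)"
      using eventually_le_at_bot[of b]
    proof eventually_elim
      case (elim a)
      have "band a b (u x) = 0"
        by (rule band_bounded_solution[OF der dom bound, of "- b"]) (use b elim x in auto)
      then show ?case by (simp add: band_def)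
    qed
    then show "((\<lambda>a. E a (u x)) \<longlongrightarrow> E b (u x)) at_bot" by (rule tendsto_eventually)
  qed (auto intro: E_bot)
  define y where "y = E 0 (u x)"
  have y: "y \<in> D" "E 0 y = y" by (auto simp: y_def T_E dom x E_E)
  have Ey: "E b y = 0" if "b < 0" for b
    using neg[OF that] that by (simp add: y_def E_E min_absorb1)
  \<comment> \<open>y lies in the band (- e, 0] for every e > 0, where T is within e of the scalar
    0.\<close>
  have small: "norm (T y) \<le> e * norm y" if "e > 0" for e
    using T_near_scalar[of y "- e" 0 e 0] y Ey[of "- e"] that by simp
  have "norm (T y) \<le> 0"
  proof (rule field_le_epsilon)
    fix e :: real assume e: "e > 0"
    define X where "X = norm y + 1"
    have X: "X > 0" by (simp add: X_def add_nonneg_pos)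
    have "norm (T y) \<le> e / X * norm y" using small[of "e / X"] e X by simp
    also have "\<dots> \<le> e / X * X" using e X by (intro mult_left_mono) (auto simp: X_def)
    finally show "norm (T y) \<le> 0 + e" using X by simp
  qed
  then show ?thesis using T_injective[OF y(1)] by (simp add: y_def)
qed

text \<open>Bands (a, b] with a > 0 vanish; since \<open>E 0\<close> includes the point 0, right
  continuity carries E a (u x) = u x down to a = 0.\<close>

lemma E_0_reversed_solution:
  assumes der: "\<And>x. x > 0 \<Longrightarrow> (u has_vector_derivative - (- 1 *\<^sub>R T (u x))) (at x)"
    and dom: "\<And>x. x > 0 \<Longrightarrow> u x \<in> D" and bound: "\<forall>\<^sub>F x in at_top. norm (u x) \<le> M" and x: "x > 0"
  shows "E 0 (u x) = u x"
proof -
  have pos: "E a (u x) = u x" if a: "a > 0" for a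
  proof (rule tendsto_unique[of at_top])
    have "\<forall>\<^sub>F b in at_top. E b (u x) = E a (u x)"
      using eventually_ge_at_top[of a]
    proof eventually_elim
      case (elim b)
      have "band a b (u x) = 0"
        by (rule band_bounded_solution[OF der dom bound, of a]) (use a elim x in auto)
      then show ?case by (simp add: band_def)
    qed
    then show "((\<lambda>b. E b (u x)) \<longlongrightarrow> E a (u x)) at_top" by (rule tendsto_eventually)
  qed (auto intro: E_top)
  have "((\<lambda>a. E a (u x)) \<longlongrightarrow> u x) (at_right 0)"
    by (rule tendsto_eventually[OF eventually_mono[OF eventually_at_right_less[of 0] pos]])
  then show ?thesis using E_right by (metis tendsto_unique trivial_limit_at_right_real)
qed

section \<open>Identification of \<open>E 0\<close> with the sign decomposition\<close>

lemma orbit_at_0: "(orbit h \<longlongrightarrow> h) (at_right 0)"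
  using continuous_orbit[of h, unfolded continuous_on_def, rule_format, of 0]
  by (simp add: at_within_Ici_at_right orbit_def[of h 0])

lemma eventually_orbit_norm: "\<forall>\<^sub>F x in at_top. norm (orbit h x) \<le> norm h"
  by (rule eventually_mono[OF eventually_ge_at_top[of 0] orbit_norm])

text \<open>Orbits in the two half-spaces are bounded solutions of the forward and the reversed
  equation, where \<open>E 0\<close> is known; their continuity at 0 passes this on to h.\<close>

lemma E_0_half: "h \<in> half 1 \<Longrightarrow> E 0 h = 0" "h \<in> half (- 1) \<Longrightarrow> E 0 h = h"
proof -
  have lim: "((\<lambda>x. E 0 (orbit h x)) \<longlongrightarrow> E 0 h) (at_right 0)"
    by (rule bounded_linear.tendsto[OF bounded_linear_E orbit_at_0])
  have pos: "\<forall>\<^sub>F x in at_right 0. x > (0::real)" by (rule eventually_at_right_less)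
  show "E 0 h = 0" if h: "h \<in> half 1"
  proof -
    have "E 0 (orbit h x) = 0" if "x > 0" for x
      by (rule E_0_bounded_solution[OF orbit_derivative[OF _ h] orbit_domain[OF _ h] eventually_orbit_norm that]) auto
    then have "((\<lambda>x. E 0 (orbit h x)) \<longlongrightarrow> 0) (at_right 0)"
      by (intro tendsto_eventually eventually_mono[OF pos])
    then show ?thesis using lim by (metis tendsto_unique trivial_limit_at_right_real)
  qed
  show "E 0 h = h" if h: "h \<in> half (- 1)"
  proof -
    have eq: "E 0 (orbit h x) = orbit h x" if "x > 0" for x
      by (rule E_0_reversed_solution[OF orbit_derivative[OF _ h] orbit_domain[OF _ h] eventually_orbit_norm that]) auto
    have "((\<lambda>x. E 0 (orbit h x)) \<longlongrightarrow> h) (at_right 0)"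
      using Lim_transform_eventually[OF orbit_at_0 eventually_mono[OF pos eq[symmetric]]] .
    then show ?thesis using lim by (metis tendsto_unique trivial_limit_at_right_real)
  qed
qed

text \<open>For the kernel to lie in \<open>half 1\<close>: the component of h in
  \<open>half (- 1)\<close> is both fixed and annihilated by \<open>E 0\<close>.\<close>

lemma half_eq_kernel: "E 0 h = 0 \<longleftrightarrow> h \<in> half 1"
proof
  assume h: "E 0 h = 0"
  have "E 0 (h - proj h) = h - proj h" by (intro E_0_half proj_props)
  moreover have "E 0 (h - proj h) = 0"
    by (simp add: linear_diff[OF linear_E] h E_0_half(1)[OF proj_props(1)])
  ultimately show "h \<in> half 1" using proj_props(1)[of h] by simp
qed (rule E_0_half)

section \<open>The Stieltjes integral of a decaying solution\<close>

text \<open>The factor exp (s z) almost cancels the evolution on a short band, and the mean value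
  inequality measures what remains. The error is relative to the same band of u 0, as
  \<open>partition_bound\<close> requires.\<close>

lemma band_exponential:
  assumes cont: "continuous_on {0..} u"
    and der: "\<And>x. x > 0 \<Longrightarrow> (u has_vector_derivative - (1 *\<^sub>R T (u x))) (at x)"
    and dom: "\<And>x. x > 0 \<Longrightarrow> u x \<in> D"
    and \<alpha>\<beta>: "0 \<le> \<alpha>" "\<alpha> \<le> s" "s \<le> \<beta>" and x: "x > 0"
  shows "norm (band \<alpha> \<beta> (u x) - exp (- x * s) *\<^sub>R band \<alpha> \<beta> (u 0)) \<le> (\<beta> - \<alpha>) * x * norm (band \<alpha> \<beta> (u 0))"
proof -
  define y where "y x = band \<alpha> \<beta> (u x)" for x
  have \<alpha>\<beta>': "\<alpha> \<le> \<beta>" using \<alpha>\<beta> by simp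
  have cont_y: "continuous_on {0..z} y" for z
    unfolding y_def by (rule bounded_linear.continuous_on[OF bounded_linear_band continuous_on_subset[OF cont]]) auto
  have y': "(y has_vector_derivative - T (y z)) (at z)" if "z > 0" for z
    using band_derivative[OF der[OF that] dom[OF that]] by (simp add: y_def[abs_def])
  have yD: "y z \<in> D" "E \<alpha> (y z) = 0" "E \<beta> (y z) = y z" if "z > 0" for z
    using that by (auto simp: y_def T_band dom band_ends \<alpha>\<beta>')
  have decreasing: "norm (y z) \<le> norm (y 0)" if z: "z \<ge> 0" for z
  proof -
    have "inner (y z) (y z) \<le> inner (y 0) (y 0)"
    proof (rule DERIV_nonpos_imp_decreasing_open[OF z, of "\<lambda>z. inner (y z) (y z)"])
      fix t assume t: "0 < t" "t < z"
      have "((\<lambda>z. inner (y z) (y z)) has_real_derivative - 2 * inner (T (y t)) (y t)) (at t)"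
        using bounded_bilinear.has_vector_derivative[OF bounded_bilinear_inner y'[OF t(1)] y'[OF t(1)]]
        by (simp add: has_real_derivative_iff_has_vector_derivative inner_commute)
      moreover have "0 \<le> inner (T (y t)) (y t)"
        using inner_T_bounds(1)[OF yD[OF t(1)] \<alpha>\<beta>'] \<alpha>\<beta>(1) by (meson mult_nonneg_nonneg order_trans zero_le_power2)
      ultimately show "\<exists>d. ((\<lambda>z. inner (y z) (y z)) has_real_derivative d) (at t) \<and> d \<le> 0"
        by (intro exI conjI) (assumption, simp)
    qed (intro continuous_intros cont_y)
    then show ?thesis by (simp add: norm_le)
  qed
  define w where "w z = exp (s * z) *\<^sub>R y z" for z
  \<comment> \<open>A bound for the derivative of \<open>w\<close>: T is within \<beta> - \<alpha>
    of s, \<open>norm (y z)\<close> is at most \<open>norm (y 0)\<close>, and s is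
    nonnegative.\<close>
  define B where "B = exp (s * x) * ((\<beta> - \<alpha>) * norm (y 0))"
  have "norm (w x - w 0) \<le> B * x - B * 0"
  proof (rule differentiable_bound_general[OF x, of w "\<lambda>z. B * z" _ "\<lambda>_. B"])
    show "continuous_on {0..x} w" unfolding w_def by (intro continuous_intros cont_y)
    show "continuous_on {0..x} (\<lambda>z. B * z)" by (intro continuous_intros)
    fix z assume z: "0 < z" "z < x"
    have e: "((\<lambda>z. exp (s * z)) has_real_derivative s * exp (s * z)) (at z)"
      by (auto intro!: derivative_eq_intros)
    show "(w has_vector_derivative exp (s * z) *\<^sub>R (- T (y z)) + (s * exp (s * z)) *\<^sub>R y z) (at z)"
      unfolding w_def by (rule has_vector_derivative_scaleR[OF e y'[OF z(1)]])
    show "((\<lambda>z. B * z) has_vector_derivative B) (at z)"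
      by (auto intro!: derivative_eq_intros)
    have "exp (s * z) *\<^sub>R (- T (y z)) + (s * exp (s * z)) *\<^sub>R y z = - (exp (s * z) *\<^sub>R (T (y z) - s *\<^sub>R y z))"
      by (simp add: algebra_simps)
    then have "norm (exp (s * z) *\<^sub>R (- T (y z)) + (s * exp (s * z)) *\<^sub>R y z) = exp (s * z) * norm (T (y z) - s *\<^sub>R y z)"
      by simp
    also have "\<dots> \<le> exp (s * x) * ((\<beta> - \<alpha>) * norm (y 0))"
    proof (rule mult_mono)
      have "norm (T (y z) - s *\<^sub>R y z) \<le> (\<beta> - \<alpha>) * norm (y z)"
        by (rule T_near_scalar[OF yD[OF z(1)] _ \<alpha>\<beta>']) (use \<alpha>\<beta> in auto)
      also have "\<dots> \<le> (\<beta> - \<alpha>) * norm (y 0)" using \<alpha>\<beta>' decreasing z by (intro mult_left_mono) auto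
      finally show "norm (T (y z) - s *\<^sub>R y z) \<le> (\<beta> - \<alpha>) * norm (y 0)" .
    qed (use z \<alpha>\<beta> in \<open>auto intro: mult_left_mono\<close>)
    finally show "norm (exp (s * z) *\<^sub>R (- T (y z)) + (s * exp (s * z)) *\<^sub>R y z) \<le> B" by (simp add: B_def)
  qed
  then have "exp (- x * s) * norm (w x - w 0) \<le> exp (- x * s) * (B * x)"
    by (intro mult_left_mono) auto
  moreover have "exp (- x * s) *\<^sub>R (w x - w 0) = y x - exp (- x * s) *\<^sub>R y 0"
    by (simp add: w_def scaleR_diff_right exp_add[symmetric] mult.commute)
  moreover have "exp (- x * s) * (B * x) = (\<beta> - \<alpha>) * x * norm (y 0)"
    by (simp add: B_def exp_minus mult.commute)
  ultimately show ?thesis unfolding y_def by (metis abs_exp_cancel norm_scaleR)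
qed

lemma RS_integral_band:
  assumes cont: "continuous_on {0..} u"
    and der: "\<And>x. x > 0 \<Longrightarrow> (u has_vector_derivative - (1 *\<^sub>R T (u x))) (at x)"
    and dom: "\<And>x. x > 0 \<Longrightarrow> u x \<in> D" and x: "x \<ge> 0" and ab: "0 < a" "a < b"
  shows "RS_has_integral (\<lambda>t. exp (- x * t)) (\<lambda>t. E t (u 0)) a b (band a b (u x))"
  unfolding RS_has_integral_def
proof (intro allI impI)
  fix e :: real assume e: "e > 0"
  define X where "X = x * norm (band a b (u 0)) + 1"
  have X: "X > 0" using x by (simp add: X_def add_nonneg_pos)
  define \<delta> where "\<delta> = e / X"
  have \<delta>: "\<delta> > 0" using e X by (simp add: \<delta>_def)
  have "norm (RS_sum (\<lambda>t. exp (- x * t)) (\<lambda>t. E t (u 0)) ts us - band a b (u x)) < e"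
    if p: "tagged_partition a b ts us" and mesh: "mesh_less \<delta> ts" for ts us
  proof -
    have "(\<Sum>i<length us. band (ts ! i) (ts ! Suc i) (u x)) = band a b (u x)"
      using tagged_partition_ends[OF p] by (simp add: band_def sum_lessThan_telescope[of "\<lambda>i. E (ts ! i) (u x)"])
    then have "RS_sum (\<lambda>t. exp (- x * t)) (\<lambda>t. E t (u 0)) ts us - band a b (u x)
        = (\<Sum>i<length us. band (ts ! i) (ts ! Suc i) (exp (- x * us ! i) *\<^sub>R u 0 - u x))"
      by (simp add: RS_sum_band linear_diff[OF linear_band] sum_subtractf)
    also have "norm \<dots> \<le> (\<delta> * x) * norm (band a b (u 0))"
    proof (rule partition_bound[OF p])
      fix i assume i: "i < length us"
      have u: "ts ! i \<le> us ! i" "us ! i \<le> ts ! Suc i" using p i by (auto simp: tagged_partition_def)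
      have m: "ts ! Suc i - ts ! i < \<delta>"
        using mesh i tagged_partition_ends(3)[OF p] by (auto simp: mesh_less_def)
      have a: "0 \<le> ts ! i"
        using tagged_partition_mono[OF p, of 0 i] tagged_partition_ends(1)[OF p] i ab by simp
      show "norm (band (ts ! i) (ts ! Suc i) (exp (- x * us ! i) *\<^sub>R u 0 - u x))
          \<le> \<delta> * x * norm (band (ts ! i) (ts ! Suc i) (u 0))"
      proof (cases "x = 0")
        case False
        then have x: "x > 0" using x by simp
        have "norm (band (ts ! i) (ts ! Suc i) (exp (- x * us ! i) *\<^sub>R u 0 - u x))
            \<le> (ts ! Suc i - ts ! i) * x * norm (band (ts ! i) (ts ! Suc i) (u 0))"
          using band_exponential[OF cont der dom a u x]
          by (simp add: linear_diff[OF linear_band] linear_scale[OF linear_band] norm_minus_commute)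
        also have "\<dots> \<le> \<delta> * x * norm (band (ts ! i) (ts ! Suc i) (u 0))"
          using m x by (intro mult_right_mono) auto
        finally show ?thesis .
      qed (simp add: linear_0[OF linear_band])
    qed (use \<delta> x in simp)
    also have "\<dots> < \<delta> * X" using \<delta> by (simp add: X_def mult.assoc)
    also have "\<dots> = e" using X by (simp add: \<delta>_def)
    finally show ?thesis .
  qed
  then show "\<exists>\<delta>>0. \<forall>ts us. tagged_partition a b ts us \<and> mesh_less \<delta> ts \<longrightarrow>
      norm (RS_sum (\<lambda>t. exp (- x * t)) (\<lambda>t. E t (u 0)) ts us - band a b (u x)) < e"
    using \<delta> by blast
qed

lemma RS_improper_solution:
  assumes cont: "continuous_on {0..} u"
    and der: "\<And>x. x > 0 \<Longrightarrow> (u has_vector_derivative - (1 *\<^sub>R T (u x))) (at x)"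
    and dom: "\<And>x. x > 0 \<Longrightarrow> u x \<in> D" and kernel: "E 0 (u x) = 0" and x: "x \<ge> 0"
    and F: "bounded_linear F"
  shows "RS_improper_pos (\<lambda>t. exp (- x * t)) (\<lambda>t. F (E t (u 0))) (F (u x))"
  unfolding RS_improper_pos_def
proof (intro exI conjI allI impI)
  fix a b :: real assume "0 < a \<and> a < b"
  then show "RS_has_integral (\<lambda>t. exp (- x * t)) (\<lambda>t. F (E t (u 0))) a b (F (band a b (u x)))"
    by (intro RS_has_integral_bounded_linear[OF F] RS_integral_band[OF cont der dom x]) auto
next
  fix a :: real
  show "((\<lambda>b. F (band a b (u x))) \<longlongrightarrow> F (u x - E a (u x))) at_top"
    unfolding band_def by (intro bounded_linear.tendsto[OF F] tendsto_intros E_top)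
next
  \<comment> \<open>The lower end of the integral tends to 0 from the right, which leaves u x - E 0
    (u x), and \<open>kernel\<close> removes the second term.\<close>
  have "((\<lambda>a. u x - E a (u x)) \<longlongrightarrow> u x - E 0 (u x)) (at_right 0)" by (intro tendsto_intros E_right)
  then show "((\<lambda>a. F (u x - E a (u x))) \<longlongrightarrow> F (u x)) (at_right 0)"
    unfolding kernel diff_0_right by (rule bounded_linear.tendsto[OF F])
qed

end

section \<open>From the complex to the underlying real Hilbert space\<close>

lemma cinner_eq_iff: "cinner Ii x y = cinner Ii x' y' \<longleftrightarrow>
    inner x y = inner x' y' \<and> inner x (Ii y) = inner x' (Ii y')"
  by (simp add: cinner_def)

lemma Ii_adjoint: "complex_structure Ii \<Longrightarrow> inner (Ii x) y = - inner x (Ii y)"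
  unfolding complex_structure_def by (metis inner_minus_left minus_minus)

text \<open>Replacing x by \<open>Ii x\<close> shows that a real adjoint relation is a complex one.\<close>

lemma selfadjoint_maximal:
  assumes Ii: "complex_structure Ii" and A: "selfadjoint Ii D A"
    and adj: "\<And>x. x \<in> D \<Longrightarrow> inner (A x) y = inner x z"
  shows "y \<in> D"
proof -
  have D: "{y. \<exists>z. \<forall>x\<in>D. cinner Ii (A x) y = cinner Ii x z} = D"
    and lin: "clinear_on Ii D A"
    using A by (auto simp: selfadjoint_def)
  have "cinner Ii (A x) y = cinner Ii x z" if x: "x \<in> D" for x
  proof -
    have "Ii x \<in> D" "A (Ii x) = Ii (A x)" using lin x by (auto simp: clinear_on_def)
    then have "inner (A x) (Ii y) = inner x (Ii z)"
      using adj[of "Ii x"] Ii_adjoint[OF Ii] by simp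
    then show ?thesis by (simp add: cinner_eq_iff adj x)
  qed
  then show ?thesis using D by blast
qed

lemma similar_pencilI:
  assumes Ii: "complex_structure Ii" and J: "signature_op Ii J" and L: "strictly_positive Ii DL L"
    and w: "similarity_witness Ii DL (\<lambda>x. J (L x)) S Si DT T"
  shows "similar_pencil DT T J L S Si DL"
proof -
  have S: "bounded_linear S" "bounded_linear Si" "\<And>x. S (Si x) = x" "\<And>x. Si (S x) = x" "S ` DL = DT"
    "\<And>x. x \<in> DT \<Longrightarrow> T x = S (J (L (Si x)))" and T: "selfadjoint Ii DT T"
    using w by (auto simp: similarity_witness_def bounded_clinear_op_def)
  have J': "bounded_linear J" "\<And>x. J (J x) = x" "\<And>x y. inner (J x) y = inner x (J y)"
    using J by (auto simp: signature_op_def bounded_clinear_op_def cinner_eq_iff)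
  have pos: "0 < inner (L h) h" if "h \<in> DL" "h \<noteq> 0" for h
    using L that by (auto simp: strictly_positive_def cinner_def)
  have lin: "clinear_on Ii DT T" using T by (simp add: selfadjoint_def)
  show ?thesis
  proof (intro similar_pencil.intro injective_selfadjoint.intro similar_pencil_axioms.intro)
    show "inner (T x) y = inner x (T y)" if "x \<in> DT" "y \<in> DT" for x y
      using T that by (auto simp: selfadjoint_def cinner_eq_iff)
    show "y \<in> DT" if "\<And>x. x \<in> DT \<Longrightarrow> inner (T x) y = inner x z" for y z
      by (rule selfadjoint_maximal[OF Ii T that])
    show "x = 0" if x: "x \<in> DT" "T x = 0" for x
    proof -
      have "Si x \<in> DL" using x S(4,5) by auto
      have "Si (S (J (L (Si x)))) = Si 0" using x S(6) by simp
      then have "J (L (Si x)) = 0" using linear_0[OF bounded_linear.linear[OF S(2)]] S(4) by simp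
      then have "L (Si x) = 0" using J'(2) linear_0[OF bounded_linear.linear[OF J'(1)]] by metis
      then have "Si x = 0" using pos[OF \<open>Si x \<in> DL\<close>] by auto
      then show "x = 0" using S(3)[of x] linear_0[OF bounded_linear.linear[OF S(1)]] by simp
    qed
    show "closure DT = UNIV" using T by (simp add: selfadjoint_def)
  qed (use lin S J' pos in \<open>auto simp: clinear_on_def\<close>)
qed

lemma spectral_operatorI:
  assumes T: "injective_selfadjoint DT T" and E: "spectral_family Ii DT T E"
  shows "spectral_operator DT T E"
proof (intro spectral_operator.intro spectral_operator_axioms.intro T)
  show "DT = {h. \<exists>v. RS_improper_line (\<lambda>t. t) (\<lambda>t. E t h) v}" using E unfolding spectral_family_def by blast
qed (use E in \<open>auto simp: spectral_family_def bounded_clinear_op_def cinner_eq_iff\<close>)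

lemma Pplus_eq:
  assumes J: "signature_op Ii J"
  shows "Pplus Ii J x = (1/2) *\<^sub>R (x + J x)"
  unfolding Pplus_def orth_proj_def
proof (rule the_equality)
  have J': "linear J" "\<And>x. J (J x) = x" "\<And>x y. inner (J x) y = inner x (J y)" "\<And>x. J (Ii x) = Ii (J x)"
    using J by (auto simp: signature_op_def bounded_clinear_op_def cinner_eq_iff bounded_linear.linear)
  let ?y = "(1/2) *\<^sub>R (x + J x)"
  have Jy: "J ?y = ?y" by (simp add: J' linear_scale[OF J'(1)] linear_add[OF J'(1)] add.commute)
  have orth: "inner (x - ?y) m = 0" if "J m = m" for m
  proof -
    have "inner (J x) m = inner x m" by (simp add: J' that)
    then show ?thesis by (simp add: inner_diff_left inner_add_left)
  qed
  show "?y \<in> Hplus J \<and> (\<forall>m\<in>Hplus J. cinner Ii (x - ?y) m = 0)"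
    using orth Jy by (auto simp: Hplus_def cinner_def J' zero_complex.code complex_eq_iff)
  fix y assume y: "y \<in> Hplus J \<and> (\<forall>m\<in>Hplus J. cinner Ii (x - y) m = 0)"
  have m: "J (y - ?y) = y - ?y" using y Jy by (simp add: Hplus_def linear_diff[OF J'(1)])
  then have "inner (x - y) (y - ?y) = 0"
    using y by (auto simp: Hplus_def cinner_def complex_eq_iff)
  with orth[OF m] have "inner (y - ?y) (y - ?y) = 0" by (simp add: inner_diff_left)
  then show "y = ?y" by simp
qed

section \<open>Existence, uniqueness and integral representation for the boundary problem\<close>

context similar_pencil
begin

lemma is_solution_evolution:
  assumes "is_solution Ii J DL L \<phi> \<psi>"
  shows "evolution 1 \<psi>" and "\<exists>M. \<forall>\<^sub>F x in at_top. norm (\<psi> x) \<le> M" and "Pplus Ii J (\<psi> 0) = \<phi>"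
proof -
  obtain \<psi>' where \<psi>': "\<And>x. x > 0 \<Longrightarrow> (\<psi> has_vector_derivative \<psi>' x) (at x) \<and> \<psi> x \<in> DL \<and> \<psi>' x = - J (L (\<psi> x))"
    "continuous_on {0..} \<psi>"
    using assms unfolding is_solution_def by blast
  moreover have "(\<psi> has_vector_derivative - (1 *\<^sub>R J (L (\<psi> x)))) (at x) \<and> \<psi> x \<in> DL" if "x > 0" for x
    using \<psi>'(1)[OF that] by (metis scaleR_one)
  ultimately show "evolution 1 \<psi>" unfolding evolution_def by blast
qed (use assms in \<open>auto simp: is_solution_def\<close>)

lemma is_solution_exists:
  assumes J: "signature_op Ii J" and \<phi>: "J \<phi> = \<phi>"
  shows "\<exists>\<psi>. is_solution Ii J DL L \<phi> \<psi>"
proof -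
  obtain f where f: "S f \<in> half 1" "(1/2) *\<^sub>R (f + J f) = \<phi>" using initial_value_exists[OF \<phi>] .
  define \<psi> where "\<psi> x = Si (orbit (S f) x)" for x
  have ev: "evolution 1 \<psi>" unfolding \<psi>_def using f(1) by (intro evolution_orbit) auto
  define \<psi>' where "\<psi>' x = - Si (T (orbit (S f) x))" for x
  have "continuous_on {0<..} \<psi>'"
    unfolding \<psi>'_def
    by (intro continuous_intros bounded_linear.continuous_on[OF bounded_linear_Si]
        continuous_orbit_derivative[of 1] f) simp
  moreover have "(\<psi> has_vector_derivative \<psi>' x) (at x) \<and> \<psi> x \<in> DL \<and> \<psi>' x = - J (L (\<psi> x))" if x: "x > 0" for x
  proof -
    have "\<psi>' x = - J (L (\<psi> x))"
      using T_eq[OF orbit_domain[OF _ f(1) x]] by (simp add: \<psi>'_def \<psi>_def Si_S)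
    then show ?thesis using ev x by (simp add: evolution_def)
  qed
  moreover obtain K where K: "\<And>y. norm (Si y) \<le> norm y * K" "K \<ge> 0"
    using bounded_linear.nonneg_bounded[OF bounded_linear_Si] by blast
  have "norm (\<psi> x) \<le> norm (S f) * K" if "x \<ge> 0" for x
    unfolding \<psi>_def using K orbit_norm[OF that] by (meson mult_right_mono order_trans)
  then have "\<forall>\<^sub>F x in at_top. norm (\<psi> x) \<le> norm (S f) * K"
    by (rule eventually_mono[OF eventually_ge_at_top[of 0]])
  moreover have "\<psi> 0 = f" by (simp add: \<psi>_def orbit_def Si_S)
  ultimately have "is_solution Ii J DL L \<phi> \<psi>"
    using ev f(2) unfolding is_solution_def Pplus_eq[OF J] evolution_def by blast
  then show ?thesis by blast
qed

text \<open>Linearity of J L on \<open>DL\<close> is inherited from T through the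
  similarity.\<close>

lemma DL_diff:
  assumes "f \<in> DL" "g \<in> DL"
  shows "f - g \<in> DL" and "J (L (f - g)) = J (L f) - J (L g)"
proof -
  have D: "S f \<in> D" "S g \<in> D" using assms S_domain by auto
  then have D': "S (f - g) \<in> D" by (simp add: linear_diff[OF linear_S] subspace_diff[OF subspace_D])
  then show "f - g \<in> DL" using S_domain Si_S by (metis imageE)
  have "S (J (L (f - g))) = S (J (L f) - J (L g))"
    using T_diff[OF D] T_eq[OF D'] T_eq[OF D(1)] T_eq[OF D(2)] by (simp add: Si_S linear_diff[OF linear_S, symmetric])
  then have "Si (S (J (L (f - g)))) = Si (S (J (L f) - J (L g)))" by simp
  then show "J (L (f - g)) = J (L f) - J (L g)" by (simp only: Si_S)
qed

lemma evolution_diff: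
  assumes "evolution c \<psi>1" "evolution c \<psi>2"
  shows "evolution c (\<lambda>x. \<psi>1 x - \<psi>2 x)"
  unfolding evolution_def
proof (intro conjI allI impI)
  show "continuous_on {0..} (\<lambda>x. \<psi>1 x - \<psi>2 x)"
    using assms by (auto simp: evolution_def intro: continuous_on_diff)
  fix x :: real assume x: "x > 0"
  have \<psi>: "\<psi>1 x \<in> DL" "\<psi>2 x \<in> DL" using assms x by (auto simp: evolution_def)
  show "\<psi>1 x - \<psi>2 x \<in> DL" by (rule DL_diff(1)[OF \<psi>])
  have "((\<lambda>x. \<psi>1 x - \<psi>2 x) has_vector_derivative - (c *\<^sub>R J (L (\<psi>1 x))) - - (c *\<^sub>R J (L (\<psi>2 x)))) (at x)"
    using assms x by (intro has_vector_derivative_diff) (auto simp: evolution_def)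
  then show "((\<lambda>x. \<psi>1 x - \<psi>2 x) has_vector_derivative - (c *\<^sub>R J (L (\<psi>1 x - \<psi>2 x)))) (at x)"
    by (simp add: DL_diff(2)[OF \<psi>] scaleR_diff_right)
qed

lemma Pplus_eq_imp:
  assumes J: "signature_op Ii J" and eq: "Pplus Ii J f = Pplus Ii J g"
  shows "J (f - g) = - (f - g)"
proof -
  have "f + J f = g + J g" using eq by (simp add: Pplus_eq[OF J])
  then show ?thesis by (simp add: linear_diff[OF linear_J] algebra_simps)
qed

lemma is_solution_unique:
  assumes J: "signature_op Ii J"
    and \<psi>: "is_solution Ii J DL L \<phi> \<psi>1" "is_solution Ii J DL L \<phi> \<psi>2" and x: "x \<ge> 0"
  shows "\<psi>1 x = \<psi>2 x"
proof -
  obtain M1 M2 where M: "\<forall>\<^sub>F x in at_top. norm (\<psi>1 x) \<le> M1" "\<forall>\<^sub>F x in at_top. norm (\<psi>2 x) \<le> M2"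
    using is_solution_evolution(2)[OF \<psi>(1)] is_solution_evolution(2)[OF \<psi>(2)] by blast
  have "\<forall>\<^sub>F x in at_top. norm (\<psi>1 x - \<psi>2 x) \<le> M1 + M2"
    using M by eventually_elim (metis add_mono norm_triangle_ineq4 order_trans)
  moreover have "J (\<psi>1 0 - \<psi>2 0) = - (\<psi>1 0 - \<psi>2 0)"
    using is_solution_evolution(3)[OF \<psi>(1)] is_solution_evolution(3)[OF \<psi>(2)]
    by (intro Pplus_eq_imp[OF J]) simp
  ultimately have "\<psi>1 x - \<psi>2 x = 0"
    by (intro evolution_unique[OF evolution_diff[OF is_solution_evolution(1)[OF \<psi>(1)] is_solution_evolution(1)[OF \<psi>(2)]]
          _ _ x])
  then show ?thesis by simp
qed

lemma is_solution_stieltjes: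
  assumes J: "signature_op Ii J" and E: "spectral_operator D T E"
    and sol: "is_solution Ii J DL L \<phi> \<psi>" and x: "x \<ge> 0"
  shows "RS_improper_pos (\<lambda>t. exp (- x * t))
      (\<lambda>t. transported_family S Si E t (Rplus Ii J (transported_family S Si E) \<phi>)) (\<psi> x)"
proof -
  interpret spectral_operator D T E by (rule E)
  note ev = is_solution_evolution(1)[OF sol]
  obtain M where M: "\<forall>\<^sub>F x in at_top. norm (\<psi> x) \<le> M" using is_solution_evolution(2)[OF sol] by blast
  have half0: "S (\<psi> 0) \<in> half 1" by (rule evolution_initial_in_half[OF ev _ M]) simp
  \<comment> \<open>This identifies H^B_+ with the preimage of \<open>half 1\<close> under S, so
    \<open>kernel_half\<close> resolves the definite description in \<open>Rplus\<close>.\<close>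
  have kernel: "transported_family S Si E 0 h = 0 \<longleftrightarrow> S h \<in> half 1" for h
  proof -
    have "Si (E 0 (S h)) = 0 \<longleftrightarrow> E 0 (S h) = 0"
      using S_Si[of "E 0 (S h)"] linear_0[OF linear_S] linear_0[OF linear_Si] by auto
    then show ?thesis by (simp add: transported_family_def half_eq_kernel)
  qed
  have "Rplus Ii J (transported_family S Si E) \<phi> = \<psi> 0"
    unfolding Rplus_def kernel
  proof (rule the_equality)
    show "S (\<psi> 0) \<in> half 1 \<and> Pplus Ii J (\<psi> 0) = \<phi>" using half0 is_solution_evolution(3)[OF sol] by blast
    fix h assume h: "S h \<in> half 1 \<and> Pplus Ii J h = \<phi>"
    have "h - \<psi> 0 = 0"
    proof (rule kernel_half)
      show "S (h - \<psi> 0) \<in> half 1"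
        using h half0 by (simp add: linear_diff[OF linear_S] subspace_diff[OF subspace_half])
      show "J (h - \<psi> 0) = - (h - \<psi> 0)"
        using h is_solution_evolution(3)[OF sol] by (intro Pplus_eq_imp[OF J]) simp
    qed
    then show "h = \<psi> 0" by simp
  qed
  moreover have "RS_improper_pos (\<lambda>t. exp (- x * t)) (\<lambda>t. Si (E t (S (\<psi> 0)))) (Si (S (\<psi> x)))"
  proof (rule RS_improper_solution[where u = "\<lambda>x. S (\<psi> x)"])
    show "continuous_on {0..} (\<lambda>x. S (\<psi> x))"
      using ev by (auto simp: evolution_def intro: bounded_linear.continuous_on[OF bounded_linear_S])
    have "S (\<psi> x) \<in> half 1"
      using half0 evolution_in_half[OF ev _ M, of x] x by (cases "x = 0") auto
    then show "E 0 (S (\<psi> x)) = 0" by (simp add: half_eq_kernel)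
  qed (use evolution_similar[OF ev] x bounded_linear_Si in auto)
  ultimately show ?thesis by (simp add: transported_family_def Si_S)
qed

end

theorem theorem2:
  fixes Ii J L :: "'h::{real_inner,complete_space} \<Rightarrow> 'h"
    and DL :: "'h set"
    and \<phi> :: 'h
  assumes "complex_structure Ii"
    and "signature_op Ii J"
    and "strictly_positive Ii DL L"
    and "similar_to_selfadjoint Ii DL (\<lambda>x. J (L x))"
    and "\<phi> \<in> Hplus J"
  shows "(\<exists>\<psi>. is_solution Ii J DL L \<phi> \<psi>)
    \<and> (\<forall>\<psi>1 \<psi>2. is_solution Ii J DL L \<phi> \<psi>1 \<and> is_solution Ii J DL L \<phi> \<psi>2
          \<longrightarrow> (\<forall>x\<ge>0. \<psi>1 x = \<psi>2 x))
    \<and> (\<forall>\<psi> S Si DT T E. is_solution Ii J DL L \<phi> \<psi>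
          \<and> similarity_witness Ii DL (\<lambda>x. J (L x)) S Si DT T
          \<and> spectral_family Ii DT T E
          \<longrightarrow> (\<forall>x\<ge>0. RS_improper_pos (\<lambda>t. exp (- x * t))
                 (\<lambda>t. transported_family S Si E t (Rplus Ii J (transported_family S Si E) \<phi>))
                 (\<psi> x)))"
proof -
  obtain S Si DT T where w: "similarity_witness Ii DL (\<lambda>x. J (L x)) S Si DT T"
    using assms(4) unfolding similar_to_selfadjoint_def by blast
  interpret similar_pencil DT T J L S Si DL by (rule similar_pencilI[OF assms(1-3) w])
  have "J \<phi> = \<phi>" using assms(5) by (simp add: Hplus_def)
  moreover have "RS_improper_pos (\<lambda>t. exp (- x * t))
      (\<lambda>t. transported_family S' Si' E t (Rplus Ii J (transported_family S' Si' E) \<phi>)) (\<psi> x)"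
    if "is_solution Ii J DL L \<phi> \<psi>" "similarity_witness Ii DL (\<lambda>x. J (L x)) S' Si' DT' T'"
      "spectral_family Ii DT' T' E" "x \<ge> 0" for \<psi> S' Si' DT' T' E x
  proof -
    \<comment> \<open>The integral formula is claimed for every similarity to a self-adjoint
      operator, so the locale is entered again with the given one.\<close>
    interpret w': similar_pencil DT' T' J L S' Si' DL by (rule similar_pencilI[OF assms(1-3) that(2)])
    have "spectral_operator DT' T' E"
      by (rule spectral_operatorI[OF w'.injective_selfadjoint_axioms that(3)])
    from w'.is_solution_stieltjes[OF assms(2) this that(1,4)] show ?thesis .
  qed
  ultimately show ?thesis
    using is_solution_exists[OF assms(2)] is_solution_unique[OF assms(2)] by blast
qed

end
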